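(* Let $G$ be a finitely generated group. Suppose the Alexander ideal of $G$ is almost principal, $\Delta^G$ has a single essential variable, and $\Delta^G\not\doteq\mathrm{const}$. Let $\Delta^G\doteq_{\mathbb{C}}\prod_jf_j^{\mu_j}$ be the decomposition of $\Delta^G$ into irreducible factors over $\mathbb{C}$. Then: (1) The set $\bigl(\mathcal{V}_1(G)\cap\mathbb{T}_G^0\bigr)\setminus\{1\}$ equals the disjoint union $\coprod_jV(f_j)\setminus\{1\}$. (2) If $1\ne\rho\in V(f_j)$, then $1\le b_1(G,\rho)\le\mu_j$.
   Context: Let $G$ be a finitely generated group, $n=b_1(G)$, and $G_{\mathrm{abf}}=G_{\mathrm{ab}}/\mathrm{Torsion}\cong\mathbb{Z}^n$. Identify $\mathbb{Z}[G_{\mathrm{abf}}]$ with $\Lambda_n=\mathbb{Z}[t_1^{\pm1},\dots,t_n^{\pm1}]$. Let $\mathbb{T}_G=\mathrm{Hom}(G,\mathbb{C}^* )$, with identity component $\mathbb{T}_G^0=\mathrm{Hom}(G_{\mathrm{abf}},\mathbb{C}^* )\cong(\mathbb{C}^* )^n$. For $\rho\in\mathbb{T}_G$, let $\mathbb{C}_\rho$ be the corresponding rank one local system, $b_1(G,\rho)=\dim_{\mathbb{C}}H_1(G;\mathbb{C}_\rho)$, and $\mathcal{V}_1(G)=\{\rho\in\mathbb{T}_G\mid b_1(G,\rho)\ge1\}$. For $f\in\Lambda_n\otimes\mathbb{C}$, $V(f)$ is its zero set in $\mathbb{T}_G^0=(\mathbb{C}^* )^n$. The Alexander module is $A_G=\mathbb{Z}[G_{\mathrm{abf}}]\otimes_{\mathbb{Z}[G]}I_G$,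 where $I_G$ is the augmentation ideal of $\mathbb{Z}[G]$. If $\Lambda_n^h\to\Lambda_n^m\to A_G\to0$ is a presentation, the Alexander ideal $\mathcal{E}_1(A_G)$ is the ideal generated by the minors of size $m-1$ of the presentation matrix (equal to $\Lambda_n$ if $m\le1$, and to $0$ if $m-1>h$). The Alexander polynomial $\Delta^G\in\Lambda_n$ is the greatest common divisor of all elements of $\mathcal{E}_1(A_G)$, well defined up to units. Write $\doteq$ (resp. $\doteq_{\mathbb{C}}$) for equality up to units of $\Lambda_n$ (resp. $\Lambda_n\otimes\mathbb{C}$). One writes $\Delta\doteq\mathrm{const}$ if $\Delta\doteq c$ for some $c\in\mathbb{Z}$ (including $c=0$). In the decomposition into irreducible factors, the $f_j\in\Lambda_n\otimes\mathbb{C}$ are pairwise non-associate irreducible elements and $\mu_j\ge1$. The Alexander ideal is almost principal if there is an integer $d\ge0$ such that $I^d\cdot(\Delta^G)\subset\mathcal{E}_1(A_G)$ over $\mathbb{C}$ (i.e. after extension of these ideals to $\Lambda_n\otimes\mathbb{C}$), where $I$ is the augmentation ideal of $\mathbb{Z}[G_{\mathrm{abf}}]$. An element $\Delta\in\mathbb{Z}[H]$, with $H$ a finitely generated free abelian group, has a single essential variable if $\Delta\doteq\tilde\nu(P)$ for some Laurent polynomial $P\in\mathbb{Z}[\mathbb{Z}]=\mathbb{Z}[t^{\pm1}]$ and some homomorphism $\nu\colon\mathbb{Z}\to H$, where $\tilde\nu\colon\mathbb{Z}[\mathbb{Z}]\to\mathbb{Z}[H]$ is the linear extension of $\nu$.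 *)

theory Defs
  imports
    Complex_Main
    "HOL-Library.Poly_Mapping"
    "HOL-Library.Disjoint_Sets"
    "HOL-Computational_Algebra.Factorial_Ring"
    "Jordan_Normal_Form.Determinant"
    "Jordan_Normal_Form.DL_Submatrix"
begin

text \<open>
  The group \<open>G\<close> is a type of class \<^class>\<open>group_add\<close>: it is written additively, but it need
  not be commutative. The group ring of a group \<open>G\<close> over \<open>R\<close> is the library type
  \<open>G \<Rightarrow>\<^sub>0 R\<close> of finitely supported functions, whose multiplication is convolution.
\<close>

section \<open>Subgroups, abelianization and its maximal torsion-free quotient\<close>

inductive_set subgroup_gen :: "'a::group_add set \<Rightarrow> 'a set" for S where
  zero: "0 \<in> subgroup_gen S"
| base: "s \<in> S \<Longrightarrow> s \<in> subgroup_gen S"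
| diff: "s \<in> subgroup_gen S \<Longrightarrow> t \<in> subgroup_gen S \<Longrightarrow> s - t \<in> subgroup_gen S"

lemma subgroup_gen_uminus: "s \<in> subgroup_gen S \<Longrightarrow> - s \<in> subgroup_gen S"
  using subgroup_gen.diff[OF subgroup_gen.zero, of s S] by simp

lemma subgroup_gen_add:
  "s \<in> subgroup_gen S \<Longrightarrow> t \<in> subgroup_gen S \<Longrightarrow> s + t \<in> subgroup_gen S"
  using subgroup_gen.diff[of s S "- t"] subgroup_gen_uminus[of t S] by simp

definition finitely_generated_group :: "'g::group_add itself \<Rightarrow> bool" where
  "finitely_generated_group _ \<longleftrightarrow> (\<exists>S::'g set. finite S \<and> subgroup_gen S = UNIV)"

definition commutator_subgroup :: "'g::group_add set" where
  "commutator_subgroup = subgroup_gen {x + y - x - y | x y. True}"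

lemma subgroup_gen_diff_sym: "s - t \<in> subgroup_gen S \<Longrightarrow> t - s \<in> subgroup_gen S"
  using subgroup_gen_uminus[of "s - t" S] unfolding minus_diff_eq .

lemma commutator_in: "x + y - x - y \<in> commutator_subgroup"
  unfolding commutator_subgroup_def by (rule subgroup_gen.base) blast

lemma commutator_subgroup_conj:
  fixes x c :: "'g::group_add"
  assumes "c \<in> commutator_subgroup"
  shows "x + c - x \<in> commutator_subgroup"
proof -
  have "(x + c - x - c) + c \<in> commutator_subgroup"
    using commutator_in[of x c] assms unfolding commutator_subgroup_def by (rule subgroup_gen_add)
  then show ?thesis by simp
qed

quotient_type (overloaded) 'g ab = "'g::group_add" / "\<lambda>x y. x - y \<in> commutator_subgroup"
  morphisms rep_ab to_ab
proof (rule equivpI)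
  show "reflp (\<lambda>x y::'g. x - y \<in> commutator_subgroup)"
    unfolding commutator_subgroup_def by (rule reflpI) (simp add: subgroup_gen.zero)
  show "symp (\<lambda>x y::'g. x - y \<in> commutator_subgroup)"
    unfolding commutator_subgroup_def
    by (rule sympI) (rule subgroup_gen_diff_sym)
  show "transp (\<lambda>x y::'g. x - y \<in> commutator_subgroup)"
    unfolding commutator_subgroup_def
  proof (rule transpI)
    fix x y z :: 'g
    let ?C = "subgroup_gen {x + y - x - y | x y::'g. True}"
    assume "x - y \<in> ?C" "y - z \<in> ?C"
    then have "(x - y) + (y - z) \<in> ?C" by (rule subgroup_gen_add)
    then show "x - z \<in> ?C" by (simp add: add_diff_eq)
  qed
qed

instantiation ab :: (group_add) ab_group_add
begin

lift_definition zero_ab :: "'a ab" is 0 .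

lift_definition plus_ab :: "'a ab \<Rightarrow> 'a ab \<Rightarrow> 'a ab" is "(+)"
proof -
  fix x y x' y' :: 'a
  assume "x - y \<in> commutator_subgroup" "x' - y' \<in> commutator_subgroup"
  then have "(x + (x' - y') - x) + (x - y) \<in> commutator_subgroup"
    using subgroup_gen_add commutator_subgroup_conj[of "x' - y'" x]
    unfolding commutator_subgroup_def by simp
  moreover have "(x + (x' - y') - x) + (x - y) = x + x' - (y + y')"
    by (simp only: add_diff_eq diff_add_cancel diff_add_eq_diff_diff_swap)
  ultimately show "x + x' - (y + y') \<in> commutator_subgroup" by simp
qed

lift_definition uminus_ab :: "'a ab \<Rightarrow> 'a ab" is uminus
proof -
  fix x y :: 'a
  assume "x - y \<in> commutator_subgroup"
  then have "- (x - y) \<in> commutator_subgroup"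
    unfolding commutator_subgroup_def by (rule subgroup_gen_uminus)
  then have "- y + (y - x) - (- y) \<in> commutator_subgroup"
    unfolding minus_diff_eq by (rule commutator_subgroup_conj)
  moreover have "- y + (y - x) - (- y) = - x - - y"
    by (simp only: add_diff_eq left_minus diff_0)
  ultimately show "- x - - y \<in> commutator_subgroup" by simp
qed

definition minus_ab :: "'a ab \<Rightarrow> 'a ab \<Rightarrow> 'a ab" where "minus_ab x y = x + - y"

instance
proof
  fix x y z :: "'a ab"
  have zero_in: "(0::'a) \<in> commutator_subgroup"
    unfolding commutator_subgroup_def by (rule subgroup_gen.zero)
  show "x + y + z = x + (y + z)"
    by transfer (simp only: add.assoc diff_self zero_in)
  show "x + y = y + x"
  proof transfer
    fix a b :: 'a
    show "a + b - (b + a) \<in> commutator_subgroup"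
      using commutator_in[of a b] by (simp only: diff_add_eq_diff_diff_swap)
  qed
  show "0 + x = x" by transfer (simp add: zero_in)
  show "- x + x = 0" by transfer (simp add: zero_in)
  show "x - y = x + - y" by (rule minus_ab_def)
qed

end

definition torsion_elem :: "'a::ab_group_add \<Rightarrow> bool" where
  "torsion_elem a \<longleftrightarrow> (\<exists>k>0. (\<Sum>i<(k::nat). a) = 0)"

lemma torsion_elem_zero: "torsion_elem 0"
  unfolding torsion_elem_def by (auto intro: exI[of _ 1])

lemma torsion_elem_uminus: "torsion_elem a \<Longrightarrow> torsion_elem (- a)"
  unfolding torsion_elem_def by (auto simp: sum_negf)

lemma torsion_elem_add:
  assumes "torsion_elem a" "torsion_elem b"
  shows "torsion_elem (a + b)"
proof -
  obtain k l :: nat where k: "k > 0" "(\<Sum>i<k. a) = 0" and l: "l > 0" "(\<Sum>i<l. b) = 0"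
    using assms unfolding torsion_elem_def by blast
  have add: "(\<Sum>i<p + q. c) = (\<Sum>i<p. c) + (\<Sum>i<q. c)" for p q :: nat and c :: 'a
    by (induction q) (simp_all add: add.assoc)
  have block: "(\<Sum>i<p * q. c) = (\<Sum>j<p. \<Sum>i<q. c)" for p q :: nat and c :: 'a
    by (induction p) (simp_all add: add add.commute)
  have "(\<Sum>i<l * k. a) = 0" using block[of a l k] k by simp
  moreover have "(\<Sum>i<l * k. b) = 0" using block[of b k l] l by (simp add: mult.commute)
  ultimately have "(\<Sum>i<l * k. a + b) = 0" by (simp add: sum.distrib)
  then show ?thesis using k l unfolding torsion_elem_def by (intro exI[of _ "l * k"]) simp
qed

quotient_type (overloaded) 'a torsion_free = "'a::ab_group_add" / "\<lambda>x y. torsion_elem (x - y)"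
  morphisms rep_torsion_free to_torsion_free
proof (rule equivpI)
  show "reflp (\<lambda>x y::'a. torsion_elem (x - y))"
    by (rule reflpI) (simp add: torsion_elem_zero)
  show "symp (\<lambda>x y::'a. torsion_elem (x - y))"
  proof (rule sympI)
    fix x y :: 'a
    assume "torsion_elem (x - y)"
    then show "torsion_elem (y - x)" using torsion_elem_uminus[of "x - y"] by simp
  qed
  show "transp (\<lambda>x y::'a. torsion_elem (x - y))"
  proof (rule transpI)
    fix x y z :: 'a
    assume "torsion_elem (x - y)" "torsion_elem (y - z)"
    then have "torsion_elem ((x - y) + (y - z))" by (rule torsion_elem_add)
    then show "torsion_elem (x - z)" by simp
  qed
qed

instantiation torsion_free :: (ab_group_add) ab_group_add
begin

lift_definition zero_torsion_free :: "'a torsion_free" is 0 .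

lift_definition plus_torsion_free :: "'a torsion_free \<Rightarrow> 'a torsion_free \<Rightarrow> 'a torsion_free" is "(+)"
  by (simp only: add_diff_add torsion_elem_add)

lift_definition uminus_torsion_free :: "'a torsion_free \<Rightarrow> 'a torsion_free" is uminus
  by (metis minus_diff_minus torsion_elem_uminus)

definition minus_torsion_free :: "'a torsion_free \<Rightarrow> 'a torsion_free \<Rightarrow> 'a torsion_free" where
  "minus_torsion_free x y = x + - y"

instance
proof
  fix x y z :: "'a torsion_free"
  show "x + y + z = x + (y + z)" by transfer (simp add: torsion_elem_zero add.assoc)
  show "x + y = y + x" by transfer (simp add: torsion_elem_zero add.commute)
  show "0 + x = x" by transfer (simp add: torsion_elem_zero)
  show "- x + x = 0" by transfer (simp add: torsion_elem_zero)
  show "x - y = x + - y" by (rule minus_torsion_free_def)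
qed

end

type_synonym 'g abf = "'g ab torsion_free"

definition to_abf :: "'g::group_add \<Rightarrow> 'g abf" where
  "to_abf g = to_torsion_free (to_ab g)"

section \<open>Group rings and ideals\<close>

text \<open>The ring \<open>\<int>[G\<^sub>a\<^sub>b\<^sub>f]\<close>, i.e. \<open>\<Lambda>\<^sub>n\<close>, and its complexification.\<close>

type_synonym 'g lambda_ring = "'g abf \<Rightarrow>\<^sub>0 int"
type_synonym 'g lambda_ring_C = "'g abf \<Rightarrow>\<^sub>0 complex"

definition complexify :: "('a \<Rightarrow>\<^sub>0 int) \<Rightarrow> ('a \<Rightarrow>\<^sub>0 complex)" where
  "complexify = Poly_Mapping.map of_int"

definition group_ring_map :: "('a \<Rightarrow> 'b) \<Rightarrow> ('a \<Rightarrow>\<^sub>0 int) \<Rightarrow> ('b \<Rightarrow>\<^sub>0 int)" where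
  "group_ring_map \<phi> = frag_extend (\<lambda>a. frag_of (\<phi> a))"

definition augmentation :: "('a \<Rightarrow>\<^sub>0 int) \<Rightarrow> int" where
  "augmentation x = (\<Sum>a\<in>Poly_Mapping.keys x. Poly_Mapping.lookup x a)"

definition augmentation_ideal :: "('a \<Rightarrow>\<^sub>0 int) set" where
  "augmentation_ideal = {x. augmentation x = 0}"

lemma module_times: "Modules.module ((*) :: 'a::comm_ring_1 \<Rightarrow> 'a \<Rightarrow> 'a)"
  by unfold_locales (simp_all add: algebra_simps)

definition ideal_gen :: "'a::comm_ring_1 set \<Rightarrow> 'a set" where
  "ideal_gen S = Modules.module.span (*) S"

definition ideal_prod :: "'a::comm_ring_1 set \<Rightarrow> 'a set \<Rightarrow> 'a set" where
  "ideal_prod I J = ideal_gen {x * y | x y. x \<in> I \<and> y \<in> J}"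

primrec ideal_power :: "'a::comm_ring_1 set \<Rightarrow> nat \<Rightarrow> 'a set" where
  "ideal_power I 0 = UNIV"
| "ideal_power I (Suc d) = ideal_prod I (ideal_power I d)"

definition ideal_extension_C :: "('a::ab_group_add \<Rightarrow>\<^sub>0 int) set \<Rightarrow> ('a \<Rightarrow>\<^sub>0 complex) set" where
  "ideal_extension_C J = ideal_gen (complexify ` J)"

definition eq_up_to_unit :: "'a::comm_ring_1 \<Rightarrow> 'a \<Rightarrow> bool"  (infix \<open>\<doteq>\<close> 50) where
  "a \<doteq> b \<longleftrightarrow> (\<exists>u. u dvd 1 \<and> a = u * b)"

definition is_gcd_of :: "'a::comm_ring_1 \<Rightarrow> 'a set \<Rightarrow> bool" where
  "is_gcd_of D E \<longleftrightarrow> (\<forall>e\<in>E. D dvd e) \<and> (\<forall>c. (\<forall>e\<in>E. c dvd e) \<longrightarrow> c dvd D)"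

definition single_essential_variable :: "('h::ab_group_add \<Rightarrow>\<^sub>0 int) \<Rightarrow> bool" where
  "single_essential_variable D \<longleftrightarrow>
    (\<exists>(P :: int \<Rightarrow>\<^sub>0 int) (\<nu> :: int \<Rightarrow> 'h).
      (\<forall>k l. \<nu> (k + l) = \<nu> k + \<nu> l) \<and> D \<doteq> group_ring_map \<nu> P)"

definition is_const_up_to_unit :: "('h::ab_group_add \<Rightarrow>\<^sub>0 int) \<Rightarrow> bool" where
  "is_const_up_to_unit D \<longleftrightarrow> (\<exists>c::int. D \<doteq> of_int c)"

section \<open>The Alexander module\<close>

text \<open>
  \<open>A\<^sub>G = \<int>[G\<^sub>a\<^sub>b\<^sub>f] \<otimes>\<^sub>\<int>\<^sub>[\<^sub>G\<^sub>] I\<^sub>G\<close> is the free abelian group on pairs \<open>(a, x)\<close>, \<open>x \<in> I\<^sub>G\<close>,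
  modulo the subgroup generated by the following relations. The carrier of the partial
  quotient below forces second components into \<open>I\<^sub>G\<close>.
\<close>

definition tensor_relators ::
    "(('g::group_add lambda_ring \<times> ('g \<Rightarrow>\<^sub>0 int)) \<Rightarrow>\<^sub>0 int) set" where
  "tensor_relators =
     {frag_of (a + b, x) - frag_of (a, x) - frag_of (b, x) | a b x. x \<in> augmentation_ideal}
   \<union> {frag_of (a, x + y) - frag_of (a, x) - frag_of (a, y) | a x y.
        x \<in> augmentation_ideal \<and> y \<in> augmentation_ideal}
   \<union> {frag_of (a * group_ring_map to_abf r, x) - frag_of (a, r * x) | a r x.
        x \<in> augmentation_ideal}"

definition tensor_free ::
    "(('g::group_add lambda_ring \<times> ('g \<Rightarrow>\<^sub>0 int)) \<Rightarrow>\<^sub>0 int) set" where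
  "tensor_free = {z. Poly_Mapping.keys z \<subseteq> UNIV \<times> augmentation_ideal}"

lemma tensor_free_zero: "0 \<in> tensor_free"
  by (simp add: tensor_free_def)

lemma tensor_free_add: "z \<in> tensor_free \<Longrightarrow> w \<in> tensor_free \<Longrightarrow> z + w \<in> tensor_free"
  using keys_add[of z w] unfolding tensor_free_def by blast

lemma tensor_free_uminus: "z \<in> tensor_free \<Longrightarrow> - z \<in> tensor_free"
  unfolding tensor_free_def by simp

definition tensor_eq ::
    "(('g::group_add lambda_ring \<times> ('g \<Rightarrow>\<^sub>0 int)) \<Rightarrow>\<^sub>0 int)
      \<Rightarrow> (('g lambda_ring \<times> ('g \<Rightarrow>\<^sub>0 int)) \<Rightarrow>\<^sub>0 int) \<Rightarrow> bool" where
  "tensor_eq z w \<longleftrightarrow>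
    z \<in> tensor_free \<and> w \<in> tensor_free \<and> z - w \<in> subgroup_gen tensor_relators"

quotient_type (overloaded) 'g alexander_module =
  "('g::group_add lambda_ring \<times> ('g \<Rightarrow>\<^sub>0 int)) \<Rightarrow>\<^sub>0 int" / partial: tensor_eq
proof (rule part_equivpI)
  show "\<exists>z::('g lambda_ring \<times> ('g \<Rightarrow>\<^sub>0 int)) \<Rightarrow>\<^sub>0 int. tensor_eq z z"
    by (rule exI[of _ 0]) (simp add: tensor_eq_def tensor_free_zero subgroup_gen.zero)
  show "symp (tensor_eq :: (('g lambda_ring \<times> ('g \<Rightarrow>\<^sub>0 int)) \<Rightarrow>\<^sub>0 int) \<Rightarrow> _)"
    unfolding tensor_eq_def by (rule sympI) (blast intro: subgroup_gen_diff_sym)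
  show "transp (tensor_eq :: (('g lambda_ring \<times> ('g \<Rightarrow>\<^sub>0 int)) \<Rightarrow>\<^sub>0 int) \<Rightarrow> _)"
  proof (rule transpI)
    fix x y z :: "('g lambda_ring \<times> ('g \<Rightarrow>\<^sub>0 int)) \<Rightarrow>\<^sub>0 int"
    assume "tensor_eq x y" "tensor_eq y z"
    then show "tensor_eq x z"
      using subgroup_gen_add[of "x - y" tensor_relators "y - z"] by (simp add: tensor_eq_def)
  qed
qed

instantiation alexander_module :: (group_add) ab_group_add
begin

lift_definition zero_alexander_module :: "'a alexander_module" is 0
  by (simp add: tensor_eq_def tensor_free_zero subgroup_gen.zero)

lift_definition plus_alexander_module ::
  "'a alexander_module \<Rightarrow> 'a alexander_module \<Rightarrow> 'a alexander_module" is "(+)"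
  unfolding tensor_eq_def
  by (simp only: add_diff_add tensor_free_add subgroup_gen_add simp_thms)

lift_definition uminus_alexander_module :: "'a alexander_module \<Rightarrow> 'a alexander_module" is uminus
  unfolding tensor_eq_def minus_diff_minus by (blast intro: tensor_free_uminus subgroup_gen_uminus)

definition minus_alexander_module ::
  "'a alexander_module \<Rightarrow> 'a alexander_module \<Rightarrow> 'a alexander_module" where
  "minus_alexander_module x y = x + - y"

instance
proof
  fix x y z :: "'a alexander_module"
  show "x + y + z = x + (y + z)"
    by transfer (simp add: tensor_eq_def subgroup_gen.zero tensor_free_add add.assoc)
  show "x + y = y + x"
    by transfer (simp add: tensor_eq_def subgroup_gen.zero tensor_free_add add.commute)
  show "0 + x = x"
    by transfer (simp add: tensor_eq_def)
  show "- x + x = 0"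
    by transfer (simp add: tensor_eq_def subgroup_gen.zero tensor_free_zero)
  show "x - y = x + - y" by (rule minus_alexander_module_def)
qed

end

definition tensor_scale ::
    "'g::group_add lambda_ring \<Rightarrow> (('g lambda_ring \<times> ('g \<Rightarrow>\<^sub>0 int)) \<Rightarrow>\<^sub>0 int)
      \<Rightarrow> (('g lambda_ring \<times> ('g \<Rightarrow>\<^sub>0 int)) \<Rightarrow>\<^sub>0 int)" where
  "tensor_scale c = frag_extend (\<lambda>(a, x). frag_of (c * a, x))"

lemma tensor_scale_frag_of [simp]: "tensor_scale c (frag_of (a, x)) = frag_of (c * a, x)"
  by (simp add: tensor_scale_def)

lemma tensor_scale_diff: "tensor_scale c (z - w) = tensor_scale c z - tensor_scale c w"
  by (simp add: tensor_scale_def frag_extend_diff)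

lemma tensor_scale_add: "tensor_scale c (z + w) = tensor_scale c z + tensor_scale c w"
  by (simp add: tensor_scale_def frag_extend_add)

lemma tensor_scale_zero: "tensor_scale c 0 = 0"
  by (simp add: tensor_scale_def)

lemma tensor_free_diff: "z \<in> tensor_free \<Longrightarrow> w \<in> tensor_free \<Longrightarrow> z - w \<in> tensor_free"
  using tensor_free_add[of z "- w"] tensor_free_uminus[of w] by simp

lemma tensor_free_induct [consumes 1, case_names zero gen diff]:
  assumes "z \<in> tensor_free" "P 0"
    and "\<And>a x. x \<in> augmentation_ideal \<Longrightarrow> P (frag_of (a, x))"
    and "\<And>z w. P z \<Longrightarrow> P w \<Longrightarrow> P (z - w)"
  shows "P z"
  using assms(1)[unfolded tensor_free_def mem_Collect_eq]
  by (rule frag_induction) (use assms in auto)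

lemma tensor_scale_free: "z \<in> tensor_free \<Longrightarrow> tensor_scale c z \<in> tensor_free"
proof (induction z rule: tensor_free_induct)
  case (gen a x)
  then show ?case by (simp add: tensor_free_def)
qed (simp_all add: tensor_scale_zero tensor_scale_diff tensor_free_zero tensor_free_diff)

lemma tensor_scale_relators:
  assumes "z \<in> subgroup_gen tensor_relators"
  shows "tensor_scale c z \<in> subgroup_gen tensor_relators"
  using assms
proof induction
  case zero
  then show ?case by (simp add: tensor_scale_zero subgroup_gen.zero)
next
  case (diff s t)
  then show ?case by (simp add: tensor_scale_diff subgroup_gen.diff)
next
  case (base s)
  then consider
      (left) a b x where "x \<in> augmentation_ideal"
        "s = frag_of (a + b, x) - frag_of (a, x) - frag_of (b, x)"
    | (right) a x y where "x \<in> augmentation_ideal" "y \<in> augmentation_ideal"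
        "s = frag_of (a, x + y) - frag_of (a, x) - frag_of (a, y)"
    | (middle) a r x where "x \<in> augmentation_ideal"
        "s = frag_of (a * group_ring_map to_abf r, x) - frag_of (a, r * x)"
    unfolding tensor_relators_def by blast
  then have "tensor_scale c s \<in> tensor_relators"
  proof cases
    case left
    then have "tensor_scale c s = frag_of (c * a + c * b, x) - frag_of (c * a, x) - frag_of (c * b, x)"
      by (simp add: tensor_scale_diff distrib_left)
    then show ?thesis using left(1) unfolding tensor_relators_def by blast
  next
    case right
    then have "tensor_scale c s = frag_of (c * a, x + y) - frag_of (c * a, x) - frag_of (c * a, y)"
      by (simp add: tensor_scale_diff)
    then show ?thesis using right(1,2) unfolding tensor_relators_def by blast
  next
    case middle
    then have "tensor_scale c s
        = frag_of ((c * a) * group_ring_map to_abf r, x) - frag_of (c * a, r * x)"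
      by (simp add: tensor_scale_diff mult.assoc)
    then show ?thesis using middle(1) unfolding tensor_relators_def by blast
  qed
  then show ?case by (rule subgroup_gen.base)
qed

lemma tensor_scale_mult:
  "z \<in> tensor_free \<Longrightarrow> tensor_scale c (tensor_scale d z) = tensor_scale (c * d) z"
  by (induction z rule: tensor_free_induct)
    (simp_all add: tensor_scale_zero tensor_scale_diff mult.assoc)

lemma tensor_scale_one: "z \<in> tensor_free \<Longrightarrow> tensor_scale 1 z = z"
  by (induction z rule: tensor_free_induct) (simp_all add: tensor_scale_zero tensor_scale_diff)

lift_definition alexander_scale ::
    "'g::group_add lambda_ring \<Rightarrow> 'g alexander_module \<Rightarrow> 'g alexander_module" is tensor_scale
  unfolding tensor_eq_def tensor_scale_diff[symmetric] by (blast intro: tensor_scale_free tensor_scale_relators)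

lemma module_alexander_scale: "Modules.module (alexander_scale :: 'g::group_add lambda_ring \<Rightarrow> _)"
proof
  fix c d :: "'g lambda_ring" and x y :: "'g alexander_module"
  show "alexander_scale c (x + y) = alexander_scale c x + alexander_scale c y"
    by transfer
      (simp add: tensor_eq_def tensor_scale_add subgroup_gen.zero tensor_free_add tensor_scale_free)
  show "alexander_scale (c + d) x = alexander_scale c x + alexander_scale d x"
  proof transfer
    fix c d :: "'g lambda_ring" and z :: "('g lambda_ring \<times> ('g \<Rightarrow>\<^sub>0 int)) \<Rightarrow>\<^sub>0 int"
    assume "tensor_eq z z"
    then have z: "z \<in> tensor_free" by (simp add: tensor_eq_def)
    have "tensor_scale (c + d) z - (tensor_scale c z + tensor_scale d z)
        \<in> subgroup_gen tensor_relators"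
      using z
    proof (induction z rule: tensor_free_induct)
      case zero
      then show ?case by (simp add: tensor_scale_zero subgroup_gen.zero)
    next
      case (gen a x)
      then have "frag_of ((c + d) * a, x) - frag_of (c * a, x) - frag_of (d * a, x)
          \<in> tensor_relators"
        unfolding tensor_relators_def distrib_right by blast
      then show ?case by (simp add: diff_diff_eq[symmetric] subgroup_gen.base)
    next
      case (diff z w)
      have "tensor_scale (c + d) (z - w) - (tensor_scale c (z - w) + tensor_scale d (z - w))
          = (tensor_scale (c + d) z - (tensor_scale c z + tensor_scale d z))
            - (tensor_scale (c + d) w - (tensor_scale c w + tensor_scale d w))"
        by (simp add: tensor_scale_diff algebra_simps)
      then show ?case using subgroup_gen.diff[OF diff] by simp
    qed
    then show "tensor_eq (tensor_scale (c + d) z) (tensor_scale c z + tensor_scale d z)"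
      using z by (simp add: tensor_eq_def tensor_free_add tensor_scale_free)
  qed
  show "alexander_scale c (alexander_scale d x) = alexander_scale (c * d) x"
    by transfer
      (simp add: tensor_eq_def tensor_scale_mult tensor_scale_free subgroup_gen.zero)
  show "alexander_scale 1 x = x"
    by transfer (simp add: tensor_eq_def tensor_scale_one subgroup_gen.zero)
qed

section \<open>Alexander ideal and almost principality\<close>

text \<open>
  Exactness of \<open>\<Lambda>\<^sup>h \<rightarrow> \<Lambda>\<^sup>m \<rightarrow> A\<^sub>G \<rightarrow> 0\<close>: the first map is multiplication by the \<open>m \<times> h\<close> matrix
  \<open>M\<close>, and the second one sends the \<open>i\<close>-th basis vector to \<open>a i\<close>.
\<close>

definition alexander_presentation ::
    "nat \<Rightarrow> nat \<Rightarrow> 'g::group_add lambda_ring mat \<Rightarrow> (nat \<Rightarrow> 'g alexander_module) \<Rightarrow> bool" where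
  "alexander_presentation m h M a \<longleftrightarrow>
     M \<in> carrier_mat m h
   \<and> (\<forall>z. \<exists>w\<in>carrier_vec m. z = (\<Sum>i<m. alexander_scale (w $ i) (a i)))
   \<and> (\<forall>w\<in>carrier_vec m. (\<Sum>i<m. alexander_scale (w $ i) (a i)) = 0
        \<longleftrightarrow> (\<exists>v\<in>carrier_vec h. w = M *\<^sub>v v))"

definition minors :: "nat \<Rightarrow> 'a::comm_ring_1 mat \<Rightarrow> 'a set" where
  "minors k M = {det (submatrix M I J) | I J.
     I \<subseteq> {..<dim_row M} \<and> J \<subseteq> {..<dim_col M} \<and> card I = k \<and> card J = k}"

text \<open>
  The ideal \<open>\<E>\<^sub>1(A\<^sub>G)\<close> does not depend on the presentation. For \<open>m \<le> 1\<close> the truncated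
  \<open>m - 1 = 0\<close> gives the empty determinant \<open>1\<close>; for \<open>m - 1 > h\<close> there are no minors.
\<close>

definition is_alexander_ideal :: "'g::group_add lambda_ring set \<Rightarrow> bool" where
  "is_alexander_ideal E \<longleftrightarrow>
    (\<exists>m h M a. alexander_presentation m h M (a :: nat \<Rightarrow> 'g alexander_module)
      \<and> E = ideal_gen (minors (m - 1) M))"

definition almost_principal :: "'g::group_add lambda_ring set \<Rightarrow> 'g lambda_ring \<Rightarrow> bool" where
  "almost_principal E D \<longleftrightarrow>
    (\<exists>d. ideal_extension_C (ideal_prod (ideal_power augmentation_ideal d) (ideal_gen {D}))
      \<subseteq> ideal_extension_C E)"

section \<open>Characters and zero sets\<close>

definition character_torus :: "('a::group_add \<Rightarrow> complex) set" where
  "character_torus = {\<rho>. (\<forall>x. \<rho> x \<noteq> 0) \<and> (\<forall>x y. \<rho> (x + y) = \<rho> x * \<rho> y)}"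

text \<open>The identity component \<open>Hom(G\<^sub>a\<^sub>b\<^sub>f, \<complex>\<^sup>*)\<close>, viewed inside \<open>Hom(G, \<complex>\<^sup>*)\<close> by pullback.\<close>

definition character_torus0 :: "('g::group_add \<Rightarrow> complex) set" where
  "character_torus0 = (\<lambda>\<sigma>. \<sigma> \<circ> to_abf) ` (character_torus :: ('g abf \<Rightarrow> complex) set)"

definition eval_character :: "('a \<Rightarrow> complex) \<Rightarrow> ('a \<Rightarrow>\<^sub>0 complex) \<Rightarrow> complex" where
  "eval_character \<sigma> f = (\<Sum>a\<in>Poly_Mapping.keys f. Poly_Mapping.lookup f a * \<sigma> a)"

definition zero_set :: "'g::group_add lambda_ring_C \<Rightarrow> ('g \<Rightarrow> complex) set" where
  "zero_set f = (\<lambda>\<sigma>. \<sigma> \<circ> to_abf) ` {\<sigma> \<in> character_torus. eval_character \<sigma> f = 0}"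

section \<open>Homology with coefficients in a rank one local system\<close>

text \<open>
  Dimension of \<open>V / W\<close> for subspaces \<open>W \<subseteq> V\<close>, following the library's \<^const>\<open>vector_space.dim\<close>
  (and like it \<open>0\<close> if infinite): \<open>S\<close> is a set of representatives, pairwise incongruent
  modulo \<open>W\<close>, of a basis of \<open>V / W\<close>.
\<close>

definition quotient_basis ::
    "('k::field \<Rightarrow> 'v::ab_group_add \<Rightarrow> 'v) \<Rightarrow> 'v set \<Rightarrow> 'v set \<Rightarrow> 'v set \<Rightarrow> bool" where
  "quotient_basis scale V W S \<longleftrightarrow> S \<subseteq> V
   \<and> (\<forall>T u. finite T \<and> T \<subseteq> S \<and> (\<Sum>v\<in>T. scale (u v) v) \<in> W \<longrightarrow> (\<forall>v\<in>T. u v = 0))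
   \<and> (\<forall>v\<in>V. \<exists>s\<in>Modules.module.span scale S. v - s \<in> W)"

definition quotient_dim ::
    "('k::field \<Rightarrow> 'v::ab_group_add \<Rightarrow> 'v) \<Rightarrow> 'v set \<Rightarrow> 'v set \<Rightarrow> nat" where
  "quotient_dim scale V W =
    (if \<exists>S. quotient_basis scale V W S then card (SOME S. quotient_basis scale V W S) else 0)"

definition chain_scale :: "complex \<Rightarrow> ('k \<Rightarrow>\<^sub>0 complex) \<Rightarrow> ('k \<Rightarrow>\<^sub>0 complex)" where
  "chain_scale c = Poly_Mapping.map ((*) c)"

lemma lookup_chain_scale:
  "Poly_Mapping.lookup (chain_scale c x) k = c * Poly_Mapping.lookup x k"
  by (simp add: chain_scale_def Poly_Mapping.map.rep_eq when_def)

lemma vector_space_chain_scale: "vector_space (chain_scale :: complex \<Rightarrow> ('k \<Rightarrow>\<^sub>0 complex) \<Rightarrow> _)"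
  by unfold_locales
    (rule poly_mapping_eqI; simp add: lookup_chain_scale lookup_add algebra_simps)+

text \<open>
  Low degrees of the bar complex \<open>\<complex>\<^sub>\<rho> \<otimes>\<^sub>\<int>\<^sub>[\<^sub>G\<^sub>] Bar\<close>, with \<open>\<complex>\<^sub>\<rho>\<close> the right \<open>\<int>[G]\<close>-module on
  which \<open>g\<close> acts as multiplication by \<open>\<rho> g\<close>:
  \<open>d\<^sub>1 [g] = \<rho>(g) - 1\<close> and \<open>d\<^sub>2 [g|h] = \<rho>(g) [h] - [g h] + [g]\<close>. The same convention gives
  \<open>\<complex>\<^sub>\<rho> \<otimes>\<^sub>\<Lambda> A\<^sub>G = \<complex>\<^sub>\<rho> \<otimes>\<^sub>\<int>\<^sub>[\<^sub>G\<^sub>] I\<^sub>G\<close> for \<open>\<rho>\<close> in the identity component.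
\<close>

definition bar_d1 :: "('g::group_add \<Rightarrow> complex) \<Rightarrow> ('g \<Rightarrow>\<^sub>0 complex) \<Rightarrow> complex" where
  "bar_d1 \<rho> x = (\<Sum>g\<in>Poly_Mapping.keys x. Poly_Mapping.lookup x g * (\<rho> g - 1))"

definition bar_d2 ::
    "('g::group_add \<Rightarrow> complex) \<Rightarrow> (('g \<times> 'g) \<Rightarrow>\<^sub>0 complex) \<Rightarrow> ('g \<Rightarrow>\<^sub>0 complex)" where
  "bar_d2 \<rho> y = (\<Sum>(g, h)\<in>Poly_Mapping.keys y. chain_scale (Poly_Mapping.lookup y (g, h))
     (Poly_Mapping.single h (\<rho> g) - Poly_Mapping.single (g + h) 1 + Poly_Mapping.single g 1))"

text \<open>\<open>b\<^sub>1(G, \<rho>) = dim H\<^sub>1(G; \<complex>\<^sub>\<rho>)\<close>, and the characteristic variety \<open>\<V>\<^sub>1(G)\<close>.\<close>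

definition twisted_b1 :: "('g::group_add \<Rightarrow> complex) \<Rightarrow> nat" where
  "twisted_b1 \<rho> = quotient_dim chain_scale {x. bar_d1 \<rho> x = 0} (Set.range (bar_d2 \<rho>))"

definition characteristic_variety1 :: "('g::group_add \<Rightarrow> complex) set" where
  "characteristic_variety1 = {\<rho> \<in> character_torus. 1 \<le> twisted_b1 \<rho>}"

end

theory Submission
  imports Defs
    "HOL-Computational_Algebra.Formal_Power_Series"
    "HOL-Computational_Algebra.Fundamental_Theorem_Algebra"
    "Jordan_Normal_Form.Char_Poly"
begin

text \<open>The argument compares two integers attached to a character \<open>\<sigma> \<noteq> 1\<close> of \<open>H = G\<^sub>a\<^sub>b\<^sub>f\<close> and its pullback
  \<open>\<rho>\<close> to \<open>G\<close>: the dimension \<open>b\<close> of \<open>H\<^sub>1(G; \<complex>\<^sub>\<rho>)\<close>, and the order of vanishing of \<open>\<Delta>\<close> at \<open>\<sigma>\<close> along a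
  curve of characters.

  Homology is linked to the Alexander matrix by duality. The functionals on \<open>1\<close>-chains that vanish on
  boundaries are the crossed homomorphisms \<open>\<delta>(g + h) = \<rho>(g) \<delta>(h) + \<delta>(g)\<close>; these are the semilinear
  functionals on the Alexander module (\<open>cocycle_induces_semilinear\<close>, \<open>semilinear_induces_cocycle\<close>), and
  those are the vectors in the left kernel of the presentation matrix evaluated at \<open>\<sigma>\<close>
  (\<open>semilinear_in_left_kernel\<close>, \<open>left_kernel_induces_semilinear\<close>). The principal crossed homomorphism
  \<open>\<rho> - 1\<close> is non-zero because \<open>\<rho> \<noteq> 1\<close>, so the left kernel has dimension \<open>b + 1\<close>. With \<open>m\<close> rows, if
  the minors of size \<open>m - 1\<close> all vanish at \<open>\<sigma>\<close>, which \<open>\<Delta>(\<sigma>) = 0\<close> implies, then this dimension is at least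
  \<open>2\<close> and so \<open>b \<ge> 1\<close> (\<open>nontrivial_homology\<close>).

  For the upper bound, deform \<open>\<sigma>\<close> to \<open>y \<mapsto> \<sigma>(y) exp(\<chi>(y) X)\<close> with \<open>\<chi>\<close> in \<open>Hom(H, \<int>)\<close>. Over the power
  series ring, \<open>b + 1\<close> relations between the rows modulo \<open>X\<close> force every minor of size \<open>m - 1\<close> to be
  divisible by \<open>X\<^sup>b\<close> (\<open>power_dvd_minor\<close>). Almost principality passes this divisibility on to \<open>\<Delta>\<close>: some
  power of an element \<open>y - 1\<close> with \<open>\<sigma>(y) \<noteq> 1\<close> multiplies \<open>\<Delta>\<close> into the complexified Alexander ideal, and
  \<open>y - 1\<close> is invertible along the curve. Hence \<open>b\<close> is at most the order of \<open>\<Delta>\<close> along the curve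
  (\<open>twisted_b1_bounds\<close>).

  The single essential variable makes that order computable. Since \<open>H\<close> is free, \<open>\<Delta>\<close> is a Laurent
  polynomial in one basis element \<open>h0\<close> of \<open>H\<close>, and over \<open>\<complex>\<close> it splits into factors \<open>h0 - w\<close>, which are
  prime in \<open>\<complex>[H]\<close>. So each \<open>f\<^sub>j\<close> is associate to some \<open>h0 - w\<^sub>j\<close> (\<open>irreducible_factors_linear\<close>), and the \<open>w\<^sub>j\<close>
  are distinct: the zero sets \<open>\<sigma>(h0) = w\<^sub>j\<close> are disjoint. Choosing \<open>\<chi>(h0) = 1\<close> makes the curve
  transversal to them, so that the order of \<open>\<Delta>\<close> is \<open>\<mu>\<^sub>j\<close> when \<open>\<sigma>(h0) = w\<^sub>j\<close> and \<open>0\<close> when \<open>\<sigma>(h0)\<close> is none of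
  the \<open>w\<^sub>j\<close>.\<close>

section \<open>Linear extension to group algebras\<close>

text \<open>Evaluation of characters and crossed homomorphisms, the bar differentials, and the ring
  homomorphisms out of group rings used below are all of this form. The map \<open>e\<close> places the
  coefficients in the target ring.\<close>

definition lin_ext :: "('c::zero \<Rightarrow> 'r::semiring_0) \<Rightarrow> ('a \<Rightarrow> 'r) \<Rightarrow> ('a \<Rightarrow>\<^sub>0 'c) \<Rightarrow> 'r" where
  "lin_ext e f x = (\<Sum>k\<in>Poly_Mapping.keys x. e (Poly_Mapping.lookup x k) * f k)"

lemma poly_mapping_single_induct [case_names single add]:
  fixes x :: "'a \<Rightarrow>\<^sub>0 'c::comm_monoid_add"
  assumes single: "\<And>k c. P (Poly_Mapping.single k c)" and add: "\<And>x y. P x \<Longrightarrow> P y \<Longrightarrow> P (x + y)"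
  shows "P x"
proof -
  have "P (\<Sum>k\<in>A. Poly_Mapping.single k (Poly_Mapping.lookup x k))" if "finite A" for A
    using that
  proof induction
    case empty
    show ?case using single[of undefined 0] by simp
  next
    case (insert k A)
    then show ?case by (simp add: single add)
  qed
  moreover have "(\<Sum>k\<in>Poly_Mapping.keys x. Poly_Mapping.single k (Poly_Mapping.lookup x k)) = x"
    by (rule poly_mapping_eqI)
      (simp add: lookup_sum lookup_single when_def sum.delta' in_keys_iff)
  ultimately show ?thesis using finite_keys by metis
qed

lemma additive_eq_on_singles:
  fixes F G :: "('a \<Rightarrow>\<^sub>0 'c::ab_group_add) \<Rightarrow> 'r::ab_group_add"
  assumes "additive F" "additive G"
    and "\<And>k c. F (Poly_Mapping.single k c) = G (Poly_Mapping.single k c)"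
  shows "F x = G x"
  by (induction x rule: poly_mapping_single_induct) (simp_all add: assms additive.add)

lemma lin_ext_superset:
  assumes "additive e" "finite A" "Poly_Mapping.keys x \<subseteq> A"
  shows "lin_ext e f x = (\<Sum>k\<in>A. e (Poly_Mapping.lookup x k) * f k)"
  unfolding lin_ext_def using assms
  by (intro sum.mono_neutral_left) (auto simp: in_keys_iff additive.zero)

lemma additive_lin_ext:
  fixes e :: "'c::ab_group_add \<Rightarrow> 'r::ring"
  assumes "additive e"
  shows "additive (lin_ext e f)"
proof
  fix x y :: "'a \<Rightarrow>\<^sub>0 'c"
  let ?A = "Poly_Mapping.keys x \<union> Poly_Mapping.keys y"
  have "lin_ext e f z = (\<Sum>k\<in>?A. e (Poly_Mapping.lookup z k) * f k)" if "z \<in> {x, y, x + y}" for z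
    using that keys_add[of x y] by (intro lin_ext_superset[OF assms]) auto
  then show "lin_ext e f (x + y) = lin_ext e f x + lin_ext e f y"
    by (simp add: lookup_add additive.add[OF assms] distrib_right sum.distrib)
qed

lemma lin_ext_single:
  assumes "additive e"
  shows "lin_ext e f (Poly_Mapping.single k c) = e c * f k"
  by (cases "c = 0") (simp_all add: lin_ext_def additive.zero[OF assms])

lemma additive_compose: "additive F \<Longrightarrow> additive G \<Longrightarrow> additive (\<lambda>x. F (G x))"
  by (simp add: additive_def)

lemma additive_of_int: "additive (of_int :: int \<Rightarrow> 'r::ring_1)"
  by (simp add: additive_def)

lemma additive_id: "additive (\<lambda>x. x)"
  by (simp add: additive_def)

lemma additive_mult_left: "additive (\<lambda>x. c * x :: 'r::ring)"
  by (simp add: additive_def distrib_left)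

lemma additive_mult_right: "additive (\<lambda>x. x * c :: 'r::ring)"
  by (simp add: additive_def distrib_right)

lemma additive_plus: "additive F \<Longrightarrow> additive G \<Longrightarrow> additive (\<lambda>x. F x + G x)"
  by (simp add: additive_def)

lemma additive_single: "additive (\<lambda>c. Poly_Mapping.single k (c :: 'c::ab_group_add))"
  by (simp add: additive_def single_add)

text \<open>By biadditivity it suffices to compare monomials. There, commutativity of the target moves
  coefficients past the values of \<open>f\<close>; the group may be non-commutative.\<close>

lemma lin_ext_mult:
  fixes e :: "'c::ring \<Rightarrow> 'r::comm_ring_1" and f :: "'a::monoid_add \<Rightarrow> 'r"
  assumes e: "additive e" "\<And>a b. e (a * b) = e a * e b"
    and f: "\<And>k l. f (k + l) = f k * f l"
  shows "lin_ext e f (x * y) = lin_ext e f x * lin_ext e f y"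
proof (rule additive_eq_on_singles[of "\<lambda>x. lin_ext e f (x * y)" "\<lambda>x. lin_ext e f x * lin_ext e f y"])
  note A = additive_lin_ext[OF e(1), of f]
  show "additive (\<lambda>x. lin_ext e f (x * y))" "additive (\<lambda>x. lin_ext e f x * lin_ext e f y)"
    by (rule additive_compose[OF A additive_mult_right] additive_compose[OF additive_mult_right A])+
  fix k c
  show "lin_ext e f (Poly_Mapping.single k c * y) = lin_ext e f (Poly_Mapping.single k c) * lin_ext e f y"
  proof (rule additive_eq_on_singles[of "\<lambda>y. lin_ext e f (Poly_Mapping.single k c * y)"])
    show "additive (\<lambda>y. lin_ext e f (Poly_Mapping.single k c * y))"
      "additive (\<lambda>y. lin_ext e f (Poly_Mapping.single k c) * lin_ext e f y)"
      by (rule additive_compose[OF A additive_mult_left] additive_compose[OF additive_mult_left A])+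
  qed (simp add: mult_single lin_ext_single[OF e(1)] e(2) f mult_ac)
qed

lemma lookup_complexify: "Poly_Mapping.lookup (complexify x) k = of_int (Poly_Mapping.lookup x k)"
  by (simp add: complexify_def Poly_Mapping.map.rep_eq when_def)

lemma additive_complexify: "additive complexify"
  by unfold_locales (rule poly_mapping_eqI; simp add: lookup_complexify lookup_add)

lemma complexify_single: "complexify (Poly_Mapping.single k c) = Poly_Mapping.single k (of_int c)"
  by (rule poly_mapping_eqI) (simp add: lookup_complexify lookup_single when_def)

lemma complexify_one: "complexify (1 :: 'a::zero \<Rightarrow>\<^sub>0 int) = 1"
  unfolding single_one[symmetric] complexify_single by simp

lemma complexify_mult:
  fixes x y :: "'a::monoid_add \<Rightarrow>\<^sub>0 int"
  shows "complexify (x * y) = complexify x * complexify y"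
proof (rule additive_eq_on_singles[of "\<lambda>x. complexify (x * y)" "\<lambda>x. complexify x * complexify y"])
  show "additive (\<lambda>x. complexify (x * y))" "additive (\<lambda>x. complexify x * complexify y)"
    by (rule additive_compose[OF additive_complexify additive_mult_right]
        additive_compose[OF additive_mult_right additive_complexify])+
  fix k c
  show "complexify (Poly_Mapping.single k c * y) = complexify (Poly_Mapping.single k c) * complexify y"
  proof (rule additive_eq_on_singles[of "\<lambda>y. complexify (Poly_Mapping.single k c * y)"])
    show "additive (\<lambda>y. complexify (Poly_Mapping.single k c * y))"
      "additive (\<lambda>y. complexify (Poly_Mapping.single k c) * complexify y)"
      by (rule additive_compose[OF additive_complexify additive_mult_left]
        additive_compose[OF additive_mult_left additive_complexify])+
  qed (simp add: mult_single complexify_single)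
qed

lemma complexify_eq_0_iff: "complexify x = 0 \<longleftrightarrow> x = 0"
  by (simp add: poly_mapping_eq_iff fun_eq_iff lookup_complexify)

lemma lin_ext_complexify:
  fixes e :: "complex \<Rightarrow> 'r::ring"
  assumes "additive e"
  shows "lin_ext e f (complexify x) = lin_ext (\<lambda>c. e (of_int c)) f x"
proof -
  have "Poly_Mapping.keys (complexify x) = Poly_Mapping.keys x"
    by (auto simp: in_keys_iff lookup_complexify)
  then show ?thesis by (simp add: lin_ext_def lookup_complexify)
qed

lemma chain_scale_eq_mult: "chain_scale c x = Poly_Mapping.single 0 c * (x :: 'k::monoid_add \<Rightarrow>\<^sub>0 complex)"
  by (simp add: chain_scale_def mult_map_scale_conv_mult)

lemma chain_scale_single: "chain_scale c (Poly_Mapping.single k a) = Poly_Mapping.single k (c * a)"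
  by (rule poly_mapping_eqI) (simp add: lookup_chain_scale lookup_single when_def)

section \<open>Integer multiples and finitely generated torsion-free groups\<close>

definition zmul :: "int \<Rightarrow> 'a::ab_group_add \<Rightarrow> 'a" where
  "zmul k x = (\<Sum>i<nat k. x) - (\<Sum>i<nat (- k). x)"

lemma zmul_of_nat: "zmul (int n) x = (\<Sum>i<n. x)"
  by (simp add: zmul_def)

lemma zmul_minus: "zmul (- k) x = - zmul k x"
  by (simp add: zmul_def)

lemma zmul_nat_diff: "zmul (int m - int n) x = (\<Sum>i<m. x) - (\<Sum>i<n. x)"
proof (cases "n \<le> m")
  case True
  then obtain d where "m = n + d" using le_Suc_ex by blast
  moreover have "(\<Sum>i<n + d. x) = (\<Sum>i<n. x) + (\<Sum>i<d. x)"
    by (induction d) (simp_all add: add_ac)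
  ultimately show ?thesis using zmul_of_nat[of d x] by simp
next
  case False
  then obtain d where "n = m + d" using le_Suc_ex by (metis nat_le_linear)
  moreover have "(\<Sum>i<m + d. x) = (\<Sum>i<m. x) + (\<Sum>i<d. x)"
    by (induction d) (simp_all add: add_ac)
  ultimately show ?thesis using zmul_of_nat[of d x] zmul_minus[of "int d" x] by simp
qed

lemma zmul_add_left: "zmul (k + l) x = zmul k x + zmul l x"
proof -
  obtain a b c d where "k = int a - int b" "l = int c - int d" by (meson int_diff_cases)
  then have kl: "k + l = int (a + c) - int (b + d)" and k: "k = int a - int b" and l: "l = int c - int d"
    by simp_all
  have "zmul (int (a + c) - int (b + d)) x = zmul (int a - int b) x + zmul (int c - int d) x"
  proof -
    have *: "(\<Sum>i<p + q. x) = (\<Sum>i<p. x) + (\<Sum>i<q. x)" for p q :: nat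
      by (induction q) (simp_all add: add_ac)
    show ?thesis unfolding zmul_nat_diff * by simp
  qed
  then show ?thesis unfolding kl k[symmetric] l[symmetric] .
qed

lemma zmul_add_right: "zmul k (x + y) = zmul k x + zmul k y"
  by (simp add: zmul_def sum.distrib)

lemma zmul_0_left [simp]: "zmul 0 x = 0"
  by (simp add: zmul_def)

lemma zmul_1_left [simp]: "zmul 1 x = x"
  by (simp add: zmul_def)

lemma additive_int_eq_zmul:
  assumes "additive (F :: int \<Rightarrow> 'a::ab_group_add)"
  shows "F k = zmul k (F 1)"
proof (induction k rule: int_induct[of _ 0])
  case base
  then show ?case by (simp add: additive.zero[OF assms])
next
  case (step1 i)
  then show ?case by (simp add: additive.add[OF assms] zmul_add_left)
next
  case (step2 i)
  have "zmul (i - 1) (F 1) = zmul i (F 1) - F 1"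
    using zmul_add_left[of "i - 1" 1 "F 1"] by simp
  then show ?case using step2 by (simp add: additive.diff[OF assms])
qed

lemma zmul_zmul: "zmul k (zmul l x) = zmul (k * l) x"
  using additive_int_eq_zmul[of "\<lambda>k. zmul (k * l) x" k]
  by (simp add: additive_def distrib_right zmul_add_left)

lemma additive_zmul:
  assumes "additive F"
  shows "F (zmul k x) = zmul k (F x)"
  using additive_int_eq_zmul[of "\<lambda>k. F (zmul k x)" k] assms
  by (simp add: additive_def zmul_add_left)

lemma torsion_elem_iff_zmul: "torsion_elem a \<longleftrightarrow> (\<exists>k. k \<noteq> 0 \<and> zmul k a = 0)"
proof
  assume "torsion_elem a"
  then obtain n :: nat where "n > 0" "(\<Sum>i<n. a) = 0" unfolding torsion_elem_def by blast
  then show "\<exists>k. k \<noteq> 0 \<and> zmul k a = 0" using zmul_of_nat[of n a] by (intro exI[of _ "int n"]) auto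
next
  assume "\<exists>k. k \<noteq> 0 \<and> zmul k a = 0"
  then obtain k where k: "k \<noteq> 0" "zmul k a = 0" by blast
  then have "zmul \<bar>k\<bar> a = 0" using zmul_minus[of k a] by (simp add: abs_if)
  then have "(\<Sum>i<nat \<bar>k\<bar>. a) = 0" using zmul_of_nat[of "nat \<bar>k\<bar>" a] by simp
  then show "torsion_elem a" using k unfolding torsion_elem_def by (intro exI[of _ "nat \<bar>k\<bar>"]) simp
qed

lemma zmul_0_right [simp]: "zmul k 0 = 0"
  by (simp add: zmul_def)

section \<open>Linear functionals and dimensions of quotients\<close>

interpretation chains: vector_space "chain_scale :: complex \<Rightarrow> ('k \<Rightarrow>\<^sub>0 complex) \<Rightarrow> _"
  by (rule vector_space_chain_scale)

abbreviation pairing :: "('k \<Rightarrow> complex) \<Rightarrow> ('k \<Rightarrow>\<^sub>0 complex) \<Rightarrow> complex" where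
  "pairing \<equiv> lin_ext (\<lambda>c. c)"

lemmas additive_pairing = additive_lin_ext[OF additive_id]

lemma pairing_single: "pairing \<delta> (Poly_Mapping.single k c) = c * \<delta> k" for c :: complex
  by (rule lin_ext_single[OF additive_id])

lemma additive_chain_scale: "additive (chain_scale c)"
  by unfold_locales (simp add: chains.scale_right_distrib)

lemma pairing_chain_scale: "pairing \<delta> (chain_scale c x) = c * pairing \<delta> x"
proof (rule additive_eq_on_singles[of "\<lambda>x. pairing \<delta> (chain_scale c x)" "\<lambda>x. c * pairing \<delta> x"])
  show "additive (\<lambda>x. pairing \<delta> (chain_scale c x))" "additive (\<lambda>x. c * pairing \<delta> x)"
    by (rule additive_compose[OF additive_pairing additive_chain_scale]
        additive_compose[OF additive_mult_left additive_pairing])+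
qed (simp add: chain_scale_single pairing_single)

lemma pairing_sum: "pairing \<delta> (sum f A) = (\<Sum>a\<in>A. pairing \<delta> (f a))"
  by (rule additive.sum[OF additive_pairing])

text \<open>Linear independence of the classes of \<open>S\<close> in the quotient by \<open>W\<close>.\<close>

definition independent_mod :: "('k \<Rightarrow>\<^sub>0 complex) set \<Rightarrow> ('k \<Rightarrow>\<^sub>0 complex) set \<Rightarrow> bool" where
  "independent_mod W S \<longleftrightarrow>
    (\<forall>T u. finite T \<and> T \<subseteq> S \<and> (\<Sum>v\<in>T. chain_scale (u v) v) \<in> W \<longrightarrow> (\<forall>v\<in>T. u v = 0))"

lemma independent_modD:
  "independent_mod W S \<Longrightarrow> finite T \<Longrightarrow> T \<subseteq> S \<Longrightarrow> (\<Sum>v\<in>T. chain_scale (u v) v) \<in> W \<Longrightarrow> v \<in> T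
    \<Longrightarrow> u v = 0"
  unfolding independent_mod_def by blast

lemma independent_mod_subset: "independent_mod W S \<Longrightarrow> T \<subseteq> S \<Longrightarrow> independent_mod W T"
  unfolding independent_mod_def by blast

text \<open>A basis of \<open>W\<close> together with \<open>T\<close> is linearly independent, so coordinates on it extend to
  the whole space.\<close>

lemma dual_functionals:
  assumes W: "chains.subspace W" and T: "independent_mod W T"
  obtains \<delta> where "\<And>t w. t \<in> T \<Longrightarrow> w \<in> W \<Longrightarrow> pairing (\<delta> t) w = 0"
    and "\<And>t t'. t \<in> T \<Longrightarrow> t' \<in> T \<Longrightarrow> pairing (\<delta> t) t' = (if t' = t then 1 else 0)"
proof -
  obtain B where B: "B \<subseteq> W" "chains.independent B" "W \<subseteq> chains.span B"
    using chains.maximal_independent_subset[of W] by blast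
  have notin: "t \<notin> W" if "t \<in> T" for t
    using independent_modD[OF T, of "{t}" "\<lambda>_. 1" t] that by auto
  have indep: "chains.independent (B \<union> T)"
  proof
    assume "chains.dependent (B \<union> T)"
    then obtain S u where S: "finite S" "S \<subseteq> B \<union> T" "\<exists>v\<in>S. u v \<noteq> 0" "(\<Sum>v\<in>S. chain_scale (u v) v) = 0"
      unfolding chains.dependent_explicit by blast
    have "(\<Sum>v\<in>S - T. chain_scale (u v) v) + (\<Sum>v\<in>S \<inter> T. chain_scale (u v) v) = 0"
      using S(4) sum.Int_Diff[OF S(1), of "\<lambda>v. chain_scale (u v) v" T] by (simp add: add.commute)
    moreover have "- (\<Sum>v\<in>S - T. chain_scale (u v) v) \<in> W"
      using S(2) B(1) by (intro chains.subspace_neg[OF W] chains.subspace_sum[OF W] chains.subspace_scale[OF W]) auto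
    ultimately have "(\<Sum>v\<in>S \<inter> T. chain_scale (u v) v) \<in> W" by (simp add: add_eq_0_iff)
    then have uT: "u v = 0" if "v \<in> S \<inter> T" for v
      using independent_modD[OF T, of "S \<inter> T" u v] that S(1) by simp
    then have "(\<Sum>v\<in>S - T. chain_scale (u v) v) = 0"
      using S(4) sum.Int_Diff[OF S(1), of "\<lambda>v. chain_scale (u v) v" T] by simp
    then have "u v = 0" if "v \<in> S - T" for v
      using chains.independentD[OF B(2), of "S - T" u v] that S(1,2) by blast
    then show False using S(3) uT by blast
  qed
  have vs: "vector_space ((*) :: complex \<Rightarrow> complex \<Rightarrow> complex)"
    by unfold_locales (simp_all add: algebra_simps)
  have vp: "vector_space_pair (chain_scale :: complex \<Rightarrow> ('a \<Rightarrow>\<^sub>0 complex) \<Rightarrow> _) ((*) :: complex \<Rightarrow> complex \<Rightarrow> complex)"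
    using vs vector_space_chain_scale by (simp add: vector_space_pair_def)
  have "\<exists>l. Vector_Spaces.linear chain_scale (*) l \<and> (\<forall>x\<in>B \<union> T. l x = (if x = t then 1 else 0))" for t
    by (rule vector_space_pair.linear_independent_extend[OF vp indep])
  then obtain l where l: "\<And>t. Vector_Spaces.linear chain_scale (*) (l t)"
    and lB: "\<And>t x. x \<in> B \<union> T \<Longrightarrow> l t x = (if x = t then 1 else 0 :: complex)"
    by metis
  have lp: "pairing (\<lambda>k. l t (Poly_Mapping.single k 1)) x = l t x" for t x
  proof (rule additive_eq_on_singles[of "pairing _" "l t"])
    interpret Vector_Spaces.linear chain_scale "(*)" "l t" by (rule l)
    show "additive (l t)" by unfold_locales (rule add)
    fix k c
    show "pairing (\<lambda>k. l t (Poly_Mapping.single k 1)) (Poly_Mapping.single k c) = l t (Poly_Mapping.single k c)"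
      using scale[of c "Poly_Mapping.single k 1"] by (simp add: pairing_single chain_scale_single)
  qed (rule additive_pairing)
  show thesis
  proof (rule that[of "\<lambda>t k. l t (Poly_Mapping.single k 1)"])
    fix t w assume t: "t \<in> T" and "w \<in> W"
    interpret Vector_Spaces.linear chain_scale "(*)" "l t" by (rule l)
    have "w \<in> chains.span B" using B \<open>w \<in> W\<close> by blast
    then have "l t w = 0"
    proof (induction rule: chains.span_induct_alt)
      case base
      show ?case by (rule zero)
    next
      case (step c x y)
      then have "x \<noteq> t" using notin[OF t] B(1) by blast
      then have "l t x = 0" using lB step by simp
      then show ?case using step by (simp add: add scale)
    qed
    then show "pairing (\<lambda>k. l t (Poly_Mapping.single k 1)) w = 0" by (simp add: lp)
  qed (simp add: lp lB)
qed

lemma quotient_basis_iff: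
  "quotient_basis chain_scale V W S \<longleftrightarrow>
    S \<subseteq> V \<and> independent_mod W S \<and> (\<forall>v\<in>V. \<exists>s\<in>chains.span S. v - s \<in> W)"
  by (simp add: quotient_basis_def independent_mod_def)

lemma independent_mod_insertI:
  assumes W: "chains.subspace W" and S: "independent_mod W S"
    and v: "\<And>s. s \<in> chains.span S \<Longrightarrow> v - s \<notin> W"
  shows "independent_mod W (insert v S)"
  unfolding independent_mod_def
proof (intro allI impI, elim conjE)
  fix T u assume T: "finite T" "T \<subseteq> insert v S" "(\<Sum>x\<in>T. chain_scale (u x) x) \<in> W"
  have sT: "(\<Sum>x\<in>T. chain_scale (u x) x)
      = (if v \<in> T then chain_scale (u v) v else 0) + (\<Sum>x\<in>T - {v}. chain_scale (u x) x)"
    using T(1) by (simp add: sum.remove)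
  have uv: "u v = 0" if "v \<in> T"
  proof (rule ccontr)
    assume "u v \<noteq> 0"
    define s where "s = chain_scale (- 1 / u v) (\<Sum>x\<in>T - {v}. chain_scale (u x) x)"
    have "s \<in> chains.span S"
      unfolding s_def using T(2) by (intro chains.span_scale chains.span_sum chains.span_base) auto
    moreover have "v - s = chain_scale (1 / u v) (\<Sum>x\<in>T. chain_scale (u x) x)"
      using \<open>u v \<noteq> 0\<close> that by (simp add: sT s_def chains.scale_right_distrib)
    then have "v - s \<in> W" using chains.subspace_scale[OF W T(3)] by simp
    ultimately show False using v by blast
  qed
  then have "(\<Sum>x\<in>T - {v}. chain_scale (u x) x) \<in> W" using T(3) sT by (auto split: if_splits)
  then have "u x = 0" if "x \<in> T - {v}" for x
    using independent_modD[OF S, of "T - {v}" u x] T that by auto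
  then show "\<forall>x\<in>T. u x = 0" using uv by auto
qed

text \<open>An independent set of maximal cardinality is a basis of the quotient. Since the bound applies to
  the finite subsets of any basis, every basis is finite, and the cardinality of the chosen one is
  \<open>0\<close> only if it is empty.\<close>

lemma quotient_dim_bounded:
  assumes W: "chains.subspace W"
    and bound: "\<And>T. finite T \<Longrightarrow> T \<subseteq> V \<Longrightarrow> independent_mod W T \<Longrightarrow> card T \<le> N"
  shows "quotient_dim chain_scale V W \<le> N" and "quotient_dim chain_scale V W = 0 \<longleftrightarrow> V \<subseteq> W"
proof -
  let ?P = "\<lambda>T. finite T \<and> T \<subseteq> V \<and> independent_mod W T"
  have "?P {}" by (simp add: independent_mod_def)
  then obtain S where S: "?P S" and max: "\<And>T. ?P T \<Longrightarrow> card T \<le> card S"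
    using ex_has_greatest_nat[of ?P "{}" card "Suc N"] bound by (metis le_imp_less_Suc)
  have "\<exists>s\<in>chains.span S. v - s \<in> W" if "v \<in> V" for v
  proof (rule ccontr)
    assume none: "\<not> (\<exists>s\<in>chains.span S. v - s \<in> W)"
    then have "?P (insert v S)" using S that independent_mod_insertI[OF W, of S v] by blast
    then have "v \<in> S" using max[of "insert v S"] S by (auto simp: card_insert_if split: if_splits)
    then have "v - v \<notin> W" using none chains.span_base by blast
    then show False using chains.subspace_0[OF W] by simp
  qed
  then have ex: "\<exists>S. quotient_basis chain_scale V W S" using S unfolding quotient_basis_iff by blast
  define B where "B = (SOME S. quotient_basis chain_scale V W S)"
  have B: "B \<subseteq> V" "independent_mod W B" "\<And>v. v \<in> V \<Longrightarrow> \<exists>s\<in>chains.span B. v - s \<in> W"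
    using someI_ex[OF ex] unfolding B_def quotient_basis_iff by blast+
  have dim: "quotient_dim chain_scale V W = card B" using ex by (simp add: quotient_dim_def B_def)
  have fin: "finite B \<and> card B \<le> N"
  proof (rule finite_if_finite_subsets_card_bdd)
    fix F assume "F \<subseteq> B" "finite F"
    then show "card F \<le> N" using bound[of F] B independent_mod_subset[OF B(2)] by blast
  qed
  then show "quotient_dim chain_scale V W \<le> N" by (simp add: dim)
  show "quotient_dim chain_scale V W = 0 \<longleftrightarrow> V \<subseteq> W"
  proof
    assume "quotient_dim chain_scale V W = 0"
    then have "B = {}" using dim fin by simp
    then show "V \<subseteq> W" using B(3) by auto
  next
    assume "V \<subseteq> W"
    then have "v \<notin> B" for v
      using independent_modD[OF B(2), of "{v}" "\<lambda>_. 1" v] B(1) by auto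
    then show "quotient_dim chain_scale V W = 0" using dim by (metis all_not_in_conv card.empty)
  qed
qed

section \<open>Crossed homomorphisms and twisted first homology\<close>

text \<open>Crossed homomorphisms: the \<open>1\<close>-cocycles of \<open>G\<close> with coefficients in \<open>\<complex>\<close>, on which \<open>G\<close> acts
  through \<open>\<rho>\<close>.\<close>

definition cocycle :: "('g::group_add \<Rightarrow> complex) \<Rightarrow> ('g \<Rightarrow> complex) \<Rightarrow> bool" where
  "cocycle \<rho> \<delta> \<longleftrightarrow> (\<forall>g h. \<delta> (g + h) = \<rho> g * \<delta> h + \<delta> g)"

lemma bar_d2_eq_lin_ext:
  "bar_d2 \<rho> = lin_ext (Poly_Mapping.single 0) (\<lambda>(g, h). Poly_Mapping.single h (\<rho> g)
      - Poly_Mapping.single (g + h) 1 + Poly_Mapping.single g 1)"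
  by (rule ext) (simp add: bar_d2_def lin_ext_def chain_scale_eq_mult case_prod_unfold)

lemma additive_bar_d2: "additive (bar_d2 \<rho>)"
  unfolding bar_d2_eq_lin_ext by (rule additive_lin_ext[OF additive_single])

lemma bar_d2_single:
  "bar_d2 \<rho> (Poly_Mapping.single (g, h) c) = chain_scale c (Poly_Mapping.single h (\<rho> g)
      - Poly_Mapping.single (g + h) 1 + Poly_Mapping.single g 1)"
  unfolding bar_d2_eq_lin_ext by (simp add: lin_ext_single[OF additive_single] chain_scale_eq_mult)

lemma bar_d2_chain_scale: "bar_d2 \<rho> (chain_scale c y) = chain_scale c (bar_d2 \<rho> y)"
proof (rule additive_eq_on_singles[of "\<lambda>y. bar_d2 \<rho> (chain_scale c y)" "\<lambda>y. chain_scale c (bar_d2 \<rho> y)"])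
  show "additive (\<lambda>y. bar_d2 \<rho> (chain_scale c y))" "additive (\<lambda>y. chain_scale c (bar_d2 \<rho> y))"
    by (rule additive_compose[OF additive_bar_d2 additive_chain_scale]
        additive_compose[OF additive_chain_scale additive_bar_d2])+
  fix k :: "'a \<times> 'a" and a
  show "bar_d2 \<rho> (chain_scale c (Poly_Mapping.single k a)) = chain_scale c (bar_d2 \<rho> (Poly_Mapping.single k a))"
    by (cases k) (simp add: chain_scale_single bar_d2_single)
qed

lemma subspace_range_bar_d2: "chains.subspace (range (bar_d2 \<rho>))"
  unfolding chains.subspace_def
  using additive.zero[OF additive_bar_d2, of \<rho>]
  by (auto simp: additive.add[OF additive_bar_d2, symmetric] bar_d2_chain_scale[symmetric]
      intro: range_eqI[of _ _ 0])

text \<open>On the bar generator \<open>[g|h]\<close> the pairing of \<open>\<delta>\<close> with the boundary is the defect of the cocycle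
  identity.\<close>

lemma cocycle_iff_pairing_bar_d2: "cocycle \<rho> \<delta> \<longleftrightarrow> (\<forall>y. pairing \<delta> (bar_d2 \<rho> y) = 0)"
proof
  have eq: "pairing \<delta> (bar_d2 \<rho> (Poly_Mapping.single (g, h) c)) = c * (\<rho> g * \<delta> h - \<delta> (g + h) + \<delta> g)" for g h c
    by (simp add: bar_d2_single pairing_chain_scale additive.add[OF additive_pairing]
        additive.diff[OF additive_pairing] pairing_single)
  show "cocycle \<rho> \<delta>" if "\<forall>y. pairing \<delta> (bar_d2 \<rho> y) = 0"
    unfolding cocycle_def
  proof (intro allI)
    fix g h
    have "\<rho> g * \<delta> h - \<delta> (g + h) + \<delta> g = 0" using that eq[of g h 1] by simp
    then show "\<delta> (g + h) = \<rho> g * \<delta> h + \<delta> g" by (simp add: algebra_simps)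
  qed
  assume "cocycle \<rho> \<delta>"
  then have "pairing \<delta> (bar_d2 \<rho> (Poly_Mapping.single k c)) = 0" for k c
    using eq by (cases k) (simp add: cocycle_def)
  then show "\<forall>y. pairing \<delta> (bar_d2 \<rho> y) = 0"
    using additive_eq_on_singles[of "\<lambda>y. pairing \<delta> (bar_d2 \<rho> y)" "\<lambda>_. 0",
        OF additive_compose[OF additive_pairing additive_bar_d2]]
    by (simp add: additive_def)
qed

lemma bar_d1_eq_pairing: "bar_d1 \<rho> = pairing (\<lambda>g. \<rho> g - 1)"
  by (rule ext) (simp add: bar_d1_def lin_ext_def)

lemma cocycle_d1: "(\<And>g h. \<rho> (g + h) = \<rho> g * \<rho> h) \<Longrightarrow> cocycle \<rho> (\<lambda>g. \<rho> g - 1)"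
  by (simp add: cocycle_def algebra_simps)

lemma cocycle_zero:
  assumes "cocycle \<rho> \<delta>" "\<rho> 0 = 1" shows "\<delta> 0 = 0"
proof -
  have "\<delta> (0 + 0) = \<rho> 0 * \<delta> 0 + \<delta> 0" using assms(1) unfolding cocycle_def by blast
  then show ?thesis using assms(2) by simp
qed

text \<open>The functional \<open>d\<^sub>1\<close> vanishes on boundaries and on the cycles in \<open>T\<close>, so it separates \<open>v\<close> from their
  sum. This accounts for the difference \<open>1\<close> between the dimension of the left kernel and that of the
  homology.\<close>

lemma independent_mod_insert_nonprincipal:
  assumes \<rho>: "\<And>g h. \<rho> (g + h) = \<rho> g * \<rho> h" and T: "T \<subseteq> {x. bar_d1 \<rho> x = 0}"
    and ind: "independent_mod (range (bar_d2 \<rho>)) T" and v: "bar_d1 \<rho> v \<noteq> 0"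
  shows "independent_mod (range (bar_d2 \<rho>)) (insert v T)"
proof (rule independent_mod_insertI[OF subspace_range_bar_d2 ind])
  fix s assume "s \<in> chains.span T"
  then have "bar_d1 \<rho> s = 0"
    by (induction rule: chains.span_induct_alt)
      (use T in \<open>auto simp: bar_d1_eq_pairing additive.zero[OF additive_pairing]
        additive.add[OF additive_pairing] pairing_chain_scale\<close>)
  then have "bar_d1 \<rho> (v - s) \<noteq> 0" using v by (simp add: bar_d1_eq_pairing additive.diff[OF additive_pairing])
  then show "v - s \<notin> range (bar_d2 \<rho>)"
    using cocycle_d1[OF \<rho>] by (auto simp: cocycle_iff_pairing_bar_d2 bar_d1_eq_pairing)
qed

text \<open>If all cycles are boundaries, a cocycle vanishes on \<open>ker d\<^sub>1\<close>, hence factors through \<open>d\<^sub>1\<close>. The chain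
  \<open>[g0]\<close> determines the factor.\<close>

lemma cocycle_multiple_of_principal:
  assumes sub: "{x. bar_d1 \<rho> x = 0} \<subseteq> range (bar_d2 \<rho>)" and \<delta>: "cocycle \<rho> \<delta>" and g0: "\<rho> g0 \<noteq> 1"
  shows "\<delta> g = \<delta> g0 / (\<rho> g0 - 1) * (\<rho> g - 1)"
proof -
  let ?x = "Poly_Mapping.single g 1 - Poly_Mapping.single g0 ((\<rho> g - 1) / (\<rho> g0 - 1))"
  have "bar_d1 \<rho> ?x = 0"
    using g0 by (simp add: bar_d1_eq_pairing additive.diff[OF additive_pairing] pairing_single)
  then have "?x \<in> range (bar_d2 \<rho>)" using sub by blast
  then have "pairing \<delta> ?x = 0" using \<delta> unfolding cocycle_iff_pairing_bar_d2 by (metis imageE)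
  then show ?thesis by (simp add: additive.diff[OF additive_pairing] pairing_single)
qed

text \<open>Only the first \<open>m\<close> values of a member matter; functions on \<open>nat\<close> avoid carrier conditions.\<close>

definition left_kernel :: "nat \<Rightarrow> nat \<Rightarrow> complex mat \<Rightarrow> (nat \<Rightarrow> complex) set" where
  "left_kernel m h N = {v. \<forall>l<h. (\<Sum>i<m. v i * N $$ (i, l)) = 0}"

section \<open>Minors of corank one\<close>

text \<open>Viewing vectors of length \<open>m\<close> as finitely supported functions makes the linear algebra of chains
  available for them.\<close>

definition fin_vec :: "nat \<Rightarrow> (nat \<Rightarrow> complex) \<Rightarrow> (nat \<Rightarrow>\<^sub>0 complex)" where
  "fin_vec m v = (\<Sum>i<m. Poly_Mapping.single i (v i))"

lemma lookup_fin_vec: "Poly_Mapping.lookup (fin_vec m v) i = (if i < m then v i else 0)"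
  by (simp add: fin_vec_def lookup_sum lookup_single when_def)

lemma pairing_fin_vec: "pairing u (fin_vec m v) = (\<Sum>i<m. u i * v i)"
  by (simp add: fin_vec_def pairing_sum pairing_single mult.commute)

lemma fin_vec_basis_card:
  assumes B: "B \<subseteq> range (fin_vec m)" "chains.independent B"
  shows "finite B" and "range (fin_vec m) \<subseteq> chains.span B \<Longrightarrow> card B = m"
proof -
  define E where "E = (\<lambda>i. Poly_Mapping.single i (1 :: complex)) ` {..<m}"
  have inj: "inj_on (\<lambda>i. Poly_Mapping.single i (1 :: complex)) {..<m}"
    by (rule inj_onI) (metis lookup_single_eq lookup_single_not_eq zero_neq_one)
  have EV: "E \<subseteq> range (fin_vec m)"
  proof
    fix x assume "x \<in> E"
    then obtain i where "i < m" "x = Poly_Mapping.single i 1" by (auto simp: E_def)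
    then have "x = fin_vec m (\<lambda>j. if j = i then 1 else 0)"
      by (intro poly_mapping_eqI) (simp add: lookup_fin_vec lookup_single when_def)
    then show "x \<in> range (fin_vec m)" by blast
  qed
  have VE: "range (fin_vec m) \<subseteq> chains.span E"
  proof
    fix x assume "x \<in> range (fin_vec m)"
    then obtain v where x: "x = (\<Sum>i<m. Poly_Mapping.single i (v i))" by (auto simp: fin_vec_def)
    have "Poly_Mapping.single i (v i) \<in> chains.span E" if "i < m" for i
      using chains.span_scale[OF chains.span_base, of "Poly_Mapping.single i 1" E "v i"] that
      by (simp add: E_def chain_scale_single)
    then show "x \<in> chains.span E" unfolding x by (intro chains.span_sum) simp
  qed
  have indE: "chains.independent E"
  proof
    assume "chains.dependent E"
    then obtain u i where i: "i < m" "u (Poly_Mapping.single i 1) \<noteq> 0"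
      and "(\<Sum>v\<in>E. chain_scale (u v) v) = 0"
      using chains.dependent_finite[of E] by (auto simp: E_def)
    then have "(\<Sum>j<m. Poly_Mapping.single j (u (Poly_Mapping.single j 1))) = 0"
      by (simp add: E_def sum.reindex[OF inj] chain_scale_single)
    then have "fin_vec m (\<lambda>j. u (Poly_Mapping.single j 1)) = 0" by (simp add: fin_vec_def)
    then show False using lookup_fin_vec[of m "\<lambda>j. u (Poly_Mapping.single j 1)" i] i by simp
  qed
  show "finite B"
    using chains.independent_span_bound[of E B] B VE by (auto simp: E_def)
  assume "range (fin_vec m) \<subseteq> chains.span B"
  then show "card B = m"
    using chains.basis_card_eq_dim[OF B(1) _ B(2)] chains.basis_card_eq_dim[OF EV VE indE] card_image[OF inj]
    by (simp add: E_def)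
qed

lemma invertible_with_rows:
  fixes v :: "'t \<Rightarrow> nat \<Rightarrow> complex"
  assumes T: "finite T"
    and ind: "\<And>c t. (\<And>i. i < m \<Longrightarrow> (\<Sum>t\<in>T. c t * v t i) = 0) \<Longrightarrow> t \<in> T \<Longrightarrow> c t = 0"
  obtains P r where "P \<in> carrier_mat m m" "det P \<noteq> 0" "inj_on r T" "r ` T \<subseteq> {..<m}"
    "\<And>t j. t \<in> T \<Longrightarrow> j < m \<Longrightarrow> P $$ (r t, j) = v t j"
proof -
  define x where "x t = fin_vec m (v t)" for t
  have inj: "inj_on x T"
  proof (rule inj_onI, rule ccontr)
    fix s t assume st: "s \<in> T" "t \<in> T" "x s = x t" "s \<noteq> t"
    then have "v s i = v t i" if "i < m" for i
      using lookup_fin_vec[of m "v s" i] lookup_fin_vec[of m "v t" i] that by (simp add: x_def)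
    then have "(\<Sum>k\<in>T. (if k = s then 1 else if k = t then - 1 else 0) * v k i) = 0" if "i < m" for i
    proof -
      have "(\<Sum>k\<in>T. (if k = s then 1 else if k = t then - 1 else 0) * v k i)
          = (\<Sum>k\<in>{s, t}. (if k = s then 1 else if k = t then - 1 else 0) * v k i)"
        using st T by (intro sum.mono_neutral_right) auto
      then show ?thesis using st \<open>\<And>i. i < m \<Longrightarrow> v s i = v t i\<close> that by simp
    qed
    then show False using ind[of "\<lambda>k. if k = s then 1 else if k = t then - 1 else 0" s] st by simp
  qed
  have "chains.independent (x ` T)"
  proof
    assume "chains.dependent (x ` T)"
    then obtain u t where t: "t \<in> T" "u (x t) \<noteq> 0" and s: "(\<Sum>y\<in>x ` T. chain_scale (u y) y) = 0"
      using chains.dependent_finite[of "x ` T"] T by auto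
    have "(\<Sum>s\<in>T. u (x s) * v s i) = 0" if "i < m" for i
      using arg_cong[OF s, of "\<lambda>y. Poly_Mapping.lookup y i"] that
      unfolding sum.reindex[OF inj] by (simp add: lookup_sum lookup_chain_scale x_def lookup_fin_vec)
    then show False using ind[of "\<lambda>s. u (x s)" t] t by simp
  qed
  then obtain B where B: "x ` T \<subseteq> B" "B \<subseteq> range (fin_vec m)" "chains.independent B"
      "range (fin_vec m) \<subseteq> chains.span B"
    using chains.maximal_independent_subset_extend[of "x ` T" "range (fin_vec m)"] by (auto simp: x_def)
  then have "finite B" "card B = m" using fin_vec_basis_card by blast+
  then obtain f where f: "bij_betw f {..<m} B"
    using ex_bij_betw_nat_finite[of B] by (auto simp: lessThan_atLeast0)
  define P where "P = mat m m (\<lambda>(i, j). Poly_Mapping.lookup (f i) j)"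
  define r where "r t = inv_into {..<m} f (x t)" for t
  have xB: "x t \<in> f ` {..<m}" if "t \<in> T" for t
    using B(1) f that by (auto simp: bij_betw_def)
  have fr: "f (r t) = x t" "r t < m" if "t \<in> T" for t
    using f_inv_into_f[OF xB[OF that]] inv_into_into[OF xB[OF that]] by (simp_all add: r_def)
  have "det P \<noteq> 0"
  proof
    assume "det P = 0"
    then have "det (transpose_mat P) = 0" by (subst det_transpose[of _ m]) (simp_all add: P_def)
    then obtain w where w: "w \<in> carrier_vec m" "w \<noteq> 0\<^sub>v m" "transpose_mat P *\<^sub>v w = 0\<^sub>v m"
      using det_0_iff_vec_prod_zero_field[of "transpose_mat P" m] by (auto simp: P_def)
    have "(\<Sum>i<m. chain_scale (w $ i) (f i)) = 0"
    proof (rule poly_mapping_eqI)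
      fix j
      show "Poly_Mapping.lookup (\<Sum>i<m. chain_scale (w $ i) (f i)) j = Poly_Mapping.lookup 0 j"
      proof (cases "j < m")
        case True
        then have "(transpose_mat P *\<^sub>v w) $ j = 0" using w by simp
        then show ?thesis using True w(1)
          by (simp add: P_def scalar_prod_def lookup_sum lookup_chain_scale lessThan_atLeast0 mult.commute)
      next
        case False
        have "Poly_Mapping.lookup (f i) j = 0" if "i < m" for i
        proof -
          have "f i \<in> range (fin_vec m)" using f B(2) that by (auto simp: bij_betw_def)
          then show ?thesis using False by (auto simp: lookup_fin_vec)
        qed
        then show ?thesis by (simp add: lookup_sum lookup_chain_scale)
      qed
    qed
    then have "(\<Sum>y\<in>B. chain_scale (w $ inv_into {..<m} f y) y) = 0"
      using sum.reindex_bij_betw[OF f, of "\<lambda>y. chain_scale (w $ inv_into {..<m} f y) y"] f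
      by (simp add: bij_betw_def)
    then have "w $ inv_into {..<m} f y = 0" if "y \<in> B" for y
      using chains.independentD[OF B(3) \<open>finite B\<close>] that by simp
    then have "w $ i = 0" if "i < m" for i
      using f that by (metis bij_betw_def image_eqI inv_into_f_f lessThan_iff)
    then have "w = 0\<^sub>v m" using w(1) by (intro eq_vecI) auto
    then show False using w(2) by simp
  qed
  moreover have "inj_on r T"
    by (rule inj_onI) (metis fr(1) inj inj_onD)
  moreover have "P $$ (r t, j) = v t j" if "t \<in> T" "j < m" for t j
    using fr[OF that(1)] that(2) by (simp add: P_def x_def lookup_fin_vec)
  ultimately show thesis using that[of P r] fr(2) by (auto simp: P_def)
qed

text \<open>Every term of the Leibniz formula has a factor from each row in \<open>R\<close>.\<close>

lemma power_dvd_det: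
  fixes A :: "'a::comm_ring_1 mat"
  assumes A: "A \<in> carrier_mat n n" and R: "R \<subseteq> {..<n}"
    and dvd: "\<And>i j. i \<in> R \<Longrightarrow> j < n \<Longrightarrow> x dvd A $$ (i, j)"
  shows "x ^ card R dvd det A"
  unfolding det_def'[OF A]
proof (intro dvd_sum dvd_mult)
  fix p assume p: "p \<in> {p. p permutes {0..<n}}"
  have "(\<Prod>i\<in>R. x) dvd (\<Prod>i\<in>R. A $$ (i, p i))"
    by (rule prod_dvd_prod) (use dvd R permutes_in_image[of p "{0..<n}"] p in \<open>auto simp: subset_iff\<close>)
  also have "\<dots> dvd (\<Prod>i = 0..<n. A $$ (i, p i))"
    by (rule prod_dvd_prod_subset) (use R in auto)
  finally show "x ^ card R dvd (\<Prod>i = 0..<n. A $$ (i, p i))" by simp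
qed

text \<open>A minor omitting only row \<open>i0\<close> is, up to sign, a determinant of full size: append a column
  supported at \<open>i0\<close>.\<close>

definition bordered :: "'a::comm_ring_1 mat \<Rightarrow> nat \<Rightarrow> nat set \<Rightarrow> 'a \<Rightarrow> 'a mat" where
  "bordered M i0 J x = mat (dim_row M) (dim_row M)
    (\<lambda>(i, j). if j < dim_row M - 1 then M $$ (i, pick J j) else if i = i0 then x else 0)"

lemma pick_all_but_one:
  assumes "i < m - 1" "i0 < m"
  shows "pick ({..<m} - {i0}) i = insert_index i0 i"
proof -
  let ?I = "{..<m} - {i0}"
  let ?k = "insert_index i0 i"
  have "{a \<in> ?I. a < ?k} = (if i < i0 then {..<i} else {..<Suc i} - {i0})"
    using assms by (auto simp: insert_index_def)
  then have "card {a \<in> ?I. a < ?k} = i" by simp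
  moreover have "?k \<in> ?I" using assms by (auto simp: insert_index_def)
  ultimately show ?thesis using pick_card_in_set[of ?k ?I] by simp
qed

lemma det_bordered:
  assumes M: "M \<in> carrier_mat m h" and i0: "i0 < m" and J: "J \<subseteq> {..<h}" "card J = m - 1"
  shows "det (bordered M i0 J x) = x * (- 1) ^ (i0 + (m - 1)) * det (submatrix M ({..<m} - {i0}) J)"
proof -
  let ?A = "bordered M i0 J x"
  have A: "?A \<in> carrier_mat m m" using M by (simp add: bordered_def)
  have rows: "{i. i < m \<and> i \<in> {..<m} - {i0}} = {..<m} - {i0}" by auto
  have cols: "{j. j < h \<and> j \<in> J} = J" using J by auto
  have "mat_delete ?A i0 (m - 1) = submatrix M ({..<m} - {i0}) J"
  proof (rule eq_matI)
    fix i j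
    assume "i < dim_row (submatrix M ({..<m} - {i0}) J)" "j < dim_col (submatrix M ({..<m} - {i0}) J)"
    then have ij: "i < m - 1" "j < m - 1" using M i0 J rows cols by (simp_all add: dim_submatrix)
    have "mat_delete ?A i0 (m - 1) $$ (i, j) = M $$ (insert_index i0 i, pick J j)"
      using ij M i0 by (auto simp: mat_delete_def bordered_def insert_index_def)
    also have "\<dots> = submatrix M ({..<m} - {i0}) J $$ (i, j)"
      using ij M i0 J rows cols pick_all_but_one[OF ij(1) i0] by (subst submatrix_index) simp_all
    finally show "mat_delete ?A i0 (m - 1) $$ (i, j) = submatrix M ({..<m} - {i0}) J $$ (i, j)" .
  qed (use M i0 J rows cols in \<open>simp_all add: dim_submatrix mat_delete_def bordered_def\<close>)
  moreover have "det ?A = (\<Sum>i<m. ?A $$ (i, m - 1) * cofactor ?A i (m - 1))"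
    using laplace_expansion_column[OF A, of "m - 1"] i0 by simp
  moreover have "\<dots> = (\<Sum>i<m. if i = i0 then x * cofactor ?A i0 (m - 1) else 0)"
    using M by (intro sum.cong) (auto simp: bordered_def)
  ultimately show ?thesis using i0 by (simp add: cofactor_def mult.assoc)
qed

lemma fps_X_dvd_iff: "fps_X dvd (f :: complex fps) \<longleftrightarrow> fps_nth f 0 = 0"
proof (cases "f = 0")
  case False
  then show ?thesis by (auto simp: fps_dvd_iff subdegree_eq_0_iff Suc_le_eq neq0_conv[symmetric])
qed simp

text \<open>The constant terms satisfy \<open>card T\<close> independent relations between the rows. Take these relations
  as rows of an invertible constant matrix \<open>P\<close>. In the product of \<open>P\<close> with the matrix bordered by \<open>X\<close>,
  the corresponding \<open>card T\<close> rows are divisible by \<open>X\<close>, and so \<open>X\<close> to the power \<open>card T\<close> divides its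
  determinant. One factor \<open>X\<close> comes from the border.\<close>

lemma power_dvd_minor:
  fixes M :: "complex fps mat" and v :: "'t \<Rightarrow> nat \<Rightarrow> complex"
  assumes M: "M \<in> carrier_mat m h" and i0: "i0 < m" and J: "J \<subseteq> {..<h}" "card J = m - 1"
    and T: "finite T"
    and ind: "\<And>c t. (\<And>i. i < m \<Longrightarrow> (\<Sum>t\<in>T. c t * v t i) = 0) \<Longrightarrow> t \<in> T \<Longrightarrow> c t = 0"
    and ker: "\<And>t. t \<in> T \<Longrightarrow> v t \<in> left_kernel m h (map_mat (\<lambda>f. fps_nth f 0) M)"
  shows "fps_X ^ (card T - 1) dvd det (submatrix M ({..<m} - {i0}) J)"
proof -
  obtain P r where P: "P \<in> carrier_mat m m" "det P \<noteq> 0" and r: "inj_on r T" "r ` T \<subseteq> {..<m}"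
    and Pr: "\<And>t j. t \<in> T \<Longrightarrow> j < m \<Longrightarrow> P $$ (r t, j) = v t j"
    by (rule invertible_with_rows[of T m v]) (use T ind in blast)+
  interpret const: comm_ring_hom "fps_const :: complex \<Rightarrow> complex fps"
    by unfold_locales (simp_all add: fps_const_add fps_const_mult)
  let ?B = "bordered M i0 J fps_X" and ?P = "map_mat fps_const P"
  let ?d = "det (submatrix M ({..<m} - {i0}) J)"
  have B: "?B \<in> carrier_mat m m" using M by (simp add: bordered_def)
  have pick: "pick J j < h" if "j < m - 1" for j
    using pick_in_set_le[of j J] J that by auto
  have "fps_X ^ card (r ` T) dvd det (?P * ?B)"
  proof (rule power_dvd_det[of _ m])
    fix i j assume "i \<in> r ` T" and j: "j < m"
    then obtain t where t: "t \<in> T" "i = r t" by blast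
    then have i: "i < m" using r by auto
    have "fps_nth ((?P * ?B) $$ (i, j)) 0 = (\<Sum>k<m. v t k * fps_nth (?B $$ (k, j)) 0)"
      using P B i j t Pr by (simp add: scalar_prod_def fps_sum_nth lessThan_atLeast0)
    also have "\<dots> = 0"
    proof (cases "j < m - 1")
      case True
      have "(\<Sum>k<m. v t k * fps_nth (?B $$ (k, j)) 0)
          = (\<Sum>k<m. v t k * map_mat (\<lambda>f. fps_nth f 0) M $$ (k, pick J j))"
        using M True pick[OF True] j by (intro sum.cong) (simp_all add: bordered_def)
      then show ?thesis using ker[OF t(1)] pick[OF True] by (simp add: left_kernel_def)
    next
      case False
      then have "fps_nth (?B $$ (k, j)) 0 = 0" if "k < m" for k
        using M j that by (simp add: bordered_def)
      then show ?thesis by simp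
    qed
    finally show "fps_X dvd (?P * ?B) $$ (i, j)" by (simp add: fps_X_dvd_iff)
  qed (use P B r in auto)
  moreover have "det (?P * ?B) = fps_const (det P) * (fps_X * (- 1) ^ (i0 + (m - 1)) * ?d)"
    using P B det_bordered[OF M i0 J, of fps_X] by (subst det_mult[of _ m]) (simp_all)
  moreover have "card (r ` T) = card T" by (rule card_image[OF r(1)])
  ultimately have *: "fps_X ^ card T dvd (fps_const (det P) * (- 1) ^ (i0 + (m - 1))) * (fps_X * ?d)"
    by (simp add: ac_simps)
  have "(fps_const (det P) * (- 1) ^ (i0 + (m - 1))) dvd 1"
    using P(2) by (simp add: fps_is_unit_iff fps_nth_power_0)
  then have "fps_X ^ card T dvd fps_X * ?d" using * dvd_mult_unit_iff' by blast
  then show ?thesis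
    by (cases "card T") (simp_all)
qed

text \<open>Extend the \<open>i0\<close>-th unit vector by columns of \<open>N\<close> to a basis \<open>B\<close> of their common span. If \<open>B\<close> had
  \<open>m\<close> elements, it would give a non-zero bordered determinant, hence a non-zero minor. So the span is
  proper, and some non-zero functional \<open>u\<close> annihilates it; \<open>u i0 = 0\<close> because the unit vector is in
  \<open>B\<close>.\<close>

lemma left_kernel_of_vanishing_minors:
  fixes N :: "complex mat"
  assumes N: "N \<in> carrier_mat m h" and i0: "i0 < m"
    and van: "\<And>J. J \<subseteq> {..<h} \<Longrightarrow> card J = m - 1 \<Longrightarrow> det (submatrix N ({..<m} - {i0}) J) = 0"
  obtains u i where "u \<in> left_kernel m h N" "u i0 = 0" "i < m" "u i \<noteq> 0"
proof -
  define c where "c l = fin_vec m (\<lambda>i. N $$ (i, l))" for l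
  define e where "e = fin_vec m (\<lambda>i. if i = i0 then 1 else 0)"
  have e: "e \<noteq> 0"
    using lookup_fin_vec[of m "\<lambda>i. if i = i0 then 1 else 0" i0] i0 unfolding e_def by force
  obtain B where B: "{e} \<subseteq> B" "B \<subseteq> insert e (c ` {..<h})" "chains.independent B"
      "insert e (c ` {..<h}) \<subseteq> chains.span B"
    using chains.maximal_independent_subset_extend[of "{e}" "insert e (c ` {..<h})"] e by auto
  have BV: "B \<subseteq> range (fin_vec m)" using B(2) by (auto simp: c_def e_def)
  have finB: "finite B" by (rule fin_vec_basis_card(1)[OF BV B(3)])
  have "\<not> range (fin_vec m) \<subseteq> chains.span B"
  proof
    assume "range (fin_vec m) \<subseteq> chains.span B"
    then have "card B = m" by (rule fin_vec_basis_card(2)[OF BV B(3)])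
    then have card: "card (B - {e}) = m - 1" using B(1) finB by simp
    define g where "g b = (SOME l. l < h \<and> c l = b)" for b
    have g: "g b < h" "c (g b) = b" if "b \<in> B - {e}" for b
      using someI_ex[of "\<lambda>l. l < h \<and> c l = b"] B(2) that unfolding g_def by blast+
    define J where "J = g ` (B - {e})"
    have injg: "inj_on g (B - {e})" using g(2) by (metis inj_onI)
    have J: "J \<subseteq> {..<h}" "card J = m - 1"
      using g(1) card card_image[OF injg] by (auto simp: J_def)
    have cJ: "c l \<in> B - {e}" "g (c l) = l" if l: "l \<in> J" for l
    proof -
      obtain b where b: "b \<in> B - {e}" "l = g b" using l unfolding J_def by blast
      then show "c l \<in> B - {e}" "g (c l) = l" using g(2)[OF b(1)] by auto
    qed
    have injc: "inj_on c J" using cJ(2) by (metis inj_onI)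
    let ?A = "bordered N i0 J 1"
    have A: "?A \<in> carrier_mat m m" using N by (simp add: bordered_def)
    have "det ?A = 0" using det_bordered[OF N i0 J, of 1] van[OF J] by simp
    then obtain w where w: "w \<in> carrier_vec m" "w \<noteq> 0\<^sub>v m" "?A *\<^sub>v w = 0\<^sub>v m"
      using det_0_iff_vec_prod_zero_field[OF A] by blast
    have pick: "pick J j \<in> J" if "j < m - 1" for j
      using pick_in_set_le[of j J] J that by simp
    define y where "y j = (if j < m - 1 then c (pick J j) else e)" for j
    have injy: "inj_on y {..<m}"
    proof (rule inj_onI)
      fix j k assume jk: "j \<in> {..<m}" "k \<in> {..<m}" "y j = y k"
      show "j = k"
      proof (cases "j < m - 1"; cases "k < m - 1")
        assume *: "j < m - 1" "k < m - 1"
        then have "pick J j = pick J k" using jk injc pick by (simp add: y_def inj_on_eq_iff)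
        then show ?thesis
          using pick_mono_le[of k J j] pick_mono_le[of j J k] J * by (metis less_irrefl linorder_neqE_nat)
      qed (use jk cJ(1) pick in \<open>auto simp: y_def\<close>)
    qed
    have yB: "y ` {..<m} \<subseteq> B" using cJ(1) pick B(1) by (auto simp: y_def)
    have "(\<Sum>j<m. chain_scale (w $ j) (y j)) = 0"
    proof (rule poly_mapping_eqI)
      fix i
      show "Poly_Mapping.lookup (\<Sum>j<m. chain_scale (w $ j) (y j)) i = Poly_Mapping.lookup 0 i"
      proof (cases "i < m")
        case True
        then have "(?A *\<^sub>v w) $ i = 0" using w by simp
        then have "(\<Sum>j<m. ?A $$ (i, j) * w $ j) = 0"
          using True w(1) A by (simp add: scalar_prod_def lessThan_atLeast0)
        moreover have "Poly_Mapping.lookup (y j) i = ?A $$ (i, j)" if "j < m" for j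
          using that True N by (simp add: y_def bordered_def c_def e_def lookup_fin_vec)
        ultimately show ?thesis by (simp add: lookup_sum lookup_chain_scale mult.commute)
      next
        case False
        then have "Poly_Mapping.lookup (y j) i = 0" for j
          by (simp add: y_def c_def e_def lookup_fin_vec)
        then show ?thesis by (simp add: lookup_sum lookup_chain_scale)
      qed
    qed
    then have "(\<Sum>b\<in>y ` {..<m}. chain_scale (w $ inv_into {..<m} y b) b) = 0"
      by (simp add: sum.reindex[OF injy] injy)
    then have "w $ inv_into {..<m} y b = 0" if "b \<in> y ` {..<m}" for b
      using chains.independentD[OF B(3) _ yB] that by simp
    then have "w $ j = 0" if "j < m" for j using injy that by (metis image_eqI inv_into_f_f lessThan_iff)
    then have "w = 0\<^sub>v m" using w(1) by (intro eq_vecI) auto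
    then show False using w(2) by simp
  qed
  then obtain z where z: "z \<in> range (fin_vec m)" "z \<notin> chains.span B" by blast
  have "independent_mod (chains.span B) {z}"
  proof -
    have "z - s \<notin> chains.span B" if "s \<in> chains.span {}" for s using that z by simp
    then show ?thesis
      using independent_mod_insertI[OF chains.subspace_span, of B "{}" z] by (simp add: independent_mod_def)
  qed
  then obtain \<delta> where \<delta>: "\<And>t w. t \<in> {z} \<Longrightarrow> w \<in> chains.span B \<Longrightarrow> pairing (\<delta> t) w = 0"
      and \<delta>1: "\<And>t t'. t \<in> {z} \<Longrightarrow> t' \<in> {z} \<Longrightarrow> pairing (\<delta> t) t' = (if t' = t then 1 else 0)"
    using dual_functionals[OF chains.subspace_span] by metis
  have "pairing (\<delta> z) (c l) = 0" if "l < h" for l using \<delta>[of z] B(4) that by auto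
  then have "\<delta> z \<in> left_kernel m h N"
    by (simp add: left_kernel_def c_def pairing_fin_vec)
  moreover have "\<delta> z i0 = 0"
  proof -
    have "pairing (\<delta> z) e = 0" using \<delta>[of z] B(4) by auto
    moreover have "pairing (\<delta> z) e = (\<Sum>i<m. if i = i0 then \<delta> z i else 0)"
      unfolding e_def pairing_fin_vec by (intro sum.cong) auto
    ultimately show ?thesis using i0 by simp
  qed
  moreover have "\<exists>i<m. \<delta> z i \<noteq> 0"
  proof (rule ccontr)
    assume "\<not> (\<exists>i<m. \<delta> z i \<noteq> 0)"
    moreover obtain v where "z = fin_vec m v" using z(1) by blast
    ultimately have "pairing (\<delta> z) z = 0" by (simp add: pairing_fin_vec)
    then show False using \<delta>1[of z z] by simp
  qed
  ultimately show thesis using that by blast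
qed

section \<open>Finitely generated torsion-free groups are free\<close>

definition zcomb :: "nat set \<Rightarrow> (nat \<Rightarrow> int) \<Rightarrow> (nat \<Rightarrow> 'h::ab_group_add) \<Rightarrow> 'h" where
  "zcomb I a x = (\<Sum>i\<in>I. zmul (a i) (x i))"

definition generates :: "nat set \<Rightarrow> (nat \<Rightarrow> 'h::ab_group_add) \<Rightarrow> bool" where
  "generates I x \<longleftrightarrow> finite I \<and> (\<forall>y. \<exists>a. y = zcomb I a x)"

lemma zcomb_add: "zcomb I (\<lambda>i. a i + b i) x = zcomb I a x + zcomb I b x"
  by (simp add: zcomb_def zmul_add_left sum.distrib)

lemma zcomb_minus: "zcomb I (\<lambda>i. - a i) x = - zcomb I a x"
  by (simp add: zcomb_def zmul_minus sum_negf)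

text \<open>One step of the Euclidean algorithm on the coefficients, compensated on the generators.\<close>

lemma zcomb_elementary:
  assumes "finite I" "i \<in> I" "j \<in> I" "i \<noteq> j"
  shows "zcomb I (a(i := a i - a j * s)) (x(j := x j + zmul s (x i))) = zcomb I a x"
proof -
  have split: "zcomb I b y = zmul (b i) (y i) + (zmul (b j) (y j) + zcomb (I - {i} - {j}) b y)"
    for b and y :: "nat \<Rightarrow> 'a"
    using assms by (simp add: zcomb_def sum.remove[of I i] sum.remove[of "I - {i}" j])
  have rest: "zcomb (I - {i} - {j}) (a(i := a i - a j * s)) (x(j := x j + zmul s (x i)))
      = zcomb (I - {i} - {j}) a x"
    unfolding zcomb_def by (rule sum.cong) auto
  have "zmul (a i - a j * s) (x i) = zmul (a i) (x i) - zmul (a j) (zmul s (x i))"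
    using zmul_add_left[of "a i" "- (a j * s)" "x i"] by (simp add: zmul_minus zmul_zmul)
  then show ?thesis
    unfolding split[of "a(i := a i - a j * s)"] split[of a x] rest
    using assms(4) by (simp add: zmul_add_right algebra_simps)
qed

text \<open>Subtracting a coefficient from a larger one decreases the sum of the absolute values, until at
  most one coefficient is left.\<close>

lemma euclid_generators:
  assumes "generates I x"
  shows "\<exists>x' a'. generates I x' \<and> zcomb I a' x' = zcomb I a x
    \<and> (\<forall>i\<in>I. \<forall>j\<in>I. i \<noteq> j \<longrightarrow> a' i = 0 \<or> a' j = 0) \<and> ((\<exists>i\<in>I. a i \<noteq> 0) \<longrightarrow> (\<exists>i\<in>I. a' i \<noteq> 0))"
  using assms
proof (induction "\<Sum>i\<in>I. nat \<bar>a i\<bar>" arbitrary: a x rule: less_induct)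
  case less
  have I: "finite I" using less.prems by (simp add: generates_def)
  show ?case
  proof (cases "\<forall>i\<in>I. \<forall>j\<in>I. i \<noteq> j \<longrightarrow> a i = 0 \<or> a j = 0")
    case True
    then show ?thesis using less.prems by blast
  next
    case False
    then obtain i j where ij: "i \<in> I" "j \<in> I" "i \<noteq> j" "a i \<noteq> 0" "a j \<noteq> 0" "\<bar>a j\<bar> \<le> \<bar>a i\<bar>"
      by (metis linear)
    \<comment> \<open>The sign for which subtracting \<open>a j\<close> decreases the absolute value of \<open>a i\<close>.\<close>
    define s where "s = sgn (a i) * sgn (a j)"
    define a' where "a' = a(i := a i - a j * s)"
    define x' where "x' = x(j := x j + zmul s (x i))"
    have "\<bar>a i - a j * s\<bar> < \<bar>a i\<bar>"
      using ij(4-6) by (auto simp: s_def sgn_if abs_if split: if_splits)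
    then have "(\<Sum>k\<in>I. nat \<bar>a' k\<bar>) < (\<Sum>k\<in>I. nat \<bar>a k\<bar>)"
      using I ij by (intro sum_strict_mono_ex1) (auto simp: a'_def intro!: bexI[of _ i])
    moreover have "generates I x'"
      unfolding generates_def
    proof (intro conjI allI I)
      fix y
      obtain b where "y = zcomb I b x" using less.prems unfolding generates_def by blast
      then have "y = zcomb I (b(i := b i - b j * s)) x'"
        unfolding x'_def using zcomb_elementary[OF I ij(1-3)] by metis
      then show "\<exists>b. y = zcomb I b x'" by blast
    qed
    ultimately obtain x'' a'' where "generates I x''" "zcomb I a'' x'' = zcomb I a' x'"
      "\<forall>i\<in>I. \<forall>j\<in>I. i \<noteq> j \<longrightarrow> a'' i = 0 \<or> a'' j = 0"
      "(\<exists>i\<in>I. a' i \<noteq> 0) \<longrightarrow> (\<exists>i\<in>I. a'' i \<noteq> 0)"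
      using less.hyps by blast
    moreover have "zcomb I a' x' = zcomb I a x"
      unfolding a'_def x'_def by (rule zcomb_elementary[OF I ij(1-3)])
    moreover have "\<exists>i\<in>I. a' i \<noteq> 0" using ij by (auto simp: a'_def)
    ultimately show ?thesis by metis
  qed
qed

lemma zcomb_single_coefficient:
  assumes "finite I" "i \<in> I" "\<forall>i\<in>I. \<forall>j\<in>I. i \<noteq> j \<longrightarrow> a i = 0 \<or> a j = 0" "a i \<noteq> 0"
  shows "zcomb I a x = zmul (a i) (x i)"
proof -
  have "zcomb (I - {i}) a x = 0"
    unfolding zcomb_def
  proof (rule sum.neutral, rule ballI)
    fix k assume "k \<in> I - {i}"
    then have "a k = 0" using assms by blast
    then show "zmul (a k) (x k) = 0" by simp
  qed
  then show ?thesis using assms(1,2) by (simp add: zcomb_def sum.remove)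
qed

text \<open>The Euclidean algorithm turns a non-trivial relation into one with a single non-zero
  coefficient, and without torsion that generator is \<open>0\<close> and can be dropped.\<close>

lemma minimal_generators_independent:
  fixes x :: "nat \<Rightarrow> 'h::ab_group_add"
  assumes tf: "\<And>k (y :: 'h). zmul k y = 0 \<Longrightarrow> k = 0 \<or> y = 0"
    and gen: "generates I x" and min: "\<And>I' (x' :: nat \<Rightarrow> 'h). generates I' x' \<Longrightarrow> card I \<le> card I'"
    and 0: "zcomb I a x = 0" and i: "i \<in> I"
  shows "a i = 0"
proof (rule ccontr)
  assume "a i \<noteq> 0"
  then have "\<exists>i\<in>I. a i \<noteq> 0" using i by blast
  moreover obtain x' a' where x': "generates I x'" "zcomb I a' x' = zcomb I a x"
    and a': "\<forall>i\<in>I. \<forall>j\<in>I. i \<noteq> j \<longrightarrow> a' i = 0 \<or> a' j = 0"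
      "(\<exists>i\<in>I. a i \<noteq> 0) \<longrightarrow> (\<exists>i\<in>I. a' i \<noteq> 0)"
    using euclid_generators[OF gen, of a] by blast
  ultimately obtain k where k: "k \<in> I" "a' k \<noteq> 0" by blast
  have I: "finite I" using gen by (simp add: generates_def)
  have "x' k = 0" using zcomb_single_coefficient[OF I k(1) a'(1) k(2), of x'] x'(2) 0 k(2) tf by metis
  then have "zcomb I b x' = zcomb (I - {k}) b x'" for b
    using I k by (simp add: zcomb_def sum.remove)
  then have "generates (I - {k}) x'" using x'(1) by (simp add: generates_def)
  then have "card I \<le> card (I - {k})" by (rule min)
  then show False using I k by (metis card_Diff1_less not_less)
qed

text \<open>A generating family of minimal size is a basis, and the Euclidean algorithm changes it into a
  basis of which one member \<open>h0\<close> divides \<open>h\<close>. Then \<open>\<chi>\<close> is the coordinate at \<open>h0\<close>, and \<open>\<iota>\<close> collects all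
  coordinates; its target is an ordered group.\<close>

lemma primitive_root:
  fixes h :: "'h::ab_group_add"
  assumes tf: "\<And>k (y :: 'h). zmul k y = 0 \<Longrightarrow> k = 0 \<or> y = 0"
    and fg: "generates I0 (x0 :: nat \<Rightarrow> 'h)" and h: "h \<noteq> 0"
  obtains h0 d \<chi> and \<iota> :: "'h \<Rightarrow> (nat \<Rightarrow>\<^sub>0 int)"
  where "h = zmul d h0" "additive \<chi>" "\<chi> h0 = (1 :: int)" "additive \<iota>" "inj \<iota>"
proof -
  let ?P = "\<lambda>n. \<exists>I (x :: nat \<Rightarrow> 'h). generates I x \<and> card I = n"
  define n where "n = (LEAST n. ?P n)"
  have "?P n" unfolding n_def by (rule LeastI_ex) (use fg in blast)
  then obtain I and x1 :: "nat \<Rightarrow> 'h" where x1: "generates I x1" "card I = n" by blast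
  have min: "card I \<le> card I'" if "generates I' x'" for I' and x' :: "nat \<Rightarrow> 'h"
    unfolding x1(2) n_def by (rule Least_le) (use that in blast)
  obtain a1 where a1: "h = zcomb I a1 x1" using x1 unfolding generates_def by blast
  have "\<exists>i\<in>I. a1 i \<noteq> 0"
    using h a1 by (auto simp: zcomb_def intro: ccontr)
  then obtain x a where x: "generates I x" and a: "h = zcomb I a x"
      "\<forall>i\<in>I. \<forall>j\<in>I. i \<noteq> j \<longrightarrow> a i = 0 \<or> a j = 0" "\<exists>i\<in>I. a i \<noteq> 0"
    using euclid_generators[OF x1(1), of a1] a1 by metis
  have I: "finite I" using x by (simp add: generates_def)
  obtain i where i: "i \<in> I" "a i \<noteq> 0" using a(3) by blast
  have ind: "b k = 0" if "zcomb I b x = 0" "k \<in> I" for b k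
    using minimal_generators_independent[OF tf x min that] .
  have uniq: "b k = b' k" if "zcomb I b x = zcomb I b' x" "k \<in> I" for b b' k
    using ind[of "\<lambda>i. b i + - b' i" k] that zcomb_add[of I b "\<lambda>i. - b' i" x] zcomb_minus[of I b' x] by simp
  obtain c where c: "\<And>y. y = zcomb I (c y) x" using x unfolding generates_def by metis
  have c_add: "c (y + z) k = c y k + c z k" if "k \<in> I" for y z k
  proof (rule uniq[OF _ that])
    show "zcomb I (c (y + z)) x = zcomb I (\<lambda>k. c y k + c z k) x"
      unfolding zcomb_add c[symmetric] ..
  qed
  define \<iota> where "\<iota> y = (\<Sum>k\<in>I. Poly_Mapping.single k (c y k))" for y
  have lookup_\<iota>: "Poly_Mapping.lookup (\<iota> y) k = c y k" if "k \<in> I" for y k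
    using I that by (simp add: \<iota>_def lookup_sum lookup_single when_def)
  show thesis
  proof (rule that[of "a i" "x i" "\<lambda>y. c y i" \<iota>])
    show "h = zmul (a i) (x i)" using zcomb_single_coefficient[OF I i(1) a(2) i(2)] a(1) by simp
    show "additive (\<lambda>y. c y i)" by unfold_locales (rule c_add[OF i(1)])
    have "x i = zcomb I (\<lambda>k. if k = i then 1 else 0) x"
      using I i by (simp add: zcomb_def sum.remove)
    then have "zcomb I (c (x i)) x = zcomb I (\<lambda>k. if k = i then 1 else 0) x"
      using c[of "x i"] by simp
    then show "c (x i) i = 1" using uniq[of "c (x i)" "\<lambda>k. if k = i then 1 else 0" i] i(1) by simp
    show "additive \<iota>"
      by unfold_locales (simp add: \<iota>_def c_add single_add sum.distrib)
    show "inj \<iota>"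
    proof (rule injI)
      fix y z assume "\<iota> y = \<iota> z"
      then have "c y k = c z k" if "k \<in> I" for k using lookup_\<iota>[OF that] by metis
      then have "zcomb I (c y) x = zcomb I (c z) x" unfolding zcomb_def by (intro sum.cong) auto
      then show "y = z" using c by metis
    qed
  qed
qed

lemma to_abf_add: "to_abf (g + h) = to_abf g + to_abf h"
  unfolding to_abf_def plus_ab.abs_eq[symmetric] plus_torsion_free.abs_eq ..

lemma abf_torsion_free:
  fixes y :: "'a::ab_group_add torsion_free"
  assumes "zmul k y = 0"
  shows "k = 0 \<or> y = 0"
proof (rule disjCI)
  assume y: "y \<noteq> 0"
  obtain x where x: "y = to_torsion_free x" by (induction y rule: torsion_free.abs_induct) blast
  have add: "additive (to_torsion_free :: 'a \<Rightarrow> _)" by unfold_locales (simp add: plus_torsion_free.abs_eq)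
  have zero: "to_torsion_free z = 0 \<longleftrightarrow> torsion_elem z" for z :: 'a
    by (simp add: zero_torsion_free_def torsion_free.abs_eq_iff)
  have "torsion_elem (zmul k x)" using assms unfolding x additive_zmul[OF add, symmetric] zero .
  then obtain l where "l \<noteq> 0" "zmul (l * k) x = 0" by (auto simp: torsion_elem_iff_zmul zmul_zmul)
  moreover have "\<not> torsion_elem x" using y x zero by simp
  ultimately show "k = 0" unfolding torsion_elem_iff_zmul by (metis mult_eq_0_iff)
qed

lemma ex_to_abf: "\<exists>g. y = to_abf g"
proof (induction y rule: torsion_free.abs_induct)
  case (1 z)
  show ?case unfolding to_abf_def by (induction z rule: ab.abs_induct) blast
qed

lemma finitely_generated_abf:
  assumes "finitely_generated_group TYPE('g::group_add)"
  obtains I and x :: "nat \<Rightarrow> 'g::group_add abf" where "generates I x"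
proof -
  obtain S :: "'g set" where S: "finite S" "subgroup_gen S = UNIV"
    using assms unfolding finitely_generated_group_def by blast
  obtain s where s: "bij_betw s {..<card S} S"
    using ex_bij_betw_nat_finite[OF S(1)] by (auto simp: lessThan_atLeast0)
  let ?I = "{..<card S}" and ?x = "\<lambda>i. to_abf (s i)"
  have add: "to_abf (g - h) = to_abf g - to_abf h" for g h :: 'g
    using to_abf_add[of "g - h" h] by simp
  have "\<exists>a. to_abf g = zcomb ?I a ?x" for g
  proof -
    have "g \<in> subgroup_gen S" using S(2) by simp
    then show ?thesis
    proof induction
      case zero
      have "to_abf (0 :: 'g) = 0" using add[of 0 0] by simp
      then show ?case by (intro exI[of _ "\<lambda>_. 0"]) (simp add: zcomb_def)
    next
      case (base g)
      then obtain i where i: "i \<in> ?I" "g = s i" using s by (auto simp: bij_betw_def)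
      then have "to_abf g = zcomb ?I (\<lambda>k. if k = i then 1 else 0) ?x"
        by (simp add: zcomb_def sum.remove[of ?I i])
      then show ?case by blast
    next
      case (diff g h)
      then obtain a b where "to_abf g = zcomb ?I a ?x" "to_abf h = zcomb ?I b ?x" by blast
      then have "to_abf (g - h) = zcomb ?I (\<lambda>i. a i + - b i) ?x"
        unfolding zcomb_add zcomb_minus add by simp
      then show ?case by blast
    qed
  qed
  then have "generates ?I ?x"
    using ex_to_abf unfolding generates_def by (metis finite_lessThan)
  then show thesis by (rule that)
qed

section \<open>Irreducible factors in the complex group ring\<close>

text \<open>The group ring embeds into that of an ordered group, which has no zero divisors.\<close>

lemma complex_group_ring_no_zero_divisors:
  fixes \<iota> :: "'h::ab_group_add \<Rightarrow> 'k::linordered_ab_group_add" and a b :: "'h \<Rightarrow>\<^sub>0 complex"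
  assumes \<iota>: "additive \<iota>" "inj \<iota>" and 0: "a * b = 0"
  shows "a = 0 \<or> b = 0"
proof -
  define m :: "('h \<Rightarrow>\<^sub>0 complex) \<Rightarrow> ('k \<Rightarrow>\<^sub>0 complex)"
    where "m = lin_ext (Poly_Mapping.single 0) (\<lambda>y. Poly_Mapping.single (\<iota> y) 1)"
  have m_mult: "m (x * y) = m x * m y" for x y
    unfolding m_def by (rule lin_ext_mult[OF additive_single]) (simp_all add: mult_single additive.add[OF \<iota>(1)])
  have m: "additive m" unfolding m_def by (rule additive_lin_ext[OF additive_single])
  have lookup_m: "Poly_Mapping.lookup (m x) (\<iota> y) = Poly_Mapping.lookup x y" for x y
  proof (rule additive_eq_on_singles[of "\<lambda>x. Poly_Mapping.lookup (m x) (\<iota> y)" "\<lambda>x. Poly_Mapping.lookup x y"])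
    show "additive (\<lambda>x. Poly_Mapping.lookup (m x) (\<iota> y))" "additive (\<lambda>x :: 'h \<Rightarrow>\<^sub>0 complex. Poly_Mapping.lookup x y)"
      by unfold_locales (simp_all add: lookup_add additive.add[OF m])
    fix k c
    show "Poly_Mapping.lookup (m (Poly_Mapping.single k c)) (\<iota> y) = Poly_Mapping.lookup (Poly_Mapping.single k c) y"
      using \<iota>(2) by (simp add: m_def lin_ext_single[OF additive_single] mult_single lookup_single when_def inj_eq)
  qed
  have "m a * m b = 0" using 0 m_mult[of a b] additive.zero[OF m] by simp
  then have "m a = 0 \<or> m b = 0" by simp
  then show ?thesis
    using lookup_m[of a] lookup_m[of b] by (metis lookup_zero poly_mapping_eqI)
qed

definition linear_factor :: "'h::ab_group_add \<Rightarrow> complex \<Rightarrow> ('h \<Rightarrow>\<^sub>0 complex)" where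
  "linear_factor h w = Poly_Mapping.single h 1 - Poly_Mapping.single 0 w"

lemma single_dvd_one:
  "c \<noteq> 0 \<Longrightarrow> (Poly_Mapping.single h c :: 'h::ab_group_add \<Rightarrow>\<^sub>0 complex) dvd 1"
  by (rule dvdI[of _ _ "Poly_Mapping.single (- h) (1 / c)"]) (simp add: mult_single)

lemma linear_factor_dvd_power_diff:
  assumes "w \<noteq> 0"
  shows "linear_factor h w dvd Poly_Mapping.single (zmul k h) 1 - Poly_Mapping.single 0 (w powi k)"
proof (induction k rule: int_induct[of _ 0])
  case base
  then show ?case by simp
next
  case (step1 k)
  have "Poly_Mapping.single (zmul (k + 1) h) 1 - Poly_Mapping.single 0 (w powi (k + 1))
      = Poly_Mapping.single h 1 * (Poly_Mapping.single (zmul k h) 1 - Poly_Mapping.single 0 (w powi k))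
        + Poly_Mapping.single 0 (w powi k) * linear_factor h w"
    using assms by (simp add: linear_factor_def right_diff_distrib mult_single zmul_add_left
        power_int_add add.commute mult.commute)
  then show ?case using step1(2) by simp
next
  case (step2 k)
  have zk: "zmul k h = zmul (k - 1) h + h" using zmul_add_left[of "k - 1" 1 h] by simp
  have wk: "w powi k = w powi (k - 1) * w"
    using power_int_add[of w "k - 1" 1] assms by simp
  have "Poly_Mapping.single (zmul (k - 1) h) 1 - Poly_Mapping.single 0 (w powi (k - 1))
      = Poly_Mapping.single (- h) 1 *
        ((Poly_Mapping.single (zmul k h) 1 - Poly_Mapping.single 0 (w powi k))
          - Poly_Mapping.single 0 (w powi (k - 1)) * linear_factor h w)"
    unfolding zk wk by (simp add: linear_factor_def right_diff_distrib mult_single single_diff)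
  then show ?case using step2(2) by (simp add: dvd_diff)
qed

text \<open>When \<open>h0\<close> belongs to a basis, the group splits as \<open>\<int> h0 \<oplus> ker \<chi>\<close>. Setting \<open>h0\<close> to \<open>w\<close> is a
  retraction of the group ring whose kernel is generated by \<open>h0 - w\<close>; its image lies in a domain, so
  \<open>h0 - w\<close> is prime.\<close>

locale primitive_element =
  fixes h0 :: "'h::ab_group_add" and \<chi> :: "'h \<Rightarrow> int" and \<iota> :: "'h \<Rightarrow> (nat \<Rightarrow>\<^sub>0 int)"
  assumes chi: "additive \<chi>" "\<chi> h0 = 1" and iota: "additive \<iota>" "inj \<iota>"
begin

lemma no_zero_divisors: "a * b = 0 \<Longrightarrow> a = 0 \<or> b = (0 :: 'h \<Rightarrow>\<^sub>0 complex)"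
  by (rule complex_group_ring_no_zero_divisors[OF iota])

definition retraction :: "complex \<Rightarrow> ('h \<Rightarrow>\<^sub>0 complex) \<Rightarrow> ('h \<Rightarrow>\<^sub>0 complex)" where
  "retraction w = lin_ext (Poly_Mapping.single 0)
    (\<lambda>y. Poly_Mapping.single (y - zmul (\<chi> y) h0) (w powi \<chi> y))"

lemma additive_retraction: "additive (retraction w)"
  unfolding retraction_def by (rule additive_lin_ext[OF additive_single])

lemma retraction_single:
  "retraction w (Poly_Mapping.single y c) = Poly_Mapping.single (y - zmul (\<chi> y) h0) (c * w powi \<chi> y)"
  by (simp add: retraction_def lin_ext_single[OF additive_single] mult_single)

lemma retraction_mult: "w \<noteq> 0 \<Longrightarrow> retraction w (f * g) = retraction w f * retraction w g"
  unfolding retraction_def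
  by (rule lin_ext_mult[OF additive_single])
    (simp_all add: mult_single additive.add[OF chi(1)] zmul_add_left power_int_add algebra_simps)

lemma retraction_linear_factor: "retraction w (linear_factor h0 w) = 0"
  by (simp add: linear_factor_def additive.diff[OF additive_retraction] retraction_single
      additive.zero[OF chi(1)] chi(2))

lemma linear_factor_dvd_iff:
  assumes "w \<noteq> 0"
  shows "linear_factor h0 w dvd f \<longleftrightarrow> retraction w f = 0"
proof
  assume "linear_factor h0 w dvd f"
  then show "retraction w f = 0"
    by (auto simp: dvd_def retraction_mult[OF assms] retraction_linear_factor)
next
  have "linear_factor h0 w dvd f - retraction w f" for f
  proof (induction f rule: poly_mapping_single_induct)
    case (single y c)
    have "Poly_Mapping.single y c - retraction w (Poly_Mapping.single y c)
        = Poly_Mapping.single (y - zmul (\<chi> y) h0) c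
          * (Poly_Mapping.single (zmul (\<chi> y) h0) 1 - Poly_Mapping.single 0 (w powi \<chi> y))"
      by (simp add: retraction_single right_diff_distrib mult_single)
    then show ?case using dvd_mult[OF linear_factor_dvd_power_diff[OF assms]] by metis
  next
    case (add x y)
    have eq: "x + y - retraction w (x + y) = (x - retraction w x) + (y - retraction w y)"
      by (simp add: additive.add[OF additive_retraction])
    show ?case unfolding eq by (rule dvd_add[OF add])
  qed
  moreover assume "retraction w f = 0"
  ultimately show "linear_factor h0 w dvd f" by (metis diff_zero)
qed

lemma linear_factor_prime:
  "w \<noteq> 0 \<Longrightarrow> linear_factor h0 w dvd f * g \<Longrightarrow> linear_factor h0 w dvd f \<or> linear_factor h0 w dvd g"
  using no_zero_divisors by (auto simp: linear_factor_dvd_iff retraction_mult)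

lemma linear_factor_not_unit: "w \<noteq> 0 \<Longrightarrow> \<not> linear_factor h0 w dvd 1"
  using retraction_single[of w 0 1] by (simp add: linear_factor_dvd_iff additive.zero[OF chi(1)])

lemma linear_factor_nonzero: "linear_factor h0 w \<noteq> 0"
proof
  assume "linear_factor h0 w = 0"
  moreover have "h0 \<noteq> 0" using chi additive.zero[OF chi(1)] by auto
  ultimately show False
    using lookup_single_eq[of h0 "1 :: complex"] lookup_single_not_eq[of 0 h0 w]
    by (simp add: linear_factor_def)
qed

text \<open>Primality of the linear factors allows them to be cancelled one after the other until one of them
  divides \<open>f\<close>. A factor with \<open>w = 0\<close> is the unit \<open>h0\<close> and is absorbed.\<close>

lemma irreducible_factor_of_linear_product:
  assumes "irreducible f" "f dvd u * (\<Prod>w\<in>#ws. linear_factor h0 w)" "u dvd 1"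
  shows "\<exists>w. w \<noteq> 0 \<and> f \<doteq> linear_factor h0 w"
  using assms(2)
proof (induction ws)
  case empty
  then show ?case using assms(1,3) dvd_trans by (auto simp: irreducible_def)
next
  case (add w ws)
  let ?l = "linear_factor h0 w" and ?R = "u * (\<Prod>w\<in>#ws. linear_factor h0 w)"
  have dvd: "f dvd ?l * ?R" using add.prems by (simp add: ac_simps)
  show ?case
  proof (cases "w = 0")
    case True
    then have "?l dvd 1" using single_dvd_one[of 1 h0] by (simp add: linear_factor_def)
    then obtain v where "1 = ?l * v" by (elim dvdE)
    then have "?R = v * (?l * ?R)" by (metis mult.assoc mult.commute mult_1)
    then have "f dvd ?R" using dvd by (metis dvd_mult)
    then show ?thesis by (rule add.IH)
  next
    case w: False
    obtain g where g: "?l * ?R = f * g" using dvd by (elim dvdE)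
    have "?l dvd f * g" unfolding g[symmetric] by simp
    then consider "?l dvd f" | "?l dvd g" using linear_factor_prime[OF w] by blast
    then show ?thesis
    proof cases
      case 1
      then obtain k where k: "f = ?l * k" by (elim dvdE)
      then have "k dvd 1" using assms(1) linear_factor_not_unit[OF w] by (auto simp: irreducible_def)
      then show ?thesis using k w by (auto simp: eq_up_to_unit_def mult.commute)
    next
      case 2
      then obtain g' where "g = ?l * g'" by (elim dvdE)
      then have "?l * (?R - f * g') = 0" using g by (simp add: algebra_simps)
      then have "?R = f * g'" using no_zero_divisors linear_factor_nonzero by fastforce
      then show ?thesis using add.IH by simp
    qed
  qed
qed

end

text \<open>A Laurent polynomial in \<open>h\<close> becomes a polynomial after multiplication by a unit, and then
  splits into linear factors by the fundamental theorem of algebra.\<close>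

lemma laurent_polynomial_factorization:
  fixes h :: "'h::ab_group_add" and p :: "'k \<Rightarrow> complex"
  assumes "finite A" and nz: "(\<Sum>k\<in>A. Poly_Mapping.single (zmul (e k) h) (p k)) \<noteq> 0"
  obtains u ws where "u dvd 1" "(\<Sum>k\<in>A. Poly_Mapping.single (zmul (e k) h) (p k)) = u * (\<Prod>w\<in>#ws. linear_factor h w)"
proof -
  interpret S: comm_ring_hom "Poly_Mapping.single 0 :: complex \<Rightarrow> ('h \<Rightarrow>\<^sub>0 complex)"
    by unfold_locales (simp_all add: single_add mult_single)
  interpret MS: map_poly_comm_ring_hom "Poly_Mapping.single 0 :: complex \<Rightarrow> ('h \<Rightarrow>\<^sub>0 complex)" ..
  define ev where "ev Q = poly (map_poly (Poly_Mapping.single 0) Q) (Poly_Mapping.single h 1)" for Q :: "complex poly"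
  have power: "Poly_Mapping.single h 1 ^ n = Poly_Mapping.single (zmul (int n) h) (1 :: complex)" for n
    by (induction n) (simp_all add: mult_single zmul_add_left)
  have ev_monom: "ev (Polynomial.monom c n) = Poly_Mapping.single (zmul (int n) h) c" for c n
    by (simp add: ev_def map_poly_monom poly_monom power mult_single)
  have ev_sum: "ev (\<Sum>k\<in>A. q k) = (\<Sum>k\<in>A. ev (q k))" for q :: "'k \<Rightarrow> complex poly"
    by (simp add: ev_def hom_distribs poly_sum)
  have ev_mult: "ev (Q * R) = ev Q * ev R" for Q R by (simp add: ev_def hom_distribs)
  have ev_lin: "ev [:- w, 1:] = linear_factor h w" for w
    by (simp add: ev_def linear_factor_def single_uminus)
  have ev_const: "ev [:c:] = Poly_Mapping.single 0 c" for c
    using ev_monom[of c 0] by (simp add: monom_0)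
  have ev_prod: "ev (\<Prod>w\<in>#ws. [:- w, 1:]) = (\<Prod>w\<in>#ws. linear_factor h w)" for ws
  proof (induction ws)
    case empty
    show ?case by (simp add: ev_def)
  next
    case (add w ws)
    then show ?case by (simp only: image_mset_add_mset prod_mset.add_mset ev_mult ev_lin)
  qed
  \<comment> \<open>Multiplication by \<open>N h\<close> makes all exponents non-negative.\<close>
  define N where "N = (\<Sum>k\<in>A. \<bar>e k\<bar>)"
  have N: "e k + N \<ge> 0" if "k \<in> A" for k
    using member_le_sum[of k A "\<lambda>k. \<bar>e k\<bar>"] that assms(1) unfolding N_def by fastforce
  define Q where "Q = (\<Sum>k\<in>A. Polynomial.monom (p k) (nat (e k + N)))"
  let ?F = "\<Sum>k\<in>A. Poly_Mapping.single (zmul (e k) h) (p k)"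
  have "ev Q = Poly_Mapping.single (zmul N h) 1 * ?F"
    unfolding Q_def ev_sum sum_distrib_left
    using N by (intro sum.cong refl) (simp add: ev_monom mult_single zmul_add_left add.commute)
  then have F: "?F = Poly_Mapping.single (zmul (- N) h) 1 * ev Q"
    by (simp add: mult.assoc[symmetric] mult_single zmul_minus)
  have "Q \<noteq> 0"
  proof
    assume "Q = 0"
    then have "ev Q = 0" by (simp add: ev_def)
    then show False using F nz by simp
  qed
  have "ev Q = ev ([:lead_coeff Q:] * (\<Prod>w\<in>#proots Q. [:- w, 1:]))"
    using complex_poly_decompose_multiset[of Q] by simp
  then have "?F = Poly_Mapping.single (zmul (- N) h) (lead_coeff Q) * (\<Prod>w\<in>#proots Q. linear_factor h w)"
    unfolding F ev_mult ev_prod ev_const by (simp add: mult_single mult.assoc[symmetric])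
  moreover have "Poly_Mapping.single (zmul (- N) h) (lead_coeff Q) dvd 1"
    using \<open>Q \<noteq> 0\<close> by (intro single_dvd_one) simp
  ultimately show thesis by (intro that)
qed

section \<open>Semilinear functionals on the Alexander module\<close>

abbreviation eval_int :: "('a \<Rightarrow> complex) \<Rightarrow> ('a \<Rightarrow>\<^sub>0 int) \<Rightarrow> complex" where
  "eval_int \<equiv> lin_ext of_int"

lemmas additive_eval_int = additive_lin_ext[OF additive_of_int]
lemmas eval_int_single = lin_ext_single[OF additive_of_int]

lemma characterD:
  assumes "\<sigma> \<in> character_torus"
  shows "\<sigma> (x + y) = \<sigma> x * \<sigma> y" "\<sigma> x \<noteq> 0" "\<sigma> 0 = 1"
proof -
  show *: "\<sigma> (x + y) = \<sigma> x * \<sigma> y" "\<sigma> x \<noteq> 0" for x y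
    using assms by (auto simp: character_torus_def)
  show "\<sigma> 0 = 1" using *(1)[of 0 0] *(2)[of 0] by simp
qed

lemma eval_int_mult:
  "\<sigma> \<in> character_torus \<Longrightarrow> eval_int \<sigma> (x * y) = eval_int \<sigma> x * eval_int \<sigma> y"
  by (rule lin_ext_mult[OF additive_of_int]) (simp_all add: characterD)

lemma eval_int_one: "\<sigma> \<in> character_torus \<Longrightarrow> eval_int \<sigma> 1 = 1"
  unfolding single_one[symmetric] by (simp add: eval_int_single characterD del: single_one)

lemma augmentation_eq_lin_ext: "augmentation = lin_ext (\<lambda>c. c) (\<lambda>_. 1)"
  by (rule ext) (simp add: augmentation_def lin_ext_def)

lemma additive_augmentation: "additive augmentation"
  unfolding augmentation_eq_lin_ext by (rule additive_lin_ext[OF additive_id])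

lemma augmentation_single: "augmentation (Poly_Mapping.single k c) = c"
  by (simp add: augmentation_eq_lin_ext lin_ext_single[OF additive_id])

lemma augmentation_mult:
  fixes x y :: "'a::monoid_add \<Rightarrow>\<^sub>0 int"
  shows "augmentation (x * y) = augmentation x * augmentation y"
  unfolding augmentation_eq_lin_ext by (rule lin_ext_mult[OF additive_id]) simp_all

lemma additive_group_ring_map: "additive (group_ring_map \<phi>)"
  by unfold_locales (simp add: group_ring_map_def frag_extend_add)

lemma group_ring_map_single: "group_ring_map \<phi> (Poly_Mapping.single k c) = Poly_Mapping.single (\<phi> k) c"
proof (cases "c = 0")
  case True
  then show ?thesis by (simp add: group_ring_map_def)
next
  case False
  then show ?thesis
    by (intro poly_mapping_eqI) (simp add: group_ring_map_def frag_extend_def lookup_single when_def)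
qed

lemma eval_int_group_ring_map: "eval_int \<sigma> (group_ring_map \<phi> r) = eval_int (\<sigma> \<circ> \<phi>) r"
  by (rule additive_eq_on_singles[of "\<lambda>r. eval_int \<sigma> (group_ring_map \<phi> r)",
        OF additive_compose[OF additive_eval_int additive_group_ring_map] additive_eval_int])
    (simp add: group_ring_map_single eval_int_single)

text \<open>The Leibniz rule of Fox calculus. The last term vanishes for \<open>x\<close> in the augmentation ideal, which
  makes \<open>\<delta>\<close> linear over the group ring there.\<close>

lemma cocycle_leibniz:
  assumes "cocycle \<rho> \<delta>"
  shows "eval_int \<delta> (r * x) = eval_int \<rho> r * eval_int \<delta> x + eval_int \<delta> r * of_int (augmentation x)"
proof (rule additive_eq_on_singles[of "\<lambda>r. eval_int \<delta> (r * x)"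
      "\<lambda>r. eval_int \<rho> r * eval_int \<delta> x + eval_int \<delta> r * of_int (augmentation x)"])
  show "additive (\<lambda>r. eval_int \<delta> (r * x))"
    by (rule additive_compose[OF additive_eval_int additive_mult_right])
  show "additive (\<lambda>r. eval_int \<rho> r * eval_int \<delta> x + eval_int \<delta> r * of_int (augmentation x))"
    by (rule additive_plus) (rule additive_compose[OF additive_mult_right additive_eval_int])+
  fix g c
  show "eval_int \<delta> (Poly_Mapping.single g c * x) = eval_int \<rho> (Poly_Mapping.single g c) * eval_int \<delta> x
      + eval_int \<delta> (Poly_Mapping.single g c) * of_int (augmentation x)"
  proof (rule additive_eq_on_singles[of "\<lambda>x. eval_int \<delta> (Poly_Mapping.single g c * x)"
      "\<lambda>x. eval_int \<rho> (Poly_Mapping.single g c) * eval_int \<delta> x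
        + eval_int \<delta> (Poly_Mapping.single g c) * of_int (augmentation x)"])
    show "additive (\<lambda>x. eval_int \<delta> (Poly_Mapping.single g c * x))"
      by (rule additive_compose[OF additive_eval_int additive_mult_left])
    show "additive (\<lambda>x. eval_int \<rho> (Poly_Mapping.single g c) * eval_int \<delta> x
        + eval_int \<delta> (Poly_Mapping.single g c) * of_int (augmentation x))"
      by (rule additive_plus) (rule additive_compose[OF additive_mult_left additive_eval_int]
          additive_compose[OF additive_mult_left additive_compose[OF additive_of_int additive_augmentation]])+
    fix h d
    show "eval_int \<delta> (Poly_Mapping.single g c * Poly_Mapping.single h d)
      = eval_int \<rho> (Poly_Mapping.single g c) * eval_int \<delta> (Poly_Mapping.single h d)
        + eval_int \<delta> (Poly_Mapping.single g c) * of_int (augmentation (Poly_Mapping.single h d))"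
      using assms by (simp add: mult_single eval_int_single augmentation_single cocycle_def algebra_simps)
  qed
qed

definition tensor :: "'g::group_add lambda_ring \<Rightarrow> ('g \<Rightarrow>\<^sub>0 int) \<Rightarrow> 'g alexander_module" where
  "tensor a x = abs_alexander_module (frag_of (a, x))"

text \<open>The linear functionals on \<open>\<complex>\<^sub>\<sigma> \<otimes>\<^sub>\<Lambda> A\<^sub>G\<close>.\<close>

definition semilinear :: "('g::group_add abf \<Rightarrow> complex) \<Rightarrow> ('g alexander_module \<Rightarrow> complex) \<Rightarrow> bool" where
  "semilinear \<sigma> D \<longleftrightarrow> additive D \<and> (\<forall>c z. D (alexander_scale c z) = eval_int \<sigma> c * D z)"

definition group_difference :: "'g::group_add \<Rightarrow> ('g \<Rightarrow>\<^sub>0 int)" where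
  "group_difference g = Poly_Mapping.single g 1 - 1"

lemma group_difference_in: "group_difference g \<in> augmentation_ideal"
  unfolding group_difference_def single_one[symmetric] augmentation_ideal_def
  by (simp add: additive.diff[OF additive_augmentation] augmentation_single del: single_one)

lemma tensor_free_frag_of: "x \<in> augmentation_ideal \<Longrightarrow> frag_of (a, x) \<in> tensor_free"
  by (simp add: tensor_free_def)

lemma alexander_abs_eqI:
  "z \<in> tensor_free \<Longrightarrow> w \<in> tensor_free \<Longrightarrow> z - w \<in> subgroup_gen tensor_relators
    \<Longrightarrow> abs_alexander_module z = abs_alexander_module w"
  by (rule Quotient_rel_abs[OF Quotient_alexander_module]) (simp add: tensor_eq_def)

lemma alexander_module_cases:
  obtains z' where "z' \<in> tensor_free" "z = abs_alexander_module z'"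
proof (rule that)
  show "rep_alexander_module z \<in> tensor_free"
    using Quotient_rep_reflp[OF Quotient_alexander_module, of z] by (simp add: tensor_eq_def)
  show "z = abs_alexander_module (rep_alexander_module z)"
    by (rule Quotient_abs_rep[OF Quotient_alexander_module, symmetric])
qed

lemma tensor_eq_refl: "z \<in> tensor_free \<Longrightarrow> tensor_eq z z"
  by (simp add: tensor_eq_def subgroup_gen.zero)

lemma alexander_abs_add: "z \<in> tensor_free \<Longrightarrow> w \<in> tensor_free \<Longrightarrow>
    abs_alexander_module (z + w) = abs_alexander_module z + abs_alexander_module w"
  by (rule plus_alexander_module.abs_eq[symmetric]) (simp_all add: tensor_eq_refl)

lemma alexander_abs_scale: "z \<in> tensor_free \<Longrightarrow>
    abs_alexander_module (tensor_scale c z) = alexander_scale c (abs_alexander_module z)"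
  by (rule alexander_scale.abs_eq[symmetric]) (simp add: tensor_eq_refl)

lemma alexander_abs_diff: "z \<in> tensor_free \<Longrightarrow> w \<in> tensor_free \<Longrightarrow>
    abs_alexander_module (z - w) = abs_alexander_module z - abs_alexander_module w"
  using alexander_abs_add[of "z - w" w] by (simp add: tensor_free_diff eq_diff_eq)

lemma tensor_add_right:
  assumes "x \<in> augmentation_ideal" "y \<in> augmentation_ideal"
  shows "tensor a (x + y) = tensor a x + tensor a y"
proof -
  have xy: "x + y \<in> augmentation_ideal"
    using assms by (simp add: augmentation_ideal_def additive.add[OF additive_augmentation])
  have "frag_of (a, x + y) - (frag_of (a, x) + frag_of (a, y)) \<in> subgroup_gen tensor_relators"
    unfolding diff_diff_eq[symmetric] tensor_relators_def
    using assms by (intro subgroup_gen.base) blast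
  then show ?thesis
    unfolding tensor_def
    using assms xy alexander_abs_eqI[of "frag_of (a, x + y)" "frag_of (a, x) + frag_of (a, y)"]
    by (simp add: tensor_free_frag_of tensor_free_add alexander_abs_add)
qed

lemma tensor_mult_right:
  assumes "x \<in> augmentation_ideal"
  shows "tensor a (r * x) = alexander_scale (a * group_ring_map to_abf r) (tensor 1 x)"
proof -
  have rx: "r * x \<in> augmentation_ideal"
    using assms by (simp add: augmentation_ideal_def augmentation_mult)
  have "frag_of (a * group_ring_map to_abf r, x) - frag_of (a, r * x) \<in> subgroup_gen tensor_relators"
    unfolding tensor_relators_def using assms by (intro subgroup_gen.base) blast
  then have "tensor (a * group_ring_map to_abf r) x = tensor a (r * x)"
    unfolding tensor_def using assms rx by (intro alexander_abs_eqI tensor_free_frag_of)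
  then show ?thesis
    unfolding tensor_def
    using alexander_abs_scale[OF tensor_free_frag_of[OF assms], of "a * group_ring_map to_abf r" 1] by simp
qed

text \<open>The pairing \<open>a \<otimes> x \<mapsto> \<sigma>(a) \<delta>(x)\<close> respects the tensor relation \<open>a r \<otimes> x = a \<otimes> r x\<close> by the Leibniz
  rule.\<close>

lemma cocycle_induces_semilinear:
  fixes \<delta> :: "'g::group_add \<Rightarrow> complex"
  assumes \<sigma>: "\<sigma> \<in> character_torus" and \<delta>: "cocycle (\<sigma> \<circ> to_abf) \<delta>"
  obtains D where "semilinear \<sigma> D" "\<And>g. D (tensor 1 (group_difference g)) = \<delta> g"
proof -
  define F where "F = lin_ext of_int (\<lambda>(a, x). eval_int \<sigma> a * eval_int \<delta> x)"
  have F: "additive F" unfolding F_def by (rule additive_lin_ext[OF additive_of_int])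
  have F1: "F (frag_of (a, x)) = eval_int \<sigma> a * eval_int \<delta> x" for a x
    by (simp add: F_def eval_int_single)
  have F_rel: "F z = 0" if "z \<in> subgroup_gen tensor_relators" for z
    using that
  proof induction
    case (base s)
    have leib: "eval_int \<delta> (r * x) = eval_int \<sigma> (group_ring_map to_abf r) * eval_int \<delta> x"
      if "x \<in> augmentation_ideal" for r x
      using cocycle_leibniz[OF \<delta>, of r x] that
      by (simp add: eval_int_group_ring_map augmentation_ideal_def)
    from base consider
        (left) a b x where "s = frag_of (a + b, x) - frag_of (a, x) - frag_of (b, x)"
      | (right) a x y where "s = frag_of (a, x + y) - frag_of (a, x) - frag_of (a, y)"
      | (middle) a r x where "x \<in> augmentation_ideal"
          "s = frag_of (a * group_ring_map to_abf r, x) - frag_of (a, r * x)"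
      unfolding tensor_relators_def by blast
    then show ?case
      by cases (simp_all only: additive.diff[OF F] F1 additive.add[OF additive_eval_int] leib
          eval_int_mult[OF \<sigma>] distrib_left distrib_right mult.assoc diff_self add_diff_cancel_left')
  qed (simp_all add: additive.zero[OF F] additive.diff[OF F])
  define D where "D z = F (rep_alexander_module z)" for z
  have D_abs: "D (abs_alexander_module z) = F z" if "z \<in> tensor_free" for z
  proof -
    have "tensor_eq (rep_alexander_module (abs_alexander_module z)) z"
      by (rule Quotient_rep_abs[OF Quotient_alexander_module tensor_eq_refl[OF that]])
    then show ?thesis using F_rel by (fastforce simp: tensor_eq_def D_def additive.diff[OF F])
  qed
  have scale: "F (tensor_scale c z) = eval_int \<sigma> c * F z" if "z \<in> tensor_free" for c z
    using that
    by (induction z rule: tensor_free_induct)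
      (simp_all add: tensor_scale_zero tensor_scale_diff additive.zero[OF F] additive.diff[OF F]
        F1 eval_int_mult[OF \<sigma>] algebra_simps)
  show thesis
  proof (rule that[of D])
    show "semilinear \<sigma> D" unfolding semilinear_def
    proof (intro conjI allI)
      show "additive D"
      proof
        fix z w :: "'g alexander_module"
        obtain z' w' where "z' \<in> tensor_free" "z = abs_alexander_module z'"
          "w' \<in> tensor_free" "w = abs_alexander_module w'" by (metis alexander_module_cases)
        then show "D (z + w) = D z + D w"
          by (simp add: alexander_abs_add[symmetric] D_abs tensor_free_add additive.add[OF F])
      qed
      fix c and z :: "'g alexander_module"
      obtain z' where "z' \<in> tensor_free" "z = abs_alexander_module z'" by (rule alexander_module_cases)
      then show "D (alexander_scale c z) = eval_int \<sigma> c * D z"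
        by (simp add: alexander_abs_scale[symmetric] D_abs tensor_scale_free scale)
    qed
    fix g
    have "(\<sigma> \<circ> to_abf) 0 = (1 :: complex)"
      using to_abf_add[of 0 0] characterD(3)[OF \<sigma>] by (metis add_cancel_right_right add_0 comp_apply)
    then have "\<delta> 0 = 0" by (rule cocycle_zero[OF \<delta>])
    then have "eval_int \<delta> (group_difference g) = \<delta> g"
      unfolding group_difference_def single_one[symmetric]
      by (simp add: additive.diff[OF additive_eval_int] eval_int_single del: single_one)
    then show "D (tensor 1 (group_difference g)) = \<delta> g"
      unfolding tensor_def
      by (simp add: D_abs tensor_free_frag_of group_difference_in F1 eval_int_one[OF \<sigma>])
  qed
qed

text \<open>The cocycle identity comes from \<open>g h - 1 = g (h - 1) + (g - 1)\<close> in the group ring.\<close>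

lemma semilinear_induces_cocycle:
  assumes \<sigma>: "\<sigma> \<in> character_torus" and D: "semilinear \<sigma> D"
  shows "cocycle (\<sigma> \<circ> to_abf) (\<lambda>g. D (tensor 1 (group_difference g)))"
  unfolding cocycle_def
proof (intro allI)
  fix g h :: 'a
  have gh: "group_difference (g + h) = Poly_Mapping.single g 1 * group_difference h + group_difference g"
    by (simp add: group_difference_def right_diff_distrib mult_single)
  have "Poly_Mapping.single g 1 * group_difference h \<in> augmentation_ideal"
    using group_difference_in[of h] by (simp add: augmentation_ideal_def augmentation_mult)
  then have "tensor 1 (group_difference (g + h))
      = alexander_scale (Poly_Mapping.single (to_abf g) 1) (tensor 1 (group_difference h))
        + tensor 1 (group_difference g)"
    unfolding gh
    by (simp add: tensor_add_right group_difference_in tensor_mult_right group_ring_map_single)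
  then show "D (tensor 1 (group_difference (g + h)))
      = (\<sigma> \<circ> to_abf) g * D (tensor 1 (group_difference h)) + D (tensor 1 (group_difference g))"
    using D by (simp add: semilinear_def additive.add eval_int_single)
qed

text \<open>The differences \<open>g - 1\<close> span the augmentation ideal additively, so the \<open>1 \<otimes> (g - 1)\<close> generate the
  Alexander module.\<close>

lemma semilinear_eq_0:
  assumes D: "semilinear \<sigma> D" and 0: "\<And>g. D (tensor 1 (group_difference g)) = 0"
  shows "D z = 0"
proof -
  have addD: "additive D" using D by (simp add: semilinear_def)
  \<comment> \<open>Subtracting the augmentation turns a statement about the ideal into one about all of \<open>\<int>[G]\<close>,
    where induction over the free abelian group is available.\<close>
  have part: "D (tensor 1 (x - Poly_Mapping.single 0 (augmentation x))) = 0" for x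
  proof (rule frag_induction[of x UNIV])
    have "tensor 1 0 = tensor 1 0 + (tensor 1 0 :: 'a alexander_module)"
      using tensor_add_right[of 0 0 1] by (simp add: augmentation_ideal_def additive.zero[OF additive_augmentation])
    then show "D (tensor 1 (0 - Poly_Mapping.single 0 (augmentation 0))) = 0"
      using additive.zero[OF addD] by (simp add: additive.zero[OF additive_augmentation])
    show "D (tensor 1 (frag_of g - Poly_Mapping.single 0 (augmentation (frag_of g)))) = 0" for g
      using 0[of g] by (simp add: group_difference_def augmentation_single)
    fix x y :: "'a \<Rightarrow>\<^sub>0 int"
    let ?r = "\<lambda>x. x - Poly_Mapping.single 0 (augmentation x)"
    assume xy: "D (tensor 1 (?r x)) = 0" "D (tensor 1 (?r y)) = 0"
    have r: "?r z \<in> augmentation_ideal" for z :: "'a \<Rightarrow>\<^sub>0 int"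
      by (simp add: augmentation_ideal_def additive.diff[OF additive_augmentation] augmentation_single)
    have "?r x = ?r (x - y) + ?r y"
      by (simp add: additive.diff[OF additive_augmentation] single_diff)
    then have "tensor 1 (?r x) = tensor 1 (?r (x - y)) + tensor 1 (?r y)"
      using tensor_add_right[OF r r] by metis
    then show "D (tensor 1 (?r (x - y))) = 0" using xy by (simp add: additive.add[OF addD])
  qed simp
  obtain z' where z': "z' \<in> tensor_free" "z = abs_alexander_module z'" by (rule alexander_module_cases)
  have "z' \<in> tensor_free \<and> D (abs_alexander_module z') = 0" using z'(1)
  proof (induction z' rule: tensor_free_induct)
    case zero
    have "abs_alexander_module 0 = (0 :: 'a alexander_module)"
      by (simp only: zero_alexander_module_def)
    then show ?case by (simp add: tensor_free_zero additive.zero[OF addD])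
  next
    case (gen a x)
    then have "D (tensor 1 x) = 0" using part[of x] by (simp add: augmentation_ideal_def)
    moreover have "tensor a x = alexander_scale a (tensor 1 x)"
      unfolding tensor_def using alexander_abs_scale[OF tensor_free_frag_of[OF gen], of a 1] by simp
    ultimately show ?case using D gen by (simp add: tensor_def semilinear_def tensor_free_frag_of)
  next
    case (diff z w)
    then show ?case by (simp add: alexander_abs_diff tensor_free_diff additive.diff[OF addD])
  qed
  then show ?thesis using z'(2) by simp
qed

lemma semilinear_in_left_kernel:
  assumes P: "alexander_presentation m h M a" and D: "semilinear \<sigma> D"
  shows "(\<lambda>i. D (a i)) \<in> left_kernel m h (map_mat (eval_int \<sigma>) M)"
  unfolding left_kernel_def
proof (intro CollectI allI impI)
  fix l assume l: "l < h"
  have M: "M \<in> carrier_mat m h" using P by (simp add: alexander_presentation_def)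
  have addD: "additive D" using D by (simp add: semilinear_def)
  have col: "col M l \<in> carrier_vec m" using M by auto
  have unit: "col M l = M *\<^sub>v unit_vec h l" using M l by (intro eq_vecI) simp_all
  have "\<forall>w\<in>carrier_vec m. (\<Sum>i<m. alexander_scale (w $ i) (a i)) = 0
      \<longleftrightarrow> (\<exists>v\<in>carrier_vec h. w = M *\<^sub>v v)"
    using P unfolding alexander_presentation_def by (elim conjE)
  from this[rule_format, OF col] have "(\<Sum>i<m. alexander_scale (col M l $ i) (a i)) = 0"
    using unit by (metis unit_vec_carrier)
  then have "D (\<Sum>i<m. alexander_scale (col M l $ i) (a i)) = 0" by (simp add: additive.zero[OF addD])
  then have "(\<Sum>i<m. eval_int \<sigma> (col M l $ i) * D (a i)) = 0"
    using D by (simp add: additive.sum[OF addD] semilinear_def)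
  then show "(\<Sum>i<m. D (a i) * map_mat (eval_int \<sigma>) M $$ (i, l)) = 0"
    using M l by (simp add: mult.commute)
qed

lemma semilinear_determined_by_generators:
  assumes P: "alexander_presentation m h M a" and D: "semilinear \<sigma> D"
    and 0: "\<And>i. i < m \<Longrightarrow> D (a i) = 0"
  shows "D z = 0"
proof -
  obtain w where "z = (\<Sum>i<m. alexander_scale (w $ i) (a i))"
    using P unfolding alexander_presentation_def by blast
  then show ?thesis using D 0 by (simp add: semilinear_def additive.sum)
qed

text \<open>Two coefficient vectors of the same element differ by an element of the image of \<open>M\<close>, on which
  \<open>w \<mapsto> \<Sum>\<^sub>i \<sigma>(w\<^sub>i) v\<^sub>i\<close> vanishes, so this form descends to the Alexander module.\<close>

lemma left_kernel_induces_semilinear: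
  fixes M :: "'g::group_add lambda_ring mat"
  assumes P: "alexander_presentation m h M a" and \<sigma>: "\<sigma> \<in> character_torus"
    and v: "v \<in> left_kernel m h (map_mat (eval_int \<sigma>) M)"
  obtains D where "semilinear \<sigma> D" "\<And>i. i < m \<Longrightarrow> D (a i) = v i"
proof -
  interpret A: Modules.module "alexander_scale :: 'g lambda_ring \<Rightarrow> _" by (rule module_alexander_scale)
  note ev = additive_eval_int[of \<sigma>]
  have M: "M \<in> carrier_mat m h"
    and gen: "\<And>z. \<exists>w\<in>carrier_vec m. z = (\<Sum>i<m. alexander_scale (w $ i) (a i))"
    and rel: "\<And>w. w \<in> carrier_vec m \<Longrightarrow> (\<Sum>i<m. alexander_scale (w $ i) (a i)) = 0
      \<Longrightarrow> \<exists>x\<in>carrier_vec h. w = M *\<^sub>v x"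
    using P by (auto simp: alexander_presentation_def)
  define L where "L w = (\<Sum>i<m. eval_int \<sigma> (w $ i) * v i)" for w
  have L_rel: "L (M *\<^sub>v x) = 0" if x: "x \<in> carrier_vec h" for x
  proof -
    have "L (M *\<^sub>v x) = (\<Sum>i<m. (\<Sum>l<h. eval_int \<sigma> (M $$ (i, l)) * eval_int \<sigma> (x $ l)) * v i)"
      unfolding L_def using M x
      by (intro sum.cong refl)
        (simp add: scalar_prod_def additive.sum[OF ev] eval_int_mult[OF \<sigma>] lessThan_atLeast0)
    also have "\<dots> = (\<Sum>l<h. \<Sum>i<m. eval_int \<sigma> (M $$ (i, l)) * eval_int \<sigma> (x $ l) * v i)"
      unfolding sum_distrib_right by (rule sum.swap)
    also have "\<dots> = (\<Sum>l<h. eval_int \<sigma> (x $ l) * (\<Sum>i<m. v i * map_mat (eval_int \<sigma>) M $$ (i, l)))"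
      unfolding sum_distrib_left using M by (intro sum.cong refl) simp
    also have "\<dots> = 0" using v by (simp add: left_kernel_def)
    finally show ?thesis .
  qed
  have L_wd: "L w = L w'"
    if "w \<in> carrier_vec m" "w' \<in> carrier_vec m"
      "(\<Sum>i<m. alexander_scale (w $ i) (a i)) = (\<Sum>i<m. alexander_scale (w' $ i) (a i))" for w w'
  proof -
    have "(\<Sum>i<m. alexander_scale ((w - w') $ i) (a i)) = 0"
      using that by (simp add: A.scale_left_diff_distrib sum_subtractf)
    then have "L (w - w') = 0" using rel[of "w - w'"] that L_rel by (metis minus_carrier_vec)
    moreover have "L (w - w') = L w - L w'"
      using that by (simp add: L_def additive.diff[OF ev] left_diff_distrib sum_subtractf)
    ultimately show ?thesis by simp
  qed
  define D where "D z = L (SOME w. w \<in> carrier_vec m \<and> z = (\<Sum>i<m. alexander_scale (w $ i) (a i)))" for z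
  have D_eq: "D (\<Sum>i<m. alexander_scale (w $ i) (a i)) = L w" if "w \<in> carrier_vec m" for w
  proof -
    define w' where "w' = (SOME w'. w' \<in> carrier_vec m
      \<and> (\<Sum>i<m. alexander_scale (w $ i) (a i)) = (\<Sum>i<m. alexander_scale (w' $ i) (a i)))"
    have "w' \<in> carrier_vec m
      \<and> (\<Sum>i<m. alexander_scale (w $ i) (a i)) = (\<Sum>i<m. alexander_scale (w' $ i) (a i))"
      unfolding w'_def by (rule someI[of _ w]) (simp add: that)
    then show ?thesis unfolding D_def w'_def[symmetric] using L_wd[of w' w] that by simp
  qed
  show thesis
  proof (rule that[of D])
    show "semilinear \<sigma> D" unfolding semilinear_def
    proof (intro conjI allI)
      show "additive D"
      proof
        fix x y
        obtain w u where w: "w \<in> carrier_vec m" "x = (\<Sum>i<m. alexander_scale (w $ i) (a i))"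
          and u: "u \<in> carrier_vec m" "y = (\<Sum>i<m. alexander_scale (u $ i) (a i))"
          using gen by metis
        have xy: "x + y = (\<Sum>i<m. alexander_scale ((w + u) $ i) (a i))"
          using w u by (simp add: A.scale_left_distrib sum.distrib)
        have "D (x + y) = L (w + u)" unfolding xy using w u by (intro D_eq) simp
        also have "\<dots> = L w + L u"
          using w u by (simp add: L_def additive.add[OF ev] distrib_right sum.distrib)
        finally show "D (x + y) = D x + D y" using w u D_eq by simp
      qed
      fix c z
      obtain w where w: "w \<in> carrier_vec m" "z = (\<Sum>i<m. alexander_scale (w $ i) (a i))"
        using gen by metis
      have cz: "alexander_scale c z = (\<Sum>i<m. alexander_scale ((c \<cdot>\<^sub>v w) $ i) (a i))"
        using w by (simp add: A.scale_sum_right)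
      have "D (alexander_scale c z) = L (c \<cdot>\<^sub>v w)" unfolding cz using w by (intro D_eq) simp
      also have "\<dots> = eval_int \<sigma> c * L w"
        using w by (simp add: L_def eval_int_mult[OF \<sigma>] sum_distrib_left mult.assoc)
      finally show "D (alexander_scale c z) = eval_int \<sigma> c * D z" using w D_eq by simp
    qed
    fix i assume i: "i < m"
    have "(\<Sum>k<m. alexander_scale (unit_vec m i $ k) (a k)) = (\<Sum>k<m. if k = i then a k else 0)"
      using i by (intro sum.cong) auto
    also have "\<dots> = a i" using i by simp
    finally have "D (a i) = L (unit_vec m i)" using D_eq[of "unit_vec m i"] by simp
    also have "\<dots> = (\<Sum>k<m. if k = i then v k else 0)"
      unfolding L_def using i by (intro sum.cong) (auto simp: eval_int_one[OF \<sigma>] additive.zero[OF ev])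
    finally show "D (a i) = v i" using i by simp
  qed
qed

section \<open>Homology and the Alexander ideal\<close>

interpretation ideal: Modules.module "(*) :: 'a::comm_ring_1 \<Rightarrow> 'a \<Rightarrow> 'a"
  by (rule module_times)

lemma ideal_gen_induct [consumes 1, case_names zero step]:
  assumes "x \<in> ideal_gen S" "P 0" "\<And>c s y. s \<in> S \<Longrightarrow> P y \<Longrightarrow> P (c * s + y)"
  shows "P x"
  using assms ideal.span_induct_alt[of x S P] unfolding ideal_gen_def by blast

lemma submatrix_map_mat:
  "submatrix (map_mat f M) I J = map_mat f (submatrix M I J)"
  by (rule eq_matI) (auto simp: dim_submatrix submatrix_index pick_le)

lemma minor_cases:
  assumes "x \<in> minors (m - 1) M" "M \<in> carrier_mat m h" "m \<noteq> 0"
  obtains i0 J where "i0 < m" "J \<subseteq> {..<h}" "card J = m - 1" "x = det (submatrix M ({..<m} - {i0}) J)"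
proof -
  obtain I J where IJ: "x = det (submatrix M I J)" "I \<subseteq> {..<m}" "J \<subseteq> {..<h}" "card I = m - 1" "card J = m - 1"
    using assms by (auto simp: minors_def)
  have "card ({..<m} - I) = 1"
    using IJ assms(3) by (simp add: card_Diff_subset finite_subset[OF IJ(2)])
  then obtain i0 where "{..<m} - I = {i0}" by (rule card_1_singletonE)
  then have "I = {..<m} - {i0}" "i0 < m" using IJ(2) by auto
  then show thesis using that IJ by blast
qed

lemma minor_omitting_row_in:
  assumes "M \<in> carrier_mat m h" "i0 < m" "J \<subseteq> {..<h}" "card J = m - 1"
  shows "det (submatrix M ({..<m} - {i0}) J) \<in> minors (m - 1) M"
proof -
  have "card ({..<m} - {i0}) = m - 1" using assms(2) by simp
  then show ?thesis using assms unfolding minors_def by fastforce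
qed

text \<open>The germ at \<open>X = 0\<close> of a curve of characters through \<open>\<sigma>\<close> in the direction \<open>\<chi>\<close>.\<close>

definition curve :: "('h::ab_group_add \<Rightarrow> complex) \<Rightarrow> ('h \<Rightarrow> int) \<Rightarrow> ('h \<Rightarrow>\<^sub>0 complex) \<Rightarrow> complex fps" where
  "curve \<sigma> \<chi> = lin_ext fps_const (\<lambda>y. fps_const (\<sigma> y) * fps_exp (of_int (\<chi> y)))"

lemma additive_fps_const: "additive (fps_const :: complex \<Rightarrow> complex fps)"
  by unfold_locales simp

lemma additive_curve: "additive (curve \<sigma> \<chi>)"
  unfolding curve_def by (rule additive_lin_ext[OF additive_fps_const])

lemma curve_single:
  "curve \<sigma> \<chi> (Poly_Mapping.single y c) = fps_const (c * \<sigma> y) * fps_exp (of_int (\<chi> y))"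
  by (simp add: curve_def lin_ext_single[OF additive_fps_const] mult.assoc[symmetric])

lemma curve_mult:
  assumes "\<sigma> \<in> character_torus" "additive \<chi>"
  shows "curve \<sigma> \<chi> (x * y) = curve \<sigma> \<chi> x * curve \<sigma> \<chi> y"
  unfolding curve_def
  by (rule lin_ext_mult[OF additive_fps_const])
    (simp_all only: characterD[OF assms(1)] additive.add[OF assms(2)] of_int_add
      fps_exp_add_mult fps_const_mult[symmetric] mult.assoc mult.left_commute)

lemma curve_one:
  assumes "\<sigma> \<in> character_torus" "additive \<chi>"
  shows "curve \<sigma> \<chi> 1 = 1"
  using curve_single[of \<sigma> \<chi> 0 1] by (simp add: characterD[OF assms(1)] additive.zero[OF assms(2)])

lemma curve_nth_0: "fps_nth (curve \<sigma> \<chi> x) 0 = pairing \<sigma> x"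
proof (rule additive_eq_on_singles[of "\<lambda>x. fps_nth (curve \<sigma> \<chi> x) 0" "pairing \<sigma>"])
  show "additive (\<lambda>x. fps_nth (curve \<sigma> \<chi> x) 0)"
    by unfold_locales (simp add: additive.add[OF additive_curve])
qed (simp_all add: curve_single pairing_single additive_pairing)

lemma pairing_complexify: "pairing \<sigma> (complexify x) = eval_int \<sigma> x"
  by (simp add: lin_ext_complexify[OF additive_id])

lemma ideal_power_member: "x \<in> I \<Longrightarrow> x ^ d \<in> ideal_power I d"
  by (induction d) (auto simp: ideal_prod_def ideal_gen_def intro!: ideal.span_base)

context
  fixes m h :: nat and M :: "'g::group_add lambda_ring mat" and a :: "nat \<Rightarrow> 'g alexander_module"
    and \<sigma> :: "'g abf \<Rightarrow> complex" and g0 :: 'g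
  assumes P: "alexander_presentation m h M a" and \<sigma>: "\<sigma> \<in> character_torus"
    and g0: "\<sigma> (to_abf g0) \<noteq> 1"
begin

abbreviation (input) "\<rho> \<equiv> \<sigma> \<circ> to_abf"

lemma presentation_carrier: "M \<in> carrier_mat m h"
  using P by (simp add: alexander_presentation_def)

lemma pullback_add: "\<rho> (g + g') = \<rho> g * \<rho> g'"
  by (simp add: to_abf_add characterD[OF \<sigma>])

text \<open>Together with the chain \<open>[g0]\<close>, which is not a cycle, \<open>T\<close> gives \<open>card T + 1\<close> classes of chains modulo
  boundaries. Dual to them are as many independent cocycles, hence relations between the rows of the
  presentation matrix at \<open>\<sigma>\<close>.\<close>

lemma minor_vanishing_order:
  assumes T: "finite T" "T \<subseteq> {x. bar_d1 \<rho> x = 0}" "independent_mod (range (bar_d2 \<rho>)) T"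
    and \<chi>: "additive \<chi>" and m: "m \<noteq> 0" and x: "x \<in> minors (m - 1) M"
  shows "fps_X ^ card T dvd curve \<sigma> \<chi> (complexify x)"
proof -
  define t0 where "t0 = Poly_Mapping.single g0 (1 :: complex)"
  define T' where "T' = insert t0 T"
  have t0: "bar_d1 \<rho> t0 \<noteq> 0" using g0 by (simp add: t0_def bar_d1_eq_pairing pairing_single)
  have "t0 \<notin> T" using t0 T(2) by blast
  then have card: "card T' - 1 = card T" using T(1) by (simp add: T'_def)
  have T': "finite T'" "independent_mod (range (bar_d2 \<rho>)) T'"
    using T independent_mod_insert_nonprincipal[OF pullback_add T(2,3) t0] by (simp_all add: T'_def)
  obtain \<delta> where \<delta>W: "\<And>t w. t \<in> T' \<Longrightarrow> w \<in> range (bar_d2 \<rho>) \<Longrightarrow> pairing (\<delta> t) w = 0"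
    and \<delta>1: "\<And>t t'. t \<in> T' \<Longrightarrow> t' \<in> T' \<Longrightarrow> pairing (\<delta> t) t' = (if t' = t then 1 else 0)"
    using dual_functionals[OF subspace_range_bar_d2 T'(2)] by blast
  have "\<exists>D. semilinear \<sigma> D \<and> (\<forall>g. D (tensor 1 (group_difference g)) = \<delta> t g)" if "t \<in> T'" for t
  proof -
    have "cocycle \<rho> (\<delta> t)" using \<delta>W[OF that] by (simp add: cocycle_iff_pairing_bar_d2)
    then show ?thesis using cocycle_induces_semilinear[OF \<sigma>] by metis
  qed
  then obtain D where D: "\<And>t. t \<in> T' \<Longrightarrow> semilinear \<sigma> (D t)"
    and D\<delta>: "\<And>t g. t \<in> T' \<Longrightarrow> D t (tensor 1 (group_difference g)) = \<delta> t g" by metis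
  have ind: "c s = 0" if c: "\<And>i. i < m \<Longrightarrow> (\<Sum>t\<in>T'. c t * D t (a i)) = 0" and s: "s \<in> T'" for c s
  proof -
    have "semilinear \<sigma> (\<lambda>z. \<Sum>t\<in>T'. c t * D t z)"
      unfolding semilinear_def additive_def sum_distrib_left sum.distrib[symmetric]
      by (intro conjI allI sum.cong refl)
        (use D in \<open>simp_all add: semilinear_def additive_def distrib_left\<close>)
    then have D0: "(\<Sum>t\<in>T'. c t * D t z) = 0" for z
      using semilinear_determined_by_generators[OF P, of \<sigma> "\<lambda>z. \<Sum>t\<in>T'. c t * D t z"] c by blast
    have zero: "(\<Sum>t\<in>T'. c t * \<delta> t g) = 0" for g
      using D0[of "tensor 1 (group_difference g)"] by (simp add: D\<delta>)
    have "(\<Sum>t\<in>T'. c t * pairing (\<delta> t) s)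
        = (\<Sum>k\<in>Poly_Mapping.keys s. Poly_Mapping.lookup s k * (\<Sum>t\<in>T'. c t * \<delta> t k))"
      unfolding lin_ext_def sum_distrib_left
      by (rule trans[OF sum.swap]) (intro sum.cong refl mult.left_commute)
    also have "\<dots> = 0" by (simp add: zero)
    also have "(\<Sum>t\<in>T'. c t * pairing (\<delta> t) s) = (\<Sum>t\<in>T'. if s = t then c t else 0)"
      using \<delta>1 s by (intro sum.cong) auto
    finally show ?thesis using T'(1) s by simp
  qed
  let ?h = "\<lambda>x. curve \<sigma> \<chi> (complexify x)"
  interpret hom: comm_ring_hom ?h
    by unfold_locales (simp_all add: additive.add[OF additive_complexify] additive.add[OF additive_curve]
        additive.zero[OF additive_complexify] additive.zero[OF additive_curve]
        complexify_mult complexify_one curve_mult[OF \<sigma> \<chi>] curve_one[OF \<sigma> \<chi>])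
  have M: "M \<in> carrier_mat m h" by (rule presentation_carrier)
  obtain i0 J where i0: "i0 < m" and J: "J \<subseteq> {..<h}" "card J = m - 1"
    and x: "x = det (submatrix M ({..<m} - {i0}) J)"
    using minor_cases[OF x M m] by blast
  have ker: "(\<lambda>i. D t (a i)) \<in> left_kernel m h (map_mat (\<lambda>f. fps_nth f 0) (map_mat ?h M))" if "t \<in> T'" for t
  proof -
    have "map_mat (\<lambda>f. fps_nth f 0) (map_mat ?h M) = map_mat (eval_int \<sigma>) M"
      by (rule eq_matI) (simp_all add: curve_nth_0 pairing_complexify)
    then show ?thesis using semilinear_in_left_kernel[OF P D[OF that]] by simp
  qed
  have "fps_X ^ (card T' - 1) dvd det (submatrix (map_mat ?h M) ({..<m} - {i0}) J)"
    by (rule power_dvd_minor[of "map_mat ?h M" m h i0 J T' "\<lambda>t i. D t (a i)"])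
      (use M i0 J T'(1) ind ker in auto)
  then show ?thesis unfolding submatrix_map_mat hom.hom_det card x .
qed

text \<open>The order of vanishing along the curve passes from the minors to the Alexander ideal, and from
  there to \<open>\<Delta>\<close>. It bounds the size of every independent set of cycles modulo boundaries, so the
  homology is finite-dimensional, which the second claim relies on.\<close>

lemma twisted_b1_bounds:
  assumes \<chi>: "additive \<chi>" and m: "m \<noteq> 0" and ap: "almost_principal (ideal_gen (minors (m - 1) M)) \<Delta>"
    and nz: "curve \<sigma> \<chi> (complexify \<Delta>) \<noteq> 0"
  shows "twisted_b1 \<rho> \<le> subdegree (curve \<sigma> \<chi> (complexify \<Delta>))"
    and "twisted_b1 \<rho> = 0 \<longleftrightarrow> {x. bar_d1 \<rho> x = 0} \<subseteq> range (bar_d2 \<rho>)"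
proof -
  have "card T \<le> subdegree (curve \<sigma> \<chi> (complexify \<Delta>))"
    if T: "finite T" "T \<subseteq> {x. bar_d1 \<rho> x = 0}" "independent_mod (range (bar_d2 \<rho>)) T" for T
  proof -
    note mult = curve_mult[OF \<sigma> \<chi>] and add = additive.add[OF additive_curve]
    let ?E = "ideal_gen (minors (m - 1) M)" and ?X = "fps_X ^ card T :: complex fps"
    have E: "?X dvd curve \<sigma> \<chi> (complexify x)" if "x \<in> ?E" for x
      using that
    proof (induction rule: ideal_gen_induct)
      case (step c s y)
      then show ?case using minor_vanishing_order[OF T \<chi> m]
        by (simp add: additive.add[OF additive_complexify] complexify_mult add mult)
    qed (simp add: additive.zero[OF additive_complexify] additive.zero[OF additive_curve])
    have EC: "?X dvd curve \<sigma> \<chi> x" if "x \<in> ideal_extension_C ?E" for x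
      using that unfolding ideal_extension_C_def
    proof (induction rule: ideal_gen_induct)
      case (step c s y)
      then show ?case using E by (auto simp: add mult)
    qed (simp add: additive.zero[OF additive_curve])
    obtain d where d: "ideal_extension_C (ideal_prod (ideal_power augmentation_ideal d) (ideal_gen {\<Delta>}))
        \<subseteq> ideal_extension_C ?E"
      using ap unfolding almost_principal_def by blast
    \<comment> \<open>An element of the augmentation ideal that does not vanish at \<open>\<sigma>\<close>: it is a unit along the curve.\<close>
    define y where "y = Poly_Mapping.single (to_abf g0) (1 :: int) - 1"
    have y: "y \<in> augmentation_ideal"
      unfolding y_def single_one[symmetric] augmentation_ideal_def
      by (simp add: additive.diff[OF additive_augmentation] augmentation_single del: single_one)
    have "y ^ d * \<Delta> \<in> ideal_prod (ideal_power augmentation_ideal d) (ideal_gen {\<Delta>})"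
      using ideal_power_member[OF y] unfolding ideal_prod_def ideal_gen_def
      by (intro ideal.span_base) (auto intro: ideal.span_base)
    then have "complexify (y ^ d * \<Delta>) \<in> ideal_extension_C ?E"
      using d unfolding ideal_extension_C_def ideal_gen_def by (meson ideal.span_base image_eqI subsetD)
    then have "?X dvd curve \<sigma> \<chi> (complexify (y ^ d)) * curve \<sigma> \<chi> (complexify \<Delta>)"
      using EC by (metis complexify_mult mult)
    moreover have "curve \<sigma> \<chi> (complexify (y ^ d)) dvd 1"
    proof -
      have "eval_int \<sigma> y = \<sigma> (to_abf g0) - 1"
        using eval_int_one[OF \<sigma>] by (simp add: y_def additive.diff[OF additive_eval_int] eval_int_single)
      moreover have "eval_int \<sigma> (y ^ d) = eval_int \<sigma> y ^ d"
        by (induction d) (simp_all add: eval_int_mult[OF \<sigma>] eval_int_one[OF \<sigma>])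
      ultimately show ?thesis using g0 by (simp add: curve_nth_0 pairing_complexify)
    qed
    ultimately have "?X dvd curve \<sigma> \<chi> (complexify \<Delta>)"
      using dvd_mult_unit_iff' by blast
    then show "card T \<le> subdegree (curve \<sigma> \<chi> (complexify \<Delta>))"
      using nz dvd_imp_subdegree_le[of ?X] by simp
  qed
  note bounded = quotient_dim_bounded[OF subspace_range_bar_d2 this]
  show "twisted_b1 \<rho> \<le> subdegree (curve \<sigma> \<chi> (complexify \<Delta>))"
    and "twisted_b1 \<rho> = 0 \<longleftrightarrow> {x. bar_d1 \<rho> x = 0} \<subseteq> range (bar_d2 \<rho>)"
    unfolding twisted_b1_def by (rule bounded; assumption)+
qed

text \<open>If all cycles were boundaries, all cocycles would be multiples of the principal one. The latter
  corresponds to a vector of the left kernel with some entry \<open>i0\<close> non-zero. The vanishing of the minors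
  that omit row \<open>i0\<close> gives another non-zero vector of the left kernel, with entry \<open>i0\<close> zero.\<close>

lemma nontrivial_homology:
  assumes E: "\<And>e. e \<in> ideal_gen (minors (m - 1) M) \<Longrightarrow> eval_int \<sigma> e = 0"
  shows "\<not> {x. bar_d1 \<rho> x = 0} \<subseteq> range (bar_d2 \<rho>)"
proof
  assume sub: "{x. bar_d1 \<rho> x = 0} \<subseteq> range (bar_d2 \<rho>)"
  have M: "M \<in> carrier_mat m h" by (rule presentation_carrier)
  interpret hom: comm_ring_hom "eval_int \<sigma>"
    by unfold_locales (simp_all add: additive.add[OF additive_eval_int]
        additive.zero[OF additive_eval_int] eval_int_mult[OF \<sigma>] eval_int_one[OF \<sigma>])
  have "cocycle \<rho> (\<lambda>g. \<rho> g - 1)" by (rule cocycle_d1[OF pullback_add])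
  then obtain D0 where D0: "semilinear \<sigma> D0" and D0g: "\<And>g. D0 (tensor 1 (group_difference g)) = \<rho> g - 1"
    using cocycle_induces_semilinear[OF \<sigma>] by blast
  have "\<exists>i<m. D0 (a i) \<noteq> 0"
  proof (rule ccontr)
    assume "\<not> (\<exists>i<m. D0 (a i) \<noteq> 0)"
    then have "D0 (tensor 1 (group_difference g0)) = 0"
      using semilinear_determined_by_generators[OF P D0] by blast
    then show False using g0 D0g[of g0] by simp
  qed
  then obtain i0 where i0: "i0 < m" "D0 (a i0) \<noteq> 0" by blast
  have van: "det (submatrix (map_mat (eval_int \<sigma>) M) ({..<m} - {i0}) J) = 0"
    if "J \<subseteq> {..<h}" "card J = m - 1" for J
    unfolding submatrix_map_mat hom.hom_det
    by (rule E) (use minor_omitting_row_in[OF M i0(1) that] in \<open>simp add: ideal_gen_def ideal.span_base\<close>)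
  have "map_mat (eval_int \<sigma>) M \<in> carrier_mat m h" using M by simp
  then obtain u i where u: "u \<in> left_kernel m h (map_mat (eval_int \<sigma>) M)" "u i0 = 0"
    and i: "i < m" "u i \<noteq> 0"
    by (rule left_kernel_of_vanishing_minors[OF _ i0(1) van]) blast
  obtain D where D: "semilinear \<sigma> D" and Du: "\<And>i. i < m \<Longrightarrow> D (a i) = u i"
    using left_kernel_induces_semilinear[OF P \<sigma> u(1)] by blast
  define \<kappa> where "\<kappa> = D (tensor 1 (group_difference g0)) / (\<rho> g0 - 1)"
  have "D (tensor 1 (group_difference g)) = \<kappa> * (\<rho> g - 1)" for g
    unfolding \<kappa>_def using g0
    by (intro cocycle_multiple_of_principal[OF sub semilinear_induces_cocycle[OF \<sigma> D]]) simp
  moreover have "semilinear \<sigma> (\<lambda>z. D z - \<kappa> * D0 z)"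
    using D D0 by (simp add: semilinear_def additive_def distrib_left right_diff_distrib
        mult.left_commute[of \<kappa>])
  ultimately have "D z = \<kappa> * D0 z" for z
    using semilinear_eq_0[of \<sigma> "\<lambda>z. D z - \<kappa> * D0 z" z] D0g by simp
  then have D\<kappa>: "u k = \<kappa> * D0 (a k)" if "k < m" for k using Du[OF that] by simp
  have "\<kappa> = 0" using D\<kappa>[OF i0(1)] u(2) i0(2) by simp
  then show False using D\<kappa> i by simp
qed

end

section \<open>Divisors with a single essential variable\<close>

lemma eq_up_to_unit_sym:
  assumes "a \<doteq> b" shows "b \<doteq> a"
proof -
  obtain u v where uv: "1 = u * v" "a = u * b" using assms unfolding eq_up_to_unit_def dvd_def by blast
  have "v * a = (u * v) * b" unfolding uv(2) by (simp only: ac_simps)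
  also have "\<dots> = b" unfolding uv(1)[symmetric] by (rule mult_1)
  finally have "b = v * a" by (rule sym)
  moreover have "v dvd 1" unfolding uv(1) by (rule dvd_triv_right)
  ultimately show ?thesis unfolding eq_up_to_unit_def by blast
qed

lemma eq_up_to_unit_trans:
  assumes "a \<doteq> b" "b \<doteq> c" shows "a \<doteq> c"
proof -
  obtain u v where uv: "u dvd 1" "v dvd 1" "a = u * b" "b = v * c"
    using assms unfolding eq_up_to_unit_def by blast
  have "u * v dvd 1" using mult_dvd_mono[OF uv(1,2)] by simp
  moreover have "a = u * v * c" unfolding uv(3,4) by (rule mult.assoc[symmetric])
  ultimately show ?thesis unfolding eq_up_to_unit_def by blast
qed

lemma complexify_unit:
  assumes "(u :: 'a::ab_group_add \<Rightarrow>\<^sub>0 int) dvd 1"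
  shows "complexify u dvd 1"
proof -
  obtain v where "1 = u * v" using assms by (elim dvdE)
  then have "1 = complexify u * complexify v" by (metis complexify_mult complexify_one)
  then show ?thesis by (rule dvdI)
qed

text \<open>Write \<open>\<Delta>\<close> as a Laurent polynomial in \<open>\<nu>(1)\<close>. If \<open>\<nu>(1) = 0\<close> it is constant; otherwise \<open>\<nu>(1)\<close> is a
  multiple of a basis element \<open>h0\<close>, and \<open>\<Delta>\<close> is a Laurent polynomial in \<open>h0\<close> that splits over \<open>\<complex>\<close>.\<close>

lemma irreducible_factors_linear:
  fixes \<Delta> :: "'g::group_add lambda_ring"
  assumes fg: "finitely_generated_group TYPE('g)" and sev: "single_essential_variable \<Delta>"
    and nc: "\<not> is_const_up_to_unit \<Delta>"
  obtains h0 \<chi> \<iota> where "primitive_element h0 \<chi> (\<iota> :: 'g abf \<Rightarrow> (nat \<Rightarrow>\<^sub>0 int))" "complexify \<Delta> \<noteq> 0"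
    "\<And>f. irreducible f \<Longrightarrow> f dvd complexify \<Delta> \<Longrightarrow> \<exists>w. w \<noteq> 0 \<and> f \<doteq> linear_factor h0 w"
proof -
  obtain P :: "int \<Rightarrow>\<^sub>0 int" and \<nu> :: "int \<Rightarrow> 'g abf"
    where \<nu>: "additive \<nu>" and \<Delta>: "\<Delta> \<doteq> group_ring_map \<nu> P"
    using sev unfolding single_essential_variable_def additive_def by blast
  have grm: "group_ring_map \<nu> P = (\<Sum>k\<in>Poly_Mapping.keys P. Poly_Mapping.single (\<nu> k) (Poly_Mapping.lookup P k))"
    unfolding group_ring_map_def frag_extend_def
    by (intro sum.cong refl poly_mapping_eqI) (simp add: lookup_single when_def)
  have h: "\<nu> 1 \<noteq> 0"
  proof
    assume "\<nu> 1 = 0"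
    then have "\<nu> k = 0" for k using additive_int_eq_zmul[OF \<nu>, of k] by simp
    moreover have single_int: "Poly_Mapping.single 0 c = (of_int c :: 'g lambda_ring)" for c :: int
      using single_of_int[of c, where 'b = int] by simp
    ultimately have "group_ring_map \<nu> P = (\<Sum>k\<in>Poly_Mapping.keys P. of_int (Poly_Mapping.lookup P k))"
      unfolding grm using single_int by simp
    then have "group_ring_map \<nu> P = of_int (\<Sum>k\<in>Poly_Mapping.keys P. Poly_Mapping.lookup P k)" by simp
    then show False using nc \<Delta> unfolding is_const_up_to_unit_def by metis
  qed
  obtain I0 and x0 :: "nat \<Rightarrow> 'g abf" where gen: "generates I0 x0"
    by (rule finitely_generated_abf[OF fg])
  obtain h0 d and \<chi> :: "'g abf \<Rightarrow> int" and \<iota> :: "'g abf \<Rightarrow> (nat \<Rightarrow>\<^sub>0 int)" where hd: "\<nu> 1 = zmul d h0"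
    and *: "additive \<chi>" "\<chi> h0 = 1" "additive \<iota>" "inj \<iota>"
    by (rule primitive_root[OF abf_torsion_free gen h]) blast
  then interpret primitive_element h0 \<chi> \<iota> by (intro primitive_element.intro)
  have "\<Delta> \<noteq> 0"
  proof
    assume "\<Delta> = 0"
    then have "\<Delta> \<doteq> of_int 0" unfolding eq_up_to_unit_def by (intro exI[of _ 1]) simp
    then show False using nc unfolding is_const_up_to_unit_def by blast
  qed
  then have nz: "complexify \<Delta> \<noteq> 0" by (simp add: complexify_eq_0_iff)
  obtain v where v: "v dvd 1" "\<Delta> = v * group_ring_map \<nu> P" using \<Delta> by (auto simp: eq_up_to_unit_def)
  have \<nu>h: "\<nu> k = zmul (k * d) h0" for k
    using additive_int_eq_zmul[OF \<nu>, of k] by (simp add: hd zmul_zmul)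
  have F: "complexify (group_ring_map \<nu> P)
      = (\<Sum>k\<in>Poly_Mapping.keys P. Poly_Mapping.single (zmul (k * d) h0) (of_int (Poly_Mapping.lookup P k)))"
    unfolding grm additive.sum[OF additive_complexify] complexify_single \<nu>h by (rule refl)
  have "complexify (group_ring_map \<nu> P) \<noteq> 0"
    using nz unfolding v(2) complexify_mult by (metis mult_zero_right)
  then obtain u ws where u: "u dvd 1"
    and uw: "complexify (group_ring_map \<nu> P) = u * (\<Prod>w\<in>#ws. linear_factor h0 w)"
    unfolding F by (rule laurent_polynomial_factorization[OF finite_keys]) blast
  have eq: "complexify \<Delta> = (complexify v * u) * (\<Prod>w\<in>#ws. linear_factor h0 w)"
    unfolding v(2) complexify_mult uw by (rule mult.assoc[symmetric])
  have unit: "complexify v * u dvd 1" using mult_dvd_mono[OF complexify_unit[OF v(1)] u] by simp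
  show thesis
  proof (rule that[OF primitive_element_axioms nz])
    fix f :: "'g lambda_ring_C" assume f: "irreducible f" "f dvd complexify \<Delta>"
    show "\<exists>w. w \<noteq> 0 \<and> f \<doteq> linear_factor h0 w"
      by (rule irreducible_factor_of_linear_product[OF f(1) f(2)[unfolded eq] unit])
  qed
qed

lemma pairing_unit:
  assumes "\<sigma> \<in> character_torus" "(u :: 'h::ab_group_add \<Rightarrow>\<^sub>0 complex) dvd 1"
  shows "pairing \<sigma> u \<noteq> 0"
proof -
  obtain v where "1 = u * v" using assms(2) by (elim dvdE)
  then have "pairing \<sigma> u * pairing \<sigma> v = pairing \<sigma> 1"
    using lin_ext_mult[OF additive_id, of \<sigma> u v] characterD[OF assms(1)] by simp
  also have "\<dots> = 1" using pairing_single[of \<sigma> 0 1] characterD[OF assms(1)] by simp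
  finally show ?thesis by auto
qed

text \<open>The curve sends \<open>h0 - w\<close> to \<open>\<sigma>(h0) exp(X) - w\<close>, whose linear coefficient \<open>\<sigma>(h0)\<close> is not zero: since
  \<open>\<chi>(h0) = 1\<close>, the curve is transversal to the zero set.\<close>

lemma (in primitive_element) subdegree_curve_linear_factor:
  assumes \<sigma>: "\<sigma> \<in> character_torus" and f: "f \<doteq> linear_factor h0 w"
  shows "curve \<sigma> \<chi> f \<noteq> 0" "subdegree (curve \<sigma> \<chi> f) = (if \<sigma> h0 = w then 1 else 0)"
    "pairing \<sigma> f = 0 \<longleftrightarrow> \<sigma> h0 = w"
proof -
  obtain u where u: "u dvd 1" "f = u * linear_factor h0 w" using f by (auto simp: eq_up_to_unit_def)
  let ?l = "curve \<sigma> \<chi> (linear_factor h0 w)"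
  have l: "?l = fps_const (\<sigma> h0) * fps_exp 1 - fps_const w"
    by (simp add: linear_factor_def additive.diff[OF additive_curve] curve_single
        additive.zero[OF chi(1)] chi(2) characterD[OF \<sigma>])
  have l1: "fps_nth ?l 1 \<noteq> 0" using characterD(2)[OF \<sigma>, of h0] by (simp add: l fps_exp_def)
  have l0: "fps_nth ?l 0 = \<sigma> h0 - w" by (simp add: l)
  have ln: "?l \<noteq> 0" using l1 by auto
  have sl: "subdegree ?l = (if \<sigma> h0 = w then 1 else 0)"
    by (cases "\<sigma> h0 = w") (use l0 l1 in \<open>auto intro!: subdegreeI\<close>)
  have u0: "fps_nth (curve \<sigma> \<chi> u) 0 \<noteq> 0" using pairing_unit[OF \<sigma> u(1)] by (simp add: curve_nth_0)
  then have un: "curve \<sigma> \<chi> u \<noteq> 0" by auto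
  have fl: "curve \<sigma> \<chi> f = curve \<sigma> \<chi> u * ?l" unfolding u(2) by (rule curve_mult[OF \<sigma> chi(1)])
  show "curve \<sigma> \<chi> f \<noteq> 0" unfolding fl using ln un by simp
  show "subdegree (curve \<sigma> \<chi> f) = (if \<sigma> h0 = w then 1 else 0)"
    unfolding fl using ln un u0 sl by (simp add: subdegree_eq_0_iff)
  show "pairing \<sigma> f = 0 \<longleftrightarrow> \<sigma> h0 = w"
    unfolding curve_nth_0[of \<sigma> \<chi>, symmetric] fl using u0 l0 by simp
qed

theorem corollary6p10:
  fixes E :: "'g::group_add lambda_ring set"
    and \<Delta> :: "'g lambda_ring"
    and J :: "'j set" and f :: "'j \<Rightarrow> 'g lambda_ring_C" and \<mu> :: "'j \<Rightarrow> nat"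
  assumes "finitely_generated_group TYPE('g)"
    and "is_alexander_ideal E"
    and "is_gcd_of \<Delta> E"
    and "almost_principal E \<Delta>"
    and "single_essential_variable \<Delta>"
    and "\<not> is_const_up_to_unit \<Delta>"
    and "finite J"
    and "\<And>j. j \<in> J \<Longrightarrow> irreducible (f j)"
    and "\<And>i j. i \<in> J \<Longrightarrow> j \<in> J \<Longrightarrow> i \<noteq> j \<Longrightarrow> \<not> f i \<doteq> f j"
    and "\<And>j. j \<in> J \<Longrightarrow> \<mu> j \<ge> 1"
    and "complexify \<Delta> \<doteq> (\<Prod>j\<in>J. f j ^ \<mu> j)"
  shows "disjoint_family_on (\<lambda>j. zero_set (f j)) J
      \<and> (characteristic_variety1 \<inter> character_torus0) - {\<lambda>_. 1}
          = (\<Union>j\<in>J. zero_set (f j)) - {\<lambda>_. 1}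
      \<and> (\<forall>j\<in>J. \<forall>\<rho>\<in>zero_set (f j). \<rho> \<noteq> (\<lambda>_. 1) \<longrightarrow>
          1 \<le> twisted_b1 \<rho> \<and> twisted_b1 \<rho> \<le> \<mu> j)"
proof -
  obtain m h M a where P: "alexander_presentation m h M (a :: nat \<Rightarrow> 'g alexander_module)"
    and E: "E = ideal_gen (minors (m - 1) M)"
    using assms(2) unfolding is_alexander_ideal_def by blast
  have \<Delta>E: "\<Delta> dvd e" if "e \<in> E" for e using assms(3) that by (simp add: is_gcd_of_def)
  \<comment> \<open>Without generators, the empty minor \<open>1\<close> lies in the Alexander ideal, and \<open>\<Delta>\<close> is a unit.\<close>
  have m: "m \<noteq> 0"
  proof
    assume "m = 0"
    then have "det (submatrix M {} {}) \<in> E"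
      unfolding E minors_def ideal_gen_def
      by (intro ideal.span_base CollectI exI[of _ "{}"] conjI) simp_all
    then have "\<Delta> dvd 1" using \<Delta>E by (simp add: det_def dim_submatrix)
    then have "\<Delta> \<doteq> of_int 1" by (auto simp: eq_up_to_unit_def)
    then show False using assms(6) unfolding is_const_up_to_unit_def by blast
  qed
  obtain h0 \<chi> \<iota> where prim: "primitive_element h0 \<chi> (\<iota> :: 'g abf \<Rightarrow> (nat \<Rightarrow>\<^sub>0 int))"
    and nz: "complexify \<Delta> \<noteq> 0"
    and lin: "\<And>f. irreducible f \<Longrightarrow> f dvd complexify \<Delta> \<Longrightarrow> \<exists>w. w \<noteq> 0 \<and> f \<doteq> linear_factor h0 w"
    using irreducible_factors_linear[OF assms(1,5,6)] by blast
  interpret primitive_element h0 \<chi> \<iota> by (rule prim)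
  obtain u where u: "u dvd 1" "complexify \<Delta> = u * (\<Prod>j\<in>J. f j ^ \<mu> j)"
    using assms(11) by (auto simp: eq_up_to_unit_def)
  have "f j dvd complexify \<Delta>" if j: "j \<in> J" for j
  proof -
    have "f j dvd f j ^ \<mu> j" using assms(10)[OF j] by (intro dvd_power) simp
    also have "\<dots> dvd (\<Prod>j\<in>J. f j ^ \<mu> j)" by (rule dvd_prodI[OF assms(7) j])
    finally show ?thesis unfolding u(2) by simp
  qed
  then have "\<exists>w. f j \<doteq> linear_factor h0 w" if "j \<in> J" for j using lin assms(8) that by blast
  then obtain w where w: "\<And>j. j \<in> J \<Longrightarrow> f j \<doteq> linear_factor h0 (w j)" by metis
  have w_inj: "i = j" if "i \<in> J" "j \<in> J" "w i = w j" for i j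
    using assms(9)[OF that(1,2)] eq_up_to_unit_trans[OF w[OF that(1)]] eq_up_to_unit_sym[OF w[OF that(2)]]
      that(3) by metis
  have zero_set: "zero_set (f j) = (\<lambda>\<sigma>. \<sigma> \<circ> to_abf) ` {\<sigma> \<in> character_torus. \<sigma> h0 = w j}" if "j \<in> J" for j
    using subdegree_curve_linear_factor(3)[OF _ w[OF that]]
    by (auto simp: zero_set_def eval_character_def lin_ext_def)
  \<comment> \<open>At most one term of the sum is non-zero: the order of \<open>\<Delta>\<close> is the multiplicity of the factor
    that vanishes at \<open>\<sigma>\<close>.\<close>
  have sub: "curve \<sigma> \<chi> (complexify \<Delta>) \<noteq> 0 \<and>
      subdegree (curve \<sigma> \<chi> (complexify \<Delta>)) = (\<Sum>j\<in>J. if \<sigma> h0 = w j then \<mu> j else 0)"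
    if \<sigma>: "\<sigma> \<in> character_torus" for \<sigma>
  proof -
    note curve_f = subdegree_curve_linear_factor[OF \<sigma> w]
    interpret comm_ring_hom "curve \<sigma> \<chi>"
      by unfold_locales (simp_all add: additive.add[OF additive_curve] additive.zero[OF additive_curve]
          curve_mult[OF \<sigma> chi(1)] curve_one[OF \<sigma> chi(1)])
    have c: "curve \<sigma> \<chi> (complexify \<Delta>) = curve \<sigma> \<chi> u * (\<Prod>j\<in>J. curve \<sigma> \<chi> (f j) ^ \<mu> j)"
      unfolding u(2) by (simp add: hom_distribs)
    have u0: "fps_nth (curve \<sigma> \<chi> u) 0 \<noteq> 0" using pairing_unit[OF \<sigma> u(1)] by (simp add: curve_nth_0)
    then have un: "curve \<sigma> \<chi> u \<noteq> 0" by auto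
    have pn: "(\<Prod>j\<in>J. curve \<sigma> \<chi> (f j) ^ \<mu> j) \<noteq> 0" using curve_f(1) assms(7) by simp
    have "subdegree (\<Prod>j\<in>J. curve \<sigma> \<chi> (f j) ^ \<mu> j) = (\<Sum>j\<in>J. subdegree (curve \<sigma> \<chi> (f j) ^ \<mu> j))"
      using curve_f(1) by (intro subdegree_prod) auto
    also have "\<dots> = (\<Sum>j\<in>J. if \<sigma> h0 = w j then \<mu> j else 0)"
      using curve_f(2) by (intro sum.cong) auto
    finally show ?thesis unfolding c using un pn u0 by (simp add: subdegree_eq_0_iff)
  qed
  have upper: "twisted_b1 (\<sigma> \<circ> to_abf) \<le> (\<Sum>j\<in>J. if \<sigma> h0 = w j then \<mu> j else 0)"
    and lower: "\<And>j. j \<in> J \<Longrightarrow> \<sigma> h0 = w j \<Longrightarrow> 1 \<le> twisted_b1 (\<sigma> \<circ> to_abf)"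
    if \<sigma>: "\<sigma> \<in> character_torus" "\<sigma> \<circ> to_abf \<noteq> (\<lambda>_. 1)" for \<sigma> :: "'g abf \<Rightarrow> complex"
  proof -
    obtain g0 where g0: "\<sigma> (to_abf g0) \<noteq> 1" using \<sigma>(2) by (auto simp: fun_eq_iff)
    note b1 = twisted_b1_bounds[OF P \<sigma>(1) g0 chi(1) m assms(4)[unfolded E]]
    show "twisted_b1 (\<sigma> \<circ> to_abf) \<le> (\<Sum>j\<in>J. if \<sigma> h0 = w j then \<mu> j else 0)"
      using b1(1) sub[OF \<sigma>(1)] by simp
    fix j assume j: "j \<in> J" "\<sigma> h0 = w j"
    have "pairing \<sigma> (complexify \<Delta>) = 0"
    proof -
      have "\<mu> j \<le> (\<Sum>j\<in>J. if \<sigma> h0 = w j then \<mu> j else 0)"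
        using member_le_sum[of j J "\<lambda>j. if \<sigma> h0 = w j then \<mu> j else 0"] j assms(7) by simp
      then have "subdegree (curve \<sigma> \<chi> (complexify \<Delta>)) \<noteq> 0"
        using sub[OF \<sigma>(1)] assms(10)[OF j(1)] by simp
      then show ?thesis unfolding curve_nth_0[of \<sigma> \<chi>, symmetric] by (simp add: subdegree_eq_0_iff)
    qed
    then have "eval_int \<sigma> \<Delta> = 0" by (simp add: pairing_complexify)
    then have "eval_int \<sigma> e = 0" if "e \<in> E" for e
      using \<Delta>E[OF that] by (auto simp: eval_int_mult[OF \<sigma>(1)])
    then have "\<not> {x. bar_d1 (\<sigma> \<circ> to_abf) x = 0} \<subseteq> range (bar_d2 (\<sigma> \<circ> to_abf))"
      unfolding E by (rule nontrivial_homology[OF P \<sigma>(1) g0])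
    then show "1 \<le> twisted_b1 (\<sigma> \<circ> to_abf)" using b1(2) sub[OF \<sigma>(1)] by simp
  qed
  have "disjoint_family_on (\<lambda>j. zero_set (f j)) J"
    unfolding disjoint_family_on_def
  proof (intro ballI impI)
    fix i j assume ij: "i \<in> J" "j \<in> J" "i \<noteq> j"
    have inj: "\<sigma> = \<tau>" if "\<sigma> \<circ> to_abf = \<tau> \<circ> (to_abf :: 'g \<Rightarrow> _)" for \<sigma> \<tau> :: "'g abf \<Rightarrow> complex"
    proof
      fix y
      obtain g :: 'g where "y = to_abf g" using ex_to_abf by blast
      then show "\<sigma> y = \<tau> y" using fun_cong[OF that, of g] by simp
    qed
    show "zero_set (f i) \<inter> zero_set (f j) = {}"
    proof (rule ccontr)
      assume "zero_set (f i) \<inter> zero_set (f j) \<noteq> {}"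
      then obtain \<sigma> \<tau> where "\<sigma> \<circ> to_abf = \<tau> \<circ> (to_abf :: 'g \<Rightarrow> _)" "\<sigma> h0 = w i" "\<tau> h0 = w j"
        unfolding zero_set[OF ij(1)] zero_set[OF ij(2)] by blast
      then show False using inj[of \<sigma> \<tau>] w_inj[OF ij(1,2)] ij(3) by simp
    qed
  qed
  moreover have "(characteristic_variety1 \<inter> character_torus0) - {\<lambda>_. 1}
      = (\<Union>j\<in>J. zero_set (f j)) - {\<lambda>_. 1}"
  proof (intro equalityI subsetI)
    fix \<rho> assume \<rho>: "\<rho> \<in> (characteristic_variety1 \<inter> character_torus0) - {\<lambda>_ :: 'g. 1 :: complex}"
    then obtain \<sigma> where \<sigma>: "\<sigma> \<in> character_torus" "\<rho> = \<sigma> \<circ> to_abf" unfolding character_torus0_def by blast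
    have "1 \<le> (\<Sum>j\<in>J. if \<sigma> h0 = w j then \<mu> j else 0)"
      using upper[OF \<sigma>(1)] \<rho> \<sigma>(2) unfolding characteristic_variety1_def by fastforce
    then have "(\<Sum>j\<in>J. if \<sigma> h0 = w j then \<mu> j else 0) \<noteq> 0" by simp
    then have "\<exists>j\<in>J. \<sigma> h0 = w j" using assms(7) by (auto split: if_splits)
    then show "\<rho> \<in> (\<Union>j\<in>J. zero_set (f j)) - {\<lambda>_. 1}" using \<rho> \<sigma> by (auto simp: zero_set)
  next
    fix \<rho> assume \<rho>: "\<rho> \<in> (\<Union>j\<in>J. zero_set (f j)) - {\<lambda>_ :: 'g. 1 :: complex}"
    then obtain j \<sigma> where j: "j \<in> J" and \<sigma>: "\<sigma> \<in> character_torus" "\<rho> = \<sigma> \<circ> to_abf" "\<sigma> h0 = w j"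
      by (auto simp: zero_set)
    have "\<rho> \<in> character_torus"
      unfolding \<sigma>(2) by (simp add: character_torus_def to_abf_add characterD[OF \<sigma>(1)])
    then show "\<rho> \<in> (characteristic_variety1 \<inter> character_torus0) - {\<lambda>_. 1}"
      using lower[OF \<sigma>(1) _ j \<sigma>(3)] \<rho> \<sigma> by (auto simp: characteristic_variety1_def character_torus0_def)
  qed
  moreover have "\<forall>j\<in>J. \<forall>\<rho>\<in>zero_set (f j). \<rho> \<noteq> (\<lambda>_. 1) \<longrightarrow>
      1 \<le> twisted_b1 \<rho> \<and> twisted_b1 \<rho> \<le> \<mu> j"
  proof (intro ballI impI conjI)
    fix j \<rho> assume j: "j \<in> J" and \<rho>: "\<rho> \<in> zero_set (f j)" "\<rho> \<noteq> (\<lambda>_. 1)"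
    then obtain \<sigma> where \<sigma>: "\<sigma> \<in> character_torus" "\<rho> = \<sigma> \<circ> to_abf" "\<sigma> h0 = w j"
      by (auto simp: zero_set)
    show "1 \<le> twisted_b1 \<rho>" using lower[OF \<sigma>(1) _ j \<sigma>(3)] \<rho>(2) \<sigma>(2) by simp
    have "(\<Sum>i\<in>J. if \<sigma> h0 = w i then \<mu> i else 0) = (\<Sum>i\<in>J. if i = j then \<mu> i else 0)"
      using w_inj[OF _ j] \<sigma>(3) by (intro sum.cong) auto
    also have "\<dots> = \<mu> j" using assms(7) j by simp
    finally show "twisted_b1 \<rho> \<le> \<mu> j" using upper[OF \<sigma>(1)] \<rho>(2) \<sigma>(2) by simp
  qed
  ultimately show ?thesis by blast
qed

end
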